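(* Let $\{\mathbf e_k : k\in\mathbb I\}$ be an orthonormal basis of $L^2(\mathbb R^d)$, where $\mathbb I$ is an infinite countable set, and for $k\in\mathbb I$, $j\in\mathbb Z$ put $$\mathbf H_E^{j,k}=\mathcal P^{-1}\left(\int_{2^{-j}E}^{\oplus}\left(L^2(\mathbb R^d)\otimes \mathbf e_k\right)|\det B(\lambda)|\,d\lambda\right).$$ (a) Let $S$ be a finite subset of $\mathbb I$, and for each $k\in S$ let $f_k$ be such that $\{L(\gamma)f_k:\gamma\in\Gamma\}$ is a Parseval frame for $\mathbf H_E^{0,k}$. Then the system $\{D_{A^j}L(\gamma)f_k:\gamma\in\Gamma,\ j\in\mathbb Z,\ k\in S\}$ is a Parseval frame for $\bigoplus_{(k,j)\in S\times\mathbb Z}\mathbf H_E^{j,k}$. (b) For each $k\in\mathbb I$ let $f_k$ be such that $\{L(\gamma)f_k:\gamma\in\Gamma\}$ is a Parseval frame for $\mathbf H_E^{0,k}$. Then the system $\{D_{A^j}L(\gamma)f_k:\gamma\in\Gamma,\ j\in\mathbb Z,\ k\in\mathbb I\}$ is a Parseval frame for $L^2(N)$.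
   Context: Setting. $N$ is a simply connected, connected, non-commutative nilpotent Lie group with Lie algebra $\mathfrak n$ of dimension $n$ over $\mathbb R$, with a rational structure (i.e. $\mathfrak n$ has a basis with rational structure constants), and $J=\{B_1,\dots,B_n\}=\{Z_1,\dots,Z_{n-2d},Y_1,\dots,Y_d,X_1,\dots,X_d\}$ is a fixed ordered Jordan-Hölder basis (each span of an initial segment is an ideal) such that: (C1) $\mathfrak n=\mathfrak z(\mathfrak n)\oplus\mathfrak a\oplus\mathfrak b$ with $\mathfrak z(\mathfrak n)=\mathrm{span}_{\mathbb R}\{Z_i\}$ the center, $\mathfrak a=\mathrm{span}_{\mathbb R}\{Y_i\}$, $\mathfrak b=\mathrm{span}_{\mathbb R}\{X_i\}$; (C2) $\mathfrak z(\mathfrak n)\oplus\mathfrak a$ is a commutative ideal, $\mathfrak b$ is a commutative subalgebra (not an ideal), and $[\mathfrak a,\mathfrak b]\subseteq\mathfrak z(\mathfrak n)$; (C3) with $V=([X_i,Y_j])_{1\le i,j\le d}$, whose entries are regarded as linear functions on $[\mathfrak n,\mathfrak n]^*$, $\det V$ is a nonzero polynomial with rational coefficients; the only possibly nonzero brackets of basis elements are $[X_i,Y_j]=-[Y_j,X_i]$. For $\lambda\in\mathfrak n^*$ let $B(\lambda)=(\lambda[X_i,Y_j])_{1\le i,j\le d}$. Let $\Sigma=\{\lambda\in\mathfrak n^*:\det B(\lambda)\ne0,\ \lambda(X_i)=\lambda(Y_i)=0,\ 1\le i\le d\}$, identified with an open subset of $\mathbb R^{n-2d}$ via $\lambda\mapsto(\lambda(Z_1),\dots,\lambda(Z_{n-2d}))$;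 $d\lambda$ is Lebesgue measure. Let $E=\left([-1/2,1/2]^{n-2d}\setminus[-1/4,1/4]^{n-2d}\right)\cap\Sigma$, and $2^{-j}E=\{2^{-j}\lambda:\lambda\in E\}$. For $\lambda\in\Sigma$, $\pi_\lambda$ is the irreducible unitary representation of $N$ on $L^2(\mathbb R^d)$ with $\pi_\lambda(\exp\sum z_lZ_l)\phi(t)=e^{2\pi i\langle\lambda,z\rangle}\phi(t)$, $\pi_\lambda(\exp\sum y_kY_k)\phi(t)=e^{-2\pi i\langle t,B(\lambda)y\rangle}\phi(t)$, $\pi_\lambda(\exp\sum x_kX_k)\phi(t)=\phi(t-x)$. $N$ carries the Haar measure which is Lebesgue measure in the coordinates $(z,y,x)\mapsto\exp(\sum z_lZ_l)\exp(\sum y_kY_k)\exp(\sum x_kX_k)$. The Fourier transform is $\mathcal Ff(\lambda)=\int_Nf(m)\pi_\lambda(m)\,dm$ on $L^1\cap L^2$ (weakly defined), and the Plancherel transform $\mathcal P$ is its unitary extension $\mathcal P:L^2(N)\to\int_\Sigma^\oplus L^2(\mathbb R^d)\otimes L^2(\mathbb R^d)\,|\det B(\lambda)|\,d\lambda$, where $L^2(\mathbb R^d)\otimes L^2(\mathbb R^d)$ is the space of Hilbert-Schmidt operators, $\phi\otimes\mathbf u$ is the rank-one operator $v\mapsto\langle v,\mathbf u\rangle\phi$, and $L^2(\mathbb R^d)\otimes\mathbf u=\{\phi\otimes\mathbf u:\phi\in L^2(\mathbb R^d)\}$. A direct integral over a subset of $\Sigma$ is viewed as the subspace of fields vanishing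 outside that subset. $L$ is the left regular representation of $N$ on $L^2(N)$. $\Gamma=\exp(\sum_l\mathbb ZZ_l)\exp(\sum_i\mathbb ZY_i)\exp(\sum_k\mathbb ZX_k)\subset N$ (the set of such products). $A$ is the automorphism of $N$ given by $A\big(\exp(\sum z_lZ_l)\exp(\sum y_kY_k)\exp(\sum x_kX_k)\big)=\exp(\sum 2z_lZ_l)\exp(\sum 2y_kY_k)\exp(\sum x_kX_k)$, and $(D_{A^j}f)(x)=2^{-j(n-d)/2}f(A^{-j}(x))$ for $j\in\mathbb Z$, a unitary operator on $L^2(N)$. A countable family $\{f_i\}$ in a Hilbert space $H$ is a Parseval frame for $H$ if $\sum_i|\langle f,f_i\rangle|^2=\|f\|^2$ for all $f\in H$. Direct sums are orthogonal Hilbert-space direct sums inside $L^2(N)$. *)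

theory Defs
  imports "HOL-Analysis.Analysis" "HOL-Algebra.Group"
begin

section \<open>Complex L2 spaces, represented by functions modulo a.e. equality\<close>

definition L2 :: "'a measure \<Rightarrow> ('a \<Rightarrow> complex) set" where
  "L2 M = {f \<in> borel_measurable M. integrable M (\<lambda>x. (cmod (f x))\<^sup>2)}"

definition l2_inner :: "'a measure \<Rightarrow> ('a \<Rightarrow> complex) \<Rightarrow> ('a \<Rightarrow> complex) \<Rightarrow> complex" where
  "l2_inner M f g = (LINT x|M. f x * cnj (g x))"

definition l2_norm :: "'a measure \<Rightarrow> ('a \<Rightarrow> complex) \<Rightarrow> real" where
  "l2_norm M f = sqrt (LINT x|M. (cmod (f x))\<^sup>2)"

definition orthonormal_basis :: "'a measure \<Rightarrow> 'i set \<Rightarrow> ('i \<Rightarrow> 'a \<Rightarrow> complex) \<Rightarrow> bool" where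
  "orthonormal_basis M I u \<longleftrightarrow>
     (\<forall>i\<in>I. u i \<in> L2 M) \<and>
     (\<forall>i\<in>I. \<forall>j\<in>I. l2_inner M (u i) (u j) = (if i = j then 1 else 0)) \<and>
     (\<forall>f\<in>L2 M. \<forall>\<epsilon>>0. \<exists>F c. finite F \<and> F \<subseteq> I \<and>
        l2_norm M (\<lambda>x. f x - (\<Sum>i\<in>F. c i * u i x)) < \<epsilon>)"

definition parseval_frame ::
    "'a measure \<Rightarrow> ('a \<Rightarrow> complex) set \<Rightarrow> 'i set \<Rightarrow> ('i \<Rightarrow> 'a \<Rightarrow> complex) \<Rightarrow> bool" where
  "parseval_frame M H I F \<longleftrightarrow>
     countable I \<and> (\<forall>i\<in>I. F i \<in> H) \<and>
     (\<forall>f\<in>H. ((\<lambda>i. (cmod (l2_inner M f (F i)))\<^sup>2) has_sum (l2_norm M f)\<^sup>2) I)"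

definition orthogonal_family ::
    "'a measure \<Rightarrow> 'i set \<Rightarrow> ('i \<Rightarrow> ('a \<Rightarrow> complex) set) \<Rightarrow> bool" where
  "orthogonal_family M I H \<longleftrightarrow>
     (\<forall>i\<in>I. \<forall>j\<in>I. i \<noteq> j \<longrightarrow> (\<forall>f\<in>H i. \<forall>g\<in>H j. l2_inner M f g = 0))"

text \<open>The Hilbert space sum of an orthogonal family of closed subspaces: all norm-convergent
  sums \<open>\<Sum>\<^sub>i h\<^sub>i\<close> with \<open>h\<^sub>i \<in> H\<^sub>i\<close>.\<close>

definition hilbert_sum ::
    "'a measure \<Rightarrow> 'i set \<Rightarrow> ('i \<Rightarrow> ('a \<Rightarrow> complex) set) \<Rightarrow> ('a \<Rightarrow> complex) set" where
  "hilbert_sum M I H =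
     {f \<in> L2 M. \<exists>h. (\<forall>i\<in>I. h i \<in> H i) \<and>
        ((\<lambda>F. l2_norm M (\<lambda>x. f x - (\<Sum>i\<in>F. h i x))) \<longlongrightarrow> 0) (finite_subsets_at_top I)}"


section \<open>Operators on the L2 space of a Euclidean space\<close>

type_synonym 'd oper = "(real^'d \<Rightarrow> complex) \<Rightarrow> (real^'d \<Rightarrow> complex)"

definition op_eq :: "'d::finite oper \<Rightarrow> 'd oper \<Rightarrow> bool" where
  "op_eq S T \<longleftrightarrow> (\<forall>\<phi>\<in>L2 lborel. AE t in lborel. S \<phi> t = T \<phi> t)"

definition bounded_operator :: "'d::finite oper \<Rightarrow> bool" where
  "bounded_operator T \<longleftrightarrow>
     (\<forall>\<phi>\<in>L2 lborel. T \<phi> \<in> L2 lborel) \<and>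
     (\<forall>\<phi>\<in>L2 lborel. \<forall>\<psi>\<in>L2 lborel. \<forall>a b.
        AE t in lborel. T (\<lambda>t. a * \<phi> t + b * \<psi> t) t = a * T \<phi> t + b * T \<psi> t) \<and>
     (\<exists>C. \<forall>\<phi>\<in>L2 lborel. l2_norm lborel (T \<phi>) \<le> C * l2_norm lborel \<phi>)"

text \<open>For a bounded operator the sum has the same value for every orthonormal basis \<open>U\<close>, so the
  supremum only serves to avoid choosing one.\<close>

definition hs_norm_sq :: "'d::finite oper \<Rightarrow> ennreal" where
  "hs_norm_sq T =
     (SUP U\<in>{U. orthonormal_basis lborel U (\<lambda>u. u)}.
        \<Sum>\<^sub>\<infinity>u\<in>U. ennreal ((l2_norm lborel (T u))\<^sup>2))"

definition hilbert_schmidt :: "'d::finite oper \<Rightarrow> bool" where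
  "hilbert_schmidt T \<longleftrightarrow> bounded_operator T \<and> hs_norm_sq T < \<infinity>"

definition rank_one :: "(real^'d::finite \<Rightarrow> complex) \<Rightarrow> (real^'d \<Rightarrow> complex) \<Rightarrow> 'd oper" where
  "rank_one \<phi> u v = (\<lambda>t. l2_inner lborel v u * \<phi> t)"


section \<open>Lie algebras\<close>

definition lie_algebra :: "('n::real_vector \<Rightarrow> 'n \<Rightarrow> 'n) \<Rightarrow> bool" where
  "lie_algebra br \<longleftrightarrow> bilinear br \<and> (\<forall>x. br x x = 0) \<and>
     (\<forall>x y z. br x (br y z) + br y (br z x) + br z (br x y) = 0)"

fun lower_central_series :: "('n::real_vector \<Rightarrow> 'n \<Rightarrow> 'n) \<Rightarrow> nat \<Rightarrow> 'n set" where
  "lower_central_series br 0 = UNIV"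
| "lower_central_series br (Suc k) = span {br x y | x y. y \<in> lower_central_series br k}"

definition lie_nilpotent :: "('n::real_vector \<Rightarrow> 'n \<Rightarrow> 'n) \<Rightarrow> bool" where
  "lie_nilpotent br \<longleftrightarrow> (\<exists>k. lower_central_series br k = {0})"

definition lie_center :: "('n::real_vector \<Rightarrow> 'n \<Rightarrow> 'n) \<Rightarrow> 'n set" where
  "lie_center br = {x. \<forall>y. br x y = 0}"

definition lie_subalgebra :: "('n::real_vector \<Rightarrow> 'n \<Rightarrow> 'n) \<Rightarrow> 'n set \<Rightarrow> bool" where
  "lie_subalgebra br V \<longleftrightarrow> subspace V \<and> (\<forall>x\<in>V. \<forall>y\<in>V. br x y \<in> V)"

definition lie_ideal :: "('n::real_vector \<Rightarrow> 'n \<Rightarrow> 'n) \<Rightarrow> 'n set \<Rightarrow> bool" where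
  "lie_ideal br V \<longleftrightarrow> subspace V \<and> (\<forall>x. \<forall>y\<in>V. br x y \<in> V)"

definition lie_commutative_on :: "('n::real_vector \<Rightarrow> 'n \<Rightarrow> 'n) \<Rightarrow> 'n set \<Rightarrow> bool" where
  "lie_commutative_on br V \<longleftrightarrow> (\<forall>x\<in>V. \<forall>y\<in>V. br x y = 0)"

definition rational_structure :: "('n::real_vector \<Rightarrow> 'n \<Rightarrow> 'n) \<Rightarrow> bool" where
  "rational_structure br \<longleftrightarrow>
     (\<exists>C. independent C \<and> span C = UNIV \<and>
        (\<forall>x\<in>C. \<forall>y\<in>C. \<forall>c\<in>C. representation C (br x y) c \<in> \<rat>))"


section \<open>The class of groups\<close>

text \<open>The group \<open>N\<close> is the underlying monoid; \<open>'n\<close> is its Lie algebra. The index type \<open>'z\<close> has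
  \<open>n - 2d\<close> elements and \<open>'d\<close> has \<open>d\<close> elements; their linear orders, with the blocks arranged as
  \<open>Z, Y, X\<close>, give the order of the Jordan-Hoelder basis.\<close>

record ('g, 'n, 'z, 'd) nilpotent_group = "'g monoid" +
  bracket :: "'n \<Rightarrow> 'n \<Rightarrow> 'n"
  lie_exp :: "'n \<Rightarrow> 'g"
  Zb :: "'z \<Rightarrow> 'n"
  Yb :: "'d \<Rightarrow> 'n"
  Xb :: "'d \<Rightarrow> 'n"

definition jh_basis :: "('g, 'n, 'z, 'd) nilpotent_group \<Rightarrow> 'z + 'd + 'd \<Rightarrow> 'n" where
  "jh_basis G = case_sum (Zb G) (case_sum (Yb G) (Xb G))"

text \<open>The vector \<open>l\<close> stands for the linear functional with value \<open>l $ i\<close> at \<open>Z\<^sub>i\<close> that vanishes at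
  all \<open>Y\<^sub>i\<close> and \<open>X\<^sub>i\<close>.\<close>

definition functional ::
    "('g, 'n::real_vector, 'z::finite, 'd) nilpotent_group \<Rightarrow> real^'z \<Rightarrow> 'n \<Rightarrow> real" where
  "functional G l v = (\<Sum>i\<in>UNIV. l $ i * representation (range (jh_basis G)) v (Zb G i))"

definition B_matrix ::
    "('g, 'n::real_vector, 'z::finite, 'd::finite) nilpotent_group \<Rightarrow> real^'z \<Rightarrow> real^'d^'d" where
  "B_matrix G l = (\<chi> i j. functional G l (bracket G (Xb G i) (Yb G j)))"

definition rational_polynomial :: "(real^'z::finite \<Rightarrow> real) \<Rightarrow> bool" where
  "rational_polynomial p \<longleftrightarrow>
     (\<exists>(M :: ('z \<Rightarrow> nat) set) (q :: ('z \<Rightarrow> nat) \<Rightarrow> rat). finite M \<and>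
        (\<forall>l. p l = (\<Sum>m\<in>M. of_rat (q m) * (\<Prod>i\<in>UNIV. l $ i ^ m i))))"

text \<open>A connected, simply connected nilpotent Lie group is determined by its Lie algebra: the
  exponential map is bijective and multiplication is given by the Baker-Campbell-Hausdorff formula.
  Conditions (C1) and (C2) put all brackets into the center, so that formula stops after the first
  bracket. Independence of \<open>jh_basis G\<close> makes the sum in (C1) direct. In (C3), each \<open>[X\<^sub>i,Y\<^sub>j]\<close> lies
  in the span of the \<open>Z\<^sub>l\<close>; \<open>det V\<close> is read as a polynomial in the \<open>Z\<^sub>l\<close>, whose value at a functional
  with coordinates \<open>l\<close> is \<open>det (B_matrix G l)\<close>.\<close>

definition nilpotent_setting ::
    "('g, 'n::real_vector, 'z::{finite,linorder}, 'd::{finite,linorder}) nilpotent_group \<Rightarrow> bool" where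
  "nilpotent_setting G \<longleftrightarrow>
     \<comment> \<open>Lie algebra\<close>
     lie_algebra (bracket G) \<and> lie_nilpotent (bracket G) \<and>
     \<not> lie_commutative_on (bracket G) UNIV \<and> rational_structure (bracket G) \<and>
     \<comment> \<open>Lie group\<close>
     group G \<and> bij_betw (lie_exp G) UNIV (carrier G) \<and>
     (\<forall>v w. lie_exp G v \<otimes>\<^bsub>G\<^esub> lie_exp G w
        = lie_exp G (v + w + (1/2) *\<^sub>R bracket G v w)) \<and>
     \<comment> \<open>Jordan-Hoelder basis\<close>
     inj (jh_basis G) \<and> independent (range (jh_basis G)) \<and> span (range (jh_basis G)) = UNIV \<and>
     (\<forall>i. lie_ideal (bracket G) (span (Zb G ` {..i}))) \<and>
     (\<forall>i. lie_ideal (bracket G) (span (range (Zb G) \<union> Yb G ` {..i}))) \<and>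
     (\<forall>i. lie_ideal (bracket G) (span (range (Zb G) \<union> range (Yb G) \<union> Xb G ` {..i}))) \<and>
     \<comment> \<open>(C1)\<close>
     lie_center (bracket G) = span (range (Zb G)) \<and>
     \<comment> \<open>(C2)\<close>
     lie_ideal (bracket G) (span (range (Zb G) \<union> range (Yb G))) \<and>
     lie_commutative_on (bracket G) (span (range (Zb G) \<union> range (Yb G))) \<and>
     lie_subalgebra (bracket G) (span (range (Xb G))) \<and>
     lie_commutative_on (bracket G) (span (range (Xb G))) \<and>
     \<not> lie_ideal (bracket G) (span (range (Xb G))) \<and>
     (\<forall>v\<in>span (range (Yb G)). \<forall>w\<in>span (range (Xb G)). bracket G v w \<in> lie_center (bracket G)) \<and>
     \<comment> \<open>(C3)\<close>
     rational_polynomial (\<lambda>l. det (B_matrix G l)) \<and> (\<exists>l. det (B_matrix G l) \<noteq> 0) \<and>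
     (\<forall>p q. bracket G (jh_basis G p) (jh_basis G q) \<noteq> 0 \<longrightarrow>
        (\<exists>i j. p = Inr (Inr i) \<and> q = Inr (Inl j) \<or> p = Inr (Inl j) \<and> q = Inr (Inr i)))"

definition exp_Z :: "('g, 'n::real_vector, 'z::finite, 'd) nilpotent_group \<Rightarrow> real^'z \<Rightarrow> 'g" where
  "exp_Z G z = lie_exp G (\<Sum>i\<in>UNIV. z $ i *\<^sub>R Zb G i)"

definition exp_Y :: "('g, 'n::real_vector, 'z, 'd::finite) nilpotent_group \<Rightarrow> real^'d \<Rightarrow> 'g" where
  "exp_Y G y = lie_exp G (\<Sum>i\<in>UNIV. y $ i *\<^sub>R Yb G i)"

definition exp_X :: "('g, 'n::real_vector, 'z, 'd::finite) nilpotent_group \<Rightarrow> real^'d \<Rightarrow> 'g" where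
  "exp_X G x = lie_exp G (\<Sum>i\<in>UNIV. x $ i *\<^sub>R Xb G i)"

definition chart :: "('g, 'n::real_vector, 'z::finite, 'd::finite) nilpotent_group \<Rightarrow>
    (real^'z) \<times> (real^'d) \<times> (real^'d) \<Rightarrow> 'g" where
  "chart G = (\<lambda>(z, y, x). exp_Z G z \<otimes>\<^bsub>G\<^esub> exp_Y G y \<otimes>\<^bsub>G\<^esub> exp_X G x)"

definition coords :: "('g, 'n::real_vector, 'z::finite, 'd::finite) nilpotent_group \<Rightarrow>
    'g \<Rightarrow> (real^'z) \<times> (real^'d) \<times> (real^'d)" where
  "coords G = inv_into UNIV (chart G)"

definition haar :: "('g, 'n::real_vector, 'z::finite, 'd::finite) nilpotent_group \<Rightarrow> 'g measure" where
  "haar G = embed_measure lborel (chart G)"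

definition Gamma_set :: "('g, 'n::real_vector, 'z::finite, 'd::finite) nilpotent_group \<Rightarrow> 'g set" where
  "Gamma_set G = {chart G (z, y, x) | z y x.
     (\<forall>i. z $ i \<in> \<int>) \<and> (\<forall>i. y $ i \<in> \<int>) \<and> (\<forall>i. x $ i \<in> \<int>)}"

definition left_translation ::
    "('g, 'n, 'z, 'd) nilpotent_group \<Rightarrow> 'g \<Rightarrow> ('g \<Rightarrow> complex) \<Rightarrow> 'g \<Rightarrow> complex" where
  "left_translation G \<gamma> f = (\<lambda>m. f (inv\<^bsub>G\<^esub> \<gamma> \<otimes>\<^bsub>G\<^esub> m))"

definition A_aut :: "('g, 'n::real_vector, 'z::finite, 'd::finite) nilpotent_group \<Rightarrow> 'g \<Rightarrow> 'g" where
  "A_aut G m = (case coords G m of (z, y, x) \<Rightarrow> chart G (2 *\<^sub>R z, 2 *\<^sub>R y, x))"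

definition A_power ::
    "('g, 'n::real_vector, 'z::finite, 'd::finite) nilpotent_group \<Rightarrow> int \<Rightarrow> 'g \<Rightarrow> 'g" where
  "A_power G j =
     (if 0 \<le> j then A_aut G ^^ nat j else inv_into (carrier G) (A_aut G) ^^ nat (- j))"

text \<open>Here \<open>n - d = CARD('z) + CARD('d)\<close>.\<close>

definition dilation :: "('g, 'n::real_vector, 'z::finite, 'd::finite) nilpotent_group \<Rightarrow>
    int \<Rightarrow> ('g \<Rightarrow> complex) \<Rightarrow> 'g \<Rightarrow> complex" where
  "dilation G j f =
     (\<lambda>m. of_real (2 powr (- (of_int j * real (CARD('z) + CARD('d)) / 2))) * f (A_power G (- j) m))"


section \<open>Plancherel transform\<close>

definition Sigma_set :: "('g, 'n::real_vector, 'z::finite, 'd::finite) nilpotent_group \<Rightarrow> (real^'z) set" where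
  "Sigma_set G = {l. det (B_matrix G l) \<noteq> 0}"

definition plancherel_measure ::
    "('g, 'n::real_vector, 'z::finite, 'd::finite) nilpotent_group \<Rightarrow> (real^'z) measure" where
  "plancherel_measure G =
     density (restrict_space lborel (Sigma_set G)) (\<lambda>l. ennreal \<bar>det (B_matrix G l)\<bar>)"

definition pi_Z :: "real^'z::finite \<Rightarrow> real^'z \<Rightarrow> 'd::finite oper" where
  "pi_Z l z \<phi> = (\<lambda>t. cis (2 * pi * (l \<bullet> z)) * \<phi> t)"

definition pi_Y :: "('g, 'n::real_vector, 'z::finite, 'd::finite) nilpotent_group \<Rightarrow>
    real^'z \<Rightarrow> real^'d \<Rightarrow> 'd oper" where
  "pi_Y G l y \<phi> = (\<lambda>t. cis (- (2 * pi * (t \<bullet> (B_matrix G l *v y)))) * \<phi> t)"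

definition pi_X :: "real^'d::finite \<Rightarrow> 'd oper" where
  "pi_X x \<phi> = (\<lambda>t. \<phi> (t - x))"

definition rep :: "('g, 'n::real_vector, 'z::finite, 'd::finite) nilpotent_group \<Rightarrow>
    real^'z \<Rightarrow> 'g \<Rightarrow> 'd oper" where
  "rep G l m = (case coords G m of (z, y, x) \<Rightarrow> pi_Z l z \<circ> pi_Y G l y \<circ> pi_X x)"

text \<open>\<open>is_fourier G f l T\<close>: \<open>T\<close> is the weak integral of \<open>f(m) \<pi>\<^sub>l(m)\<close> over the group.\<close>

definition is_fourier :: "('g, 'n::real_vector, 'z::finite, 'd::finite) nilpotent_group \<Rightarrow>
    ('g \<Rightarrow> complex) \<Rightarrow> real^'z \<Rightarrow> 'd oper \<Rightarrow> bool" where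
  "is_fourier G f l T \<longleftrightarrow>
     (\<forall>\<phi>\<in>L2 lborel. \<forall>\<psi>\<in>L2 lborel.
        l2_inner lborel (T \<phi>) \<psi> = (LINT m|haar G. f m * l2_inner lborel (rep G l m \<phi>) \<psi>))"

definition direct_integral ::
    "('g, 'n::real_vector, 'z::finite, 'd::finite) nilpotent_group \<Rightarrow> (real^'z \<Rightarrow> 'd oper) set" where
  "direct_integral G = {T.
     (\<forall>l\<in>Sigma_set G. hilbert_schmidt (T l)) \<and>
     (\<forall>\<phi>\<in>L2 lborel. \<forall>\<psi>\<in>L2 lborel.
        (\<lambda>l. l2_inner lborel (T l \<phi>) \<psi>) \<in> borel_measurable (plancherel_measure G)) \<and>
     (\<integral>\<^sup>+ l. hs_norm_sq (T l) \<partial>plancherel_measure G) < \<infinity>}"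

definition field_eq :: "('g, 'n::real_vector, 'z::finite, 'd::finite) nilpotent_group \<Rightarrow>
    (real^'z \<Rightarrow> 'd oper) \<Rightarrow> (real^'z \<Rightarrow> 'd oper) \<Rightarrow> bool" where
  "field_eq G S T \<longleftrightarrow> (AE l in plancherel_measure G. op_eq (S l) (T l))"

text \<open>\<open>P\<close> is the unitary (linear, isometric, surjective) map from \<open>L2(N)\<close> to the direct integral
  that extends the Fourier transform on \<open>L1 \<inter> L2\<close>.\<close>

definition plancherel_transform :: "('g, 'n::real_vector, 'z::finite, 'd::finite) nilpotent_group \<Rightarrow>
    (('g \<Rightarrow> complex) \<Rightarrow> real^'z \<Rightarrow> 'd oper) \<Rightarrow> bool" where
  "plancherel_transform G P \<longleftrightarrow>
     (\<forall>f\<in>L2 (haar G). P f \<in> direct_integral G) \<and>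
     (\<forall>f\<in>L2 (haar G). \<forall>g\<in>L2 (haar G). \<forall>a b.
        field_eq G (P (\<lambda>m. a * f m + b * g m)) (\<lambda>l \<phi> t. a * P f l \<phi> t + b * P g l \<phi> t)) \<and>
     (\<forall>f\<in>L2 (haar G).
        (\<integral>\<^sup>+ l. hs_norm_sq (P f l) \<partial>plancherel_measure G) = ennreal ((l2_norm (haar G) f)\<^sup>2)) \<and>
     (\<forall>T\<in>direct_integral G. \<exists>f\<in>L2 (haar G). field_eq G (P f) T) \<and>
     (\<forall>f\<in>L2 (haar G). integrable (haar G) f \<longrightarrow>
        (AE l in plancherel_measure G. is_fourier G f l (P f l)))"

definition E_set :: "('g, 'n::real_vector, 'z::finite, 'd::finite) nilpotent_group \<Rightarrow> (real^'z) set" where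
  "E_set G = (cbox (\<chi> i. -1/2) (\<chi> i. 1/2) - cbox (\<chi> i. -1/4) (\<chi> i. 1/4)) \<inter> Sigma_set G"

definition E_scaled ::
    "('g, 'n::real_vector, 'z::finite, 'd::finite) nilpotent_group \<Rightarrow> int \<Rightarrow> (real^'z) set" where
  "E_scaled G j = (\<lambda>l. (2 powi (- j)) *\<^sub>R l) ` E_set G"

text \<open>The direct integral of \<open>L2 \<otimes> u\<close> over \<open>C\<close>, as fields vanishing outside \<open>C\<close>.\<close>

definition direct_integral_over :: "('g, 'n::real_vector, 'z::finite, 'd::finite) nilpotent_group \<Rightarrow>
    (real^'z) set \<Rightarrow> (real^'d \<Rightarrow> complex) \<Rightarrow> (real^'z \<Rightarrow> 'd oper) set" where
  "direct_integral_over G C u = {T \<in> direct_integral G.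
     AE l in plancherel_measure G.
       (l \<in> C \<longrightarrow> (\<exists>\<phi>\<in>L2 lborel. op_eq (T l) (rank_one \<phi> u))) \<and>
       (l \<notin> C \<longrightarrow> op_eq (T l) (\<lambda>_ _. 0))}"

definition H_space :: "('g, 'n::real_vector, 'z::finite, 'd::finite) nilpotent_group \<Rightarrow>
    (('g \<Rightarrow> complex) \<Rightarrow> real^'z \<Rightarrow> 'd oper) \<Rightarrow> int \<Rightarrow> (real^'d \<Rightarrow> complex) \<Rightarrow> ('g \<Rightarrow> complex) set" where
  "H_space G P j u = {f \<in> L2 (haar G). P f \<in> direct_integral_over G (E_scaled G j) u}"

end

theory Submission
  imports Defs
begin

text \<open>Everything is read off from the matrix coefficients
  \<open>\<langle>(P f)(l) e\<^sub>k, e\<^sub>i\<rangle>\<close>. As the Hilbert-Schmidt norm is computed by any orthonormal basis, \<open>P\<close>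
  turns \<open>\<parallel>f\<parallel>\<^sup>2\<close> into the integral over \<open>l\<close> of the sum over \<open>k, i\<close> of their squared moduli, and
  \<open>f\<close> belongs to \<open>H_space G P j (e k)\<close> iff its coefficients vanish outside column \<open>k\<close> and off
  \<open>2\<^sup>-\<^sup>j E\<close>. Since the sets \<open>2\<^sup>-\<^sup>j E\<close> tile \<open>\<Sigma>\<close>, these spaces are mutually orthogonal and sum to
  \<open>L2 (haar G)\<close>. The representation satisfies \<open>\<pi>\<^sub>l \<circ> A = \<pi>\<^sub>2\<^sub>l\<close>, so the \<open>j\<close>-th dilation acts on
  coefficients by \<open>l \<mapsto> 2\<^sup>j l\<close> up to a constant, and it maps the spaces of level \<open>0\<close> unitarily onto
  those of level \<open>j\<close>, carrying the given Parseval frames along. The union of Parseval frames of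
  orthogonal subspaces is a Parseval frame of their sum.\<close>

section \<open>Square-integrable functions\<close>

text \<open>\<open>P\<close> is known explicitly only on integrable functions, through weak
  integrals and for almost every l, and the operators are maps on functions that are linear only up
  to null sets. Inner products do not see null sets, so the coefficients in a fixed basis are
  genuine measurable functions of l, and countability of \<open>I\<close> lets all of them share one
  exceptional null set. The isometry of \<open>P\<close> speaks of norms only; orthogonality is
  recovered from it by polarization. Surjectivity of \<open>P\<close> turns a truncated field of
  operators back into a function and so supplies the components of f.

  One exponent n - d, that is \<open>CARD('z) + CARD('d)\<close>, governs both sides. On the group,
  A stretches the n - 2d central coordinates and the d coordinates y. On the dual, Lebesgue measure
  contributes n - 2d and the weight |det B(l)|, homogeneous of degree d, contributes the rest. Hence
  the constant that makes the dilation unitary on the group is also the one that makes rescaling of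
  l unitary on the dual.\<close>

lemma borel_measurable_cnj [measurable (raw)]:
  "f \<in> borel_measurable M \<Longrightarrow> (\<lambda>x. cnj (f x)) \<in> borel_measurable M"
  by (rule borel_measurable_continuous_on[OF continuous_on_cnj[OF continuous_on_id]])

lemma L2_measurable: "f \<in> L2 M \<Longrightarrow> f \<in> borel_measurable M"
  and L2_integrable: "f \<in> L2 M \<Longrightarrow> integrable M (\<lambda>x. (cmod (f x))\<^sup>2)"
  by (auto simp: L2_def)

lemma L2_zero [simp]: "(\<lambda>x. 0) \<in> L2 M"
  by (simp add: L2_def)

lemma L2_cmult [intro]: "f \<in> L2 M \<Longrightarrow> (\<lambda>x. c * f x) \<in> L2 M"
  by (auto simp: L2_def norm_mult power_mult_distrib)

lemma L2_add [intro]: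
  assumes "f \<in> L2 M" "g \<in> L2 M"
  shows "(\<lambda>x. f x + g x) \<in> L2 M"
proof -
  have [measurable]: "f \<in> borel_measurable M" "g \<in> borel_measurable M"
    using assms by (auto simp: L2_def)
  have "integrable M (\<lambda>x. (cmod (f x + g x))\<^sup>2)"
  proof (rule Bochner_Integration.integrable_bound)
    show "integrable M (\<lambda>x. 2 * (cmod (f x))\<^sup>2 + 2 * (cmod (g x))\<^sup>2)"
      using assms by (auto simp: L2_def)
    have "(cmod (f x + g x))\<^sup>2 \<le> 2 * (cmod (f x))\<^sup>2 + 2 * (cmod (g x))\<^sup>2" for x
    proof -
      have "(cmod (f x + g x))\<^sup>2 \<le> (cmod (f x) + cmod (g x))\<^sup>2"
        by (simp add: norm_triangle_ineq power_mono)
      also have "\<dots> \<le> 2 * (cmod (f x))\<^sup>2 + 2 * (cmod (g x))\<^sup>2"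
        using sum_squares_bound[of "cmod (f x)" "cmod (g x)"] by (simp add: power2_sum)
      finally show ?thesis .
    qed
    then show "AE x in M. norm ((cmod (f x + g x))\<^sup>2) \<le> norm (2 * (cmod (f x))\<^sup>2 + 2 * (cmod (g x))\<^sup>2)"
      by auto
  qed measurable
  then show ?thesis
    by (simp add: L2_def)
qed

lemma L2_diff [intro]: "f \<in> L2 M \<Longrightarrow> g \<in> L2 M \<Longrightarrow> (\<lambda>x. f x - g x) \<in> L2 M"
  using L2_add[OF _ L2_cmult[where c="-1"], of f M g] by simp

lemma L2_sum [intro]: "(\<And>i. i \<in> F \<Longrightarrow> f i \<in> L2 M) \<Longrightarrow> (\<lambda>x. \<Sum>i\<in>F. f i x) \<in> L2 M"
  by (induction F rule: infinite_finite_induct) auto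

lemma L2_mult_integrable:
  assumes "f \<in> L2 M" "g \<in> L2 M"
  shows "integrable M (\<lambda>x. f x * cnj (g x))"
proof (rule Bochner_Integration.integrable_bound)
  show "integrable M (\<lambda>x. (cmod (f x))\<^sup>2 + (cmod (g x))\<^sup>2)"
    using assms by (auto simp: L2_def)
  show "(\<lambda>x. f x * cnj (g x)) \<in> borel_measurable M"
    using assms[THEN L2_measurable] by measurable
  have "cmod (f x * cnj (g x)) \<le> (cmod (f x))\<^sup>2 + (cmod (g x))\<^sup>2" for x
    using sum_squares_bound[of "cmod (f x)" "cmod (g x)"]
      mult_nonneg_nonneg[OF norm_ge_zero[of "f x"] norm_ge_zero[of "g x"]]
    unfolding norm_mult complex_mod_cnj mult.assoc by linarith
  then show "AE x in M. norm (f x * cnj (g x)) \<le> norm ((cmod (f x))\<^sup>2 + (cmod (g x))\<^sup>2)"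
    by auto
qed

lemma l2_inner_commute: "l2_inner M g f = cnj (l2_inner M f g)"
  using Bochner_Integration.integral_cnj[of M "\<lambda>x. f x * cnj (g x)"] by (simp add: l2_inner_def mult.commute)

lemma l2_inner_add_left:
  assumes "f \<in> L2 M" "g \<in> L2 M" "h \<in> L2 M"
  shows "l2_inner M (\<lambda>x. f x + g x) h = l2_inner M f h + l2_inner M g h"
  using L2_mult_integrable[OF assms(1,3)] L2_mult_integrable[OF assms(2,3)]
  by (simp add: l2_inner_def distrib_right)

lemma l2_inner_cmult_left: "l2_inner M (\<lambda>x. c * f x) h = c * l2_inner M f h"
  by (simp add: l2_inner_def mult.assoc)

lemma l2_inner_cmult_right: "l2_inner M h (\<lambda>x. c * f x) = cnj c * l2_inner M h f"
  by (simp add: l2_inner_def mult.left_commute)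

lemma l2_inner_diff_left:
  assumes "f \<in> L2 M" "g \<in> L2 M" "h \<in> L2 M"
  shows "l2_inner M (\<lambda>x. f x - g x) h = l2_inner M f h - l2_inner M g h"
  using L2_mult_integrable[OF assms(1,3)] L2_mult_integrable[OF assms(2,3)]
  by (simp add: l2_inner_def left_diff_distrib)

lemma l2_inner_zero_left [simp]: "l2_inner M (\<lambda>x. 0) h = 0"
  by (simp add: l2_inner_def)

lemma l2_inner_zero_right [simp]: "l2_inner M h (\<lambda>x. 0) = 0"
  by (simp add: l2_inner_def)

lemma l2_inner_sum_left:
  assumes "\<And>i. i \<in> F \<Longrightarrow> f i \<in> L2 M" "h \<in> L2 M"
  shows "l2_inner M (\<lambda>x. \<Sum>i\<in>F. f i x) h = (\<Sum>i\<in>F. l2_inner M (f i) h)"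
  using assms
  by (induction F rule: infinite_finite_induct) (simp_all add: l2_inner_add_left L2_sum)

lemma l2_inner_sum_right:
  assumes "\<And>i. i \<in> F \<Longrightarrow> f i \<in> L2 M" "h \<in> L2 M"
  shows "l2_inner M h (\<lambda>x. \<Sum>i\<in>F. f i x) = (\<Sum>i\<in>F. l2_inner M h (f i))"
proof -
  have "l2_inner M h (\<lambda>x. \<Sum>i\<in>F. f i x) = cnj (l2_inner M (\<lambda>x. \<Sum>i\<in>F. f i x) h)"
    by (rule l2_inner_commute)
  also have "\<dots> = (\<Sum>i\<in>F. cnj (l2_inner M (f i) h))"
    using assms by (simp add: l2_inner_sum_left)
  also have "\<dots> = (\<Sum>i\<in>F. l2_inner M h (f i))"
    by (simp add: l2_inner_commute[of M h, symmetric])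
  finally show ?thesis .
qed

lemma l2_inner_cong_AE:
  assumes "f \<in> borel_measurable M" "f' \<in> borel_measurable M" "g \<in> borel_measurable M"
    "g' \<in> borel_measurable M" "AE x in M. f x = f' x" "AE x in M. g x = g' x"
  shows "l2_inner M f g = l2_inner M f' g'"
  unfolding l2_inner_def using assms by (intro integral_cong_AE) (measurable, auto)

lemma l2_norm_nonneg [simp]: "0 \<le> l2_norm M f"
  by (simp add: l2_norm_def)

lemma l2_norm_zero [simp]: "l2_norm M (\<lambda>x. 0) = 0"
  by (simp add: l2_norm_def)

lemma l2_norm_square: "(l2_norm M f)\<^sup>2 = (LINT x|M. (cmod (f x))\<^sup>2)"
  by (simp add: l2_norm_def)

lemma l2_inner_self: "l2_inner M f f = of_real ((l2_norm M f)\<^sup>2)"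
  by (simp add: l2_inner_def l2_norm_square complex_norm_square[symmetric]
      del: of_real_power)

lemma l2_norm_cmult: "l2_norm M (\<lambda>x. c * f x) = cmod c * l2_norm M f"
  by (simp add: l2_norm_def norm_mult power_mult_distrib real_sqrt_mult)

lemma l2_norm_eq_0_iff:
  assumes "f \<in> L2 M"
  shows "l2_norm M f = 0 \<longleftrightarrow> (AE x in M. f x = 0)"
  using integral_nonneg_eq_0_iff_AE[OF L2_integrable[OF assms]]
  by (simp add: l2_norm_def)

lemma l2_norm_add_square:
  assumes "f \<in> L2 M" "g \<in> L2 M"
  shows "(l2_norm M (\<lambda>x. f x + g x))\<^sup>2
    = (l2_norm M f)\<^sup>2 + (l2_norm M g)\<^sup>2 + 2 * Re (l2_inner M f g)"
proof -
  note [intro] = L2_add assms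
  let ?h = "\<lambda>x. f x + g x"
  have "l2_inner M ?h ?h = l2_inner M f ?h + l2_inner M g ?h"
    by (intro l2_inner_add_left) auto
  also have "l2_inner M f ?h = cnj (l2_inner M ?h f)" by (rule l2_inner_commute)
  also have "l2_inner M ?h f = l2_inner M f f + l2_inner M g f"
    by (intro l2_inner_add_left) auto
  also have "l2_inner M g ?h = cnj (l2_inner M ?h g)" by (rule l2_inner_commute)
  also have "l2_inner M ?h g = l2_inner M f g + l2_inner M g g"
    by (intro l2_inner_add_left) auto
  also have "l2_inner M g f = cnj (l2_inner M f g)" by (rule l2_inner_commute)
  finally have "Re (l2_inner M ?h ?h) = Re (cnj (l2_inner M f f + cnj (l2_inner M f g))
      + cnj (l2_inner M f g + l2_inner M g g))"
    by simp
  then show ?thesis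
    by (simp add: l2_inner_self del: of_real_power)
qed

lemma l2_norm_diff_square:
  assumes "f \<in> L2 M" "g \<in> L2 M"
  shows "(l2_norm M (\<lambda>x. f x - g x))\<^sup>2
    = (l2_norm M f)\<^sup>2 + (l2_norm M g)\<^sup>2 - 2 * Re (l2_inner M f g)"
  using l2_norm_add_square[OF assms(1) L2_cmult[OF assms(2), of "-1"]]
  by (simp add: l2_norm_cmult l2_inner_cmult_right[where c="-1", simplified] l2_norm_cmult[where c="-1", simplified])

text \<open>A function g of norm 0 need not be the zero function, only zero almost everywhere, hence
  the separate case.\<close>

lemma l2_Cauchy_Schwarz:
  assumes f: "f \<in> L2 M" and g: "g \<in> L2 M"
  shows "cmod (l2_inner M f g) \<le> l2_norm M f * l2_norm M g"
proof (cases "l2_norm M g = 0")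
  case True
  then have "AE x in M. g x = 0"
    using l2_norm_eq_0_iff[OF g] by simp
  then have "l2_inner M f g = l2_inner M f (\<lambda>x. 0)"
    by (intro l2_inner_cong_AE) (auto intro: L2_measurable f g)
  then show ?thesis using True by simp
next
  case False
  define n where "n = (l2_norm M g)\<^sup>2"
  define c where "c = l2_inner M f g"
  have n: "n > 0" using False by (simp add: n_def)
  \<comment> \<open>With \<open>c / n\<close> the subtracted term is the projection of f onto g, and
    the inequality is the nonnegativity of what remains.\<close>
  have "0 \<le> (l2_norm M (\<lambda>x. f x - (c / of_real n) * g x))\<^sup>2" by simp
  also have "\<dots> = (l2_norm M f)\<^sup>2 + (cmod (c / of_real n))\<^sup>2 * n
      - 2 * Re (l2_inner M f (\<lambda>x. (c / of_real n) * g x))"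
    by (subst l2_norm_diff_square[OF f L2_cmult[OF g]])
       (simp only: l2_norm_cmult power_mult_distrib n_def)
  also have "l2_inner M f (\<lambda>x. (c / of_real n) * g x) = cnj c * c / of_real n"
    by (subst l2_inner_cmult_right) (simp add: c_def)
  also have "Re (cnj c * c / of_real n) = (cmod c)\<^sup>2 / n"
    using complex_norm_square[of c]
    by (metis Re_complex_of_real mult.commute of_real_divide)
  also have "(cmod (c / of_real n))\<^sup>2 * n = (cmod c)\<^sup>2 / n"
    using n by (simp add: norm_divide power2_eq_square)
  finally have "(cmod c)\<^sup>2 / n \<le> (l2_norm M f)\<^sup>2" by simp
  then have "(cmod c)\<^sup>2 \<le> (l2_norm M f * l2_norm M g)\<^sup>2"
    using n by (simp add: divide_le_eq power_mult_distrib n_def)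
  then show ?thesis
    unfolding c_def by (rule power2_le_imp_le) simp
qed

lemma tendsto_l2_inner_left:
  assumes "\<And>F. u F \<in> L2 M" "f \<in> L2 M" "g \<in> L2 M"
    and "((\<lambda>F. l2_norm M (\<lambda>x. f x - u F x)) \<longlongrightarrow> 0) A"
  shows "((\<lambda>F. l2_inner M (u F) g) \<longlongrightarrow> l2_inner M f g) A"
proof -
  have "((\<lambda>F. l2_norm M (\<lambda>x. f x - u F x) * l2_norm M g) \<longlongrightarrow> 0) A"
    using assms(4) by (auto intro: tendsto_mult_left_zero)
  then have "((\<lambda>F. l2_inner M f g - l2_inner M (u F) g) \<longlongrightarrow> 0) A"
  proof (rule Lim_null_comparison[rotated])
    show "\<forall>\<^sub>F F in A. norm (l2_inner M f g - l2_inner M (u F) g)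
        \<le> l2_norm M (\<lambda>x. f x - u F x) * l2_norm M g"
      using l2_Cauchy_Schwarz[OF L2_diff[OF assms(2,1)] assms(3)] assms(1-3)
      by (intro always_eventually allI) (simp add: l2_inner_diff_left)
  qed
  then show ?thesis
    using tendsto_diff[OF tendsto_const[of "l2_inner M f g"]] by fastforce
qed

lemma l2_norm_sum_square:
  assumes "finite F" "\<And>i. i \<in> F \<Longrightarrow> f i \<in> L2 M"
    and "\<And>i j. i \<in> F \<Longrightarrow> j \<in> F \<Longrightarrow> i \<noteq> j \<Longrightarrow> l2_inner M (f i) (f j) = 0"
  shows "(l2_norm M (\<lambda>x. \<Sum>i\<in>F. f i x))\<^sup>2 = (\<Sum>i\<in>F. (l2_norm M (f i))\<^sup>2)"
  using assms
proof (induction F)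
  case (insert a F)
  have "l2_inner M (f a) (\<lambda>x. \<Sum>i\<in>F. f i x) = (\<Sum>i\<in>F. l2_inner M (f a) (f i))"
    by (intro l2_inner_sum_right insert.prems) auto
  also have "\<dots> = 0"
    using insert.hyps by (intro sum.neutral ballI insert.prems) auto
  finally show ?case
    using insert by (simp add: l2_norm_add_square L2_sum)
qed simp

text \<open>The last hypothesis says that f - h i is orthogonal to h i, so the sum is the orthogonal
  projection of f and Pythagoras applies. It serves twice: to prove that the components of f sum to
  f, and to read off the norms of the components of a given sum.\<close>

lemma l2_norm_diff_sum_square:
  assumes "finite F" "f \<in> L2 M" "\<And>i. i \<in> F \<Longrightarrow> h i \<in> L2 M"
    and "\<And>i j. i \<in> F \<Longrightarrow> j \<in> F \<Longrightarrow> i \<noteq> j \<Longrightarrow> l2_inner M (h i) (h j) = 0"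
    and "\<And>i. i \<in> F \<Longrightarrow> l2_inner M f (h i) = of_real ((l2_norm M (h i))\<^sup>2)"
  shows "(l2_norm M (\<lambda>x. f x - (\<Sum>i\<in>F. h i x)))\<^sup>2
    = (l2_norm M f)\<^sup>2 - (\<Sum>i\<in>F. (l2_norm M (h i))\<^sup>2)"
proof -
  have "l2_inner M f (\<lambda>x. \<Sum>i\<in>F. h i x) = (\<Sum>i\<in>F. of_real ((l2_norm M (h i))\<^sup>2))"
    using assms by (simp add: l2_inner_sum_right del: of_real_power)
  then show ?thesis
    using assms by (simp add: l2_norm_diff_square L2_sum l2_norm_sum_square del: of_real_power)
qed

section \<open>Orthonormal bases\<close>

context
  fixes M :: "'a measure" and I :: "'i set" and u :: "'i \<Rightarrow> 'a \<Rightarrow> complex"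
  assumes onb: "orthonormal_basis M I u"
begin

lemma onb_L2: "i \<in> I \<Longrightarrow> u i \<in> L2 M"
  and onb_inner: "i \<in> I \<Longrightarrow> j \<in> I \<Longrightarrow> l2_inner M (u i) (u j) = (if i = j then 1 else 0)"
  using onb unfolding orthonormal_basis_def by auto

lemma onb_norm: "i \<in> I \<Longrightarrow> l2_norm M (u i) = 1"
proof -
  assume "i \<in> I"
  then have "(l2_norm M (u i))\<^sup>2 = 1"
    using onb_inner[of i i] l2_inner_self[of M "u i"]
    by (metis of_real_eq_1_iff)
  then show ?thesis
    using l2_norm_nonneg[of M "u i"] by (simp add: power2_eq_1_iff)
qed

lemma onb_inj_on: "inj_on u I"
  using onb_inner by (intro inj_onI) (metis zero_neq_one)

text \<open>\<open>hs_norm_sq\<close> ranges over bases that are sets indexed by themselves; this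
  puts an indexed basis into that form.\<close>

lemma onb_image: "orthonormal_basis M (u ` I) (\<lambda>v. v)"
  unfolding orthonormal_basis_def
proof (intro conjI ballI allI impI)
  fix f and \<epsilon> :: real assume "f \<in> L2 M" "\<epsilon> > 0"
  then obtain F c where F: "finite F" "F \<subseteq> I" "l2_norm M (\<lambda>x. f x - (\<Sum>i\<in>F. c i * u i x)) < \<epsilon>"
    using onb unfolding orthonormal_basis_def by blast
  have inj: "inj_on u F"
    using onb_inj_on F(2) by (rule inj_on_subset)
  have "(\<Sum>i\<in>F. c i * u i x) = (\<Sum>v\<in>u ` F. c (inv_into F u v) * v x)" for x
    by (subst sum.reindex[OF inj]) (simp add: inv_into_f_f[OF inj])
  with F show "\<exists>F c. finite F \<and> F \<subseteq> u ` I \<and> l2_norm M (\<lambda>x. f x - (\<Sum>i\<in>F. c i * i x)) < \<epsilon>"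
    by (intro exI[of _ "u ` F"] exI[of _ "\<lambda>v. c (inv_into F u v)"]) auto
qed (use onb_L2 onb_inner inj_onD[OF onb_inj_on] in \<open>auto\<close>)

lemma onb_combination_norm:
  assumes "finite F" "F \<subseteq> I"
  shows "(l2_norm M (\<lambda>x. \<Sum>i\<in>F. c i * u i x))\<^sup>2 = (\<Sum>i\<in>F. (cmod (c i))\<^sup>2)"
  using assms onb_L2
  by (subst l2_norm_sum_square)
     (auto simp: l2_inner_cmult_left l2_inner_cmult_right onb_inner subset_iff l2_norm_cmult onb_norm
        intro!: sum.cong)

text \<open>Completing the square: the last sum measures how far the coefficients c are from the
  Fourier coefficients. It lets the unspecified combinations in the definition of a basis be
  compared with Fourier partial sums.\<close>

lemma onb_best_approximation:
  assumes "f \<in> L2 M" "finite F" "F \<subseteq> I"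
  shows "(l2_norm M (\<lambda>x. f x - (\<Sum>i\<in>F. c i * u i x)))\<^sup>2
    = (l2_norm M f)\<^sup>2 - (\<Sum>i\<in>F. (cmod (l2_inner M f (u i)))\<^sup>2)
      + (\<Sum>i\<in>F. (cmod (l2_inner M f (u i) - c i))\<^sup>2)"
proof -
  have *: "l2_inner M f (\<lambda>x. \<Sum>i\<in>F. c i * u i x) = (\<Sum>i\<in>F. cnj (c i) * l2_inner M f (u i))"
    using assms onb_L2 by (subst l2_inner_sum_right) (auto simp: l2_inner_cmult_right)
  have c: "(cmod (a - b))\<^sup>2 = (cmod a)\<^sup>2 + (cmod b)\<^sup>2 - 2 * Re (cnj b * a)" for a b
    by (simp only: cmod_power2) (simp add: power2_eq_square algebra_simps)
  show ?thesis
    using assms onb_L2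
    by (subst l2_norm_diff_square)
       (auto simp: * onb_combination_norm c sum.distrib sum_subtractf sum_distrib_left intro!: L2_sum)
qed

lemma onb_projection:
  assumes "f \<in> L2 M" "finite F" "F \<subseteq> I"
  shows "(l2_norm M (\<lambda>x. f x - (\<Sum>i\<in>F. l2_inner M f (u i) * u i x)))\<^sup>2
    = (l2_norm M f)\<^sup>2 - (\<Sum>i\<in>F. (cmod (l2_inner M f (u i)))\<^sup>2)"
  by (subst onb_best_approximation[OF assms]) simp

text \<open>Density yields one good finite combination for each error. Replacing its coefficients by
  Fourier coefficients, and then enlarging its index set, can only decrease the error.\<close>

lemma onb_expansion:
  assumes f: "f \<in> L2 M"
  shows "((\<lambda>F. l2_norm M (\<lambda>x. f x - (\<Sum>i\<in>F. l2_inner M f (u i) * u i x))) \<longlongrightarrow> 0)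
    (finite_subsets_at_top I)"
proof (rule tendstoI)
  fix \<epsilon> :: real assume "\<epsilon> > 0"
  with f obtain F c where F: "finite F" "F \<subseteq> I" "l2_norm M (\<lambda>x. f x - (\<Sum>i\<in>F. c i * u i x)) < \<epsilon>"
    using onb unfolding orthonormal_basis_def by blast
  have "l2_norm M (\<lambda>x. f x - (\<Sum>i\<in>H. l2_inner M f (u i) * u i x)) < \<epsilon>"
    if H: "finite H" "F \<subseteq> H" "H \<subseteq> I" for H
  proof -
    have "(\<Sum>i\<in>F. (cmod (l2_inner M f (u i)))\<^sup>2) \<le> (\<Sum>i\<in>H. (cmod (l2_inner M f (u i)))\<^sup>2)"
      using H by (intro sum_mono2) auto
    moreover have "0 \<le> (\<Sum>i\<in>F. (cmod (l2_inner M f (u i) - c i))\<^sup>2)"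
      by (intro sum_nonneg) auto
    ultimately have "(l2_norm M (\<lambda>x. f x - (\<Sum>i\<in>H. l2_inner M f (u i) * u i x)))\<^sup>2
        \<le> (l2_norm M (\<lambda>x. f x - (\<Sum>i\<in>F. c i * u i x)))\<^sup>2"
      by (subst onb_projection[OF f H(1,3)], subst onb_best_approximation[OF f F(1,2)]) linarith
    then show ?thesis
      using F(3) power2_le_imp_le[OF _ l2_norm_nonneg] by fastforce
  qed
  then show "\<forall>\<^sub>F H in finite_subsets_at_top I.
      dist (l2_norm M (\<lambda>x. f x - (\<Sum>i\<in>H. l2_inner M f (u i) * u i x))) 0 < \<epsilon>"
    unfolding eventually_finite_subsets_at_top using F(1,2) by (intro exI[of _ F]) auto
qed

lemma onb_Parseval:
  assumes f: "f \<in> L2 M"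
  shows "((\<lambda>i. (cmod (l2_inner M f (u i)))\<^sup>2) has_sum (l2_norm M f)\<^sup>2) I"
proof -
  have "((\<lambda>F. (l2_norm M f)\<^sup>2 - (l2_norm M (\<lambda>x. f x - (\<Sum>i\<in>F. l2_inner M f (u i) * u i x)))\<^sup>2)
      \<longlongrightarrow> (l2_norm M f)\<^sup>2 - 0\<^sup>2) (finite_subsets_at_top I)"
    by (intro tendsto_intros onb_expansion f)
  moreover have "\<forall>\<^sub>F F in finite_subsets_at_top I. (l2_norm M f)\<^sup>2
        - (l2_norm M (\<lambda>x. f x - (\<Sum>i\<in>F. l2_inner M f (u i) * u i x)))\<^sup>2
      = (\<Sum>i\<in>F. (cmod (l2_inner M f (u i)))\<^sup>2)"
    by (rule eventually_finite_subsets_at_top_weakI) (simp add: onb_projection f)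
  ultimately show ?thesis
    unfolding has_sum_def by (simp add: tendsto_cong)
qed

end

section \<open>Sums of nonnegative extended reals\<close>

lemma has_sum_infsum_ennreal: "(f has_sum infsum f A) A" for f :: "'a \<Rightarrow> ennreal"
  by (intro has_sum_infsum nonneg_summable_on_complete) simp

lemma infsum_ennreal_add: "(\<Sum>\<^sub>\<infinity>x\<in>A. f x + g x) = infsum f A + infsum g A"
  for f g :: "'a \<Rightarrow> ennreal"
  by (intro infsumI has_sum_add has_sum_infsum_ennreal)

lemma infsum_ennreal_ge_sum:
  fixes f :: "'a \<Rightarrow> ennreal"
  assumes "finite F" "F \<subseteq> A"
  shows "sum f F \<le> infsum f A"
  using assms by (simp add: nonneg_infsum_complete SUP_upper)

lemma infsum_ennreal_le:
  fixes f :: "'a \<Rightarrow> ennreal"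
  assumes "\<And>F. finite F \<Longrightarrow> F \<subseteq> A \<Longrightarrow> sum f F \<le> c"
  shows "infsum f A \<le> c"
  using assms by (auto simp: nonneg_infsum_complete intro: SUP_least)

text \<open>A finite outer sum can be moved inside, where it is bounded by the full inner sum. By
  symmetry this one inequality gives equality.\<close>

lemma infsum_ennreal_swap_le:
  fixes f :: "'a \<Rightarrow> 'b \<Rightarrow> ennreal"
  shows "(\<Sum>\<^sub>\<infinity>x\<in>A. \<Sum>\<^sub>\<infinity>y\<in>B. f x y) \<le> (\<Sum>\<^sub>\<infinity>y\<in>B. \<Sum>\<^sub>\<infinity>x\<in>A. f x y)"
proof (rule infsum_ennreal_le)
  fix F assume F: "finite F" "F \<subseteq> A"
  have "((\<lambda>y. \<Sum>x\<in>F. f x y) has_sum (\<Sum>x\<in>F. \<Sum>\<^sub>\<infinity>y\<in>B. f x y)) B"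
    using F(1) by (induction F) (auto intro!: has_sum_add has_sum_infsum_ennreal)
  then have "(\<Sum>x\<in>F. \<Sum>\<^sub>\<infinity>y\<in>B. f x y) = (\<Sum>\<^sub>\<infinity>y\<in>B. \<Sum>x\<in>F. f x y)"
    by (rule infsumI[symmetric])
  also have "\<dots> \<le> (\<Sum>\<^sub>\<infinity>y\<in>B. \<Sum>\<^sub>\<infinity>x\<in>A. f x y)"
    by (rule has_sum_mono[OF has_sum_infsum_ennreal has_sum_infsum_ennreal])
       (rule infsum_ennreal_ge_sum[OF F])
  finally show "(\<Sum>x\<in>F. \<Sum>\<^sub>\<infinity>y\<in>B. f x y) \<le> (\<Sum>\<^sub>\<infinity>y\<in>B. \<Sum>\<^sub>\<infinity>x\<in>A. f x y)" .
qed

lemma infsum_ennreal_swap: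
  fixes f :: "'a \<Rightarrow> 'b \<Rightarrow> ennreal"
  shows "(\<Sum>\<^sub>\<infinity>x\<in>A. \<Sum>\<^sub>\<infinity>y\<in>B. f x y) = (\<Sum>\<^sub>\<infinity>y\<in>B. \<Sum>\<^sub>\<infinity>x\<in>A. f x y)"
  by (intro antisym infsum_ennreal_swap_le)

lemma infsum_ennreal_single:
  fixes f :: "'a \<Rightarrow> ennreal"
  assumes "a \<in> A" "\<And>x. x \<in> A \<Longrightarrow> x \<noteq> a \<Longrightarrow> f x = 0"
  shows "infsum f A = f a"
proof -
  have "infsum f A = infsum f {a}"
    using assms by (intro infsum_cong_neutral) auto
  then show ?thesis by simp
qed

lemma infsum_ennreal_has_sum:
  assumes "(f has_sum s) A" "\<And>x. x \<in> A \<Longrightarrow> 0 \<le> f x"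
  shows "(\<Sum>\<^sub>\<infinity>x\<in>A. ennreal (f x)) = ennreal s"
proof (rule infsumI)
  have "((\<lambda>F. ennreal (sum f F)) \<longlongrightarrow> ennreal s) (finite_subsets_at_top A)"
    using assms(1) unfolding has_sum_def by (rule tendsto_ennrealI)
  moreover have "\<forall>\<^sub>F F in finite_subsets_at_top A. ennreal (sum f F) = (\<Sum>x\<in>F. ennreal (f x))"
    using assms(2)
    by (intro eventually_finite_subsets_at_top_weakI) (auto simp: subset_iff sum_ennreal)
  ultimately show "((\<lambda>x. ennreal (f x)) has_sum ennreal s) A"
    unfolding has_sum_def by (rule Lim_transform_eventually)
qed

text \<open>The way back to real sums: norms are computed in extended reals, where summability is
  automatic, while Parseval frames and Hilbert sums are stated with real ones.\<close>

lemma has_sum_of_infsum_ennreal: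
  assumes "(\<Sum>\<^sub>\<infinity>x\<in>A. ennreal (f x)) = ennreal s" "\<And>x. x \<in> A \<Longrightarrow> 0 \<le> f x" "0 \<le> s"
  shows "(f has_sum s) A"
proof -
  have "((\<lambda>x. ennreal (f x)) has_sum ennreal s) A"
    using has_sum_infsum_ennreal[of "\<lambda>x. ennreal (f x)" A] assms(1) by simp
  moreover have "\<forall>\<^sub>F F in finite_subsets_at_top A. (\<Sum>x\<in>F. ennreal (f x)) = ennreal (sum f F)"
    using assms(2)
    by (intro eventually_finite_subsets_at_top_weakI) (auto simp: subset_iff sum_ennreal)
  ultimately have "((\<lambda>F. ennreal (sum f F)) \<longlongrightarrow> ennreal s) (finite_subsets_at_top A)"
    unfolding has_sum_def by (rule Lim_transform_eventually)
  moreover have "\<forall>\<^sub>F F in finite_subsets_at_top A. 0 \<le> sum f F"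
    using assms(2) by (intro eventually_finite_subsets_at_top_weakI) (auto intro: sum_nonneg)
  ultimately show ?thesis
    unfolding has_sum_def using tendsto_ennreal_iff[of "sum f" _ s] assms(3) by simp
qed

text \<open>Sums become integrals over a counting measure, so exchanging sum and integral is an
  instance of Tonelli.\<close>

lemma nn_integral_count_space_infsum:
  assumes "countable A"
  shows "(\<integral>\<^sup>+x. f x \<partial>count_space A) = (\<Sum>\<^sub>\<infinity>x\<in>A. f x)"
proof (cases "finite A")
  case False
  note bij = bij_betw_from_nat_into[OF assms False]
  have "(\<integral>\<^sup>+x. f x \<partial>count_space A) = (\<integral>\<^sup>+n. f (from_nat_into A n) \<partial>count_space UNIV)"
    by (rule nn_integral_bij_count_space[OF bij, symmetric])
  also have "\<dots> = (\<Sum>n. f (from_nat_into A n))"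
    by (rule nn_integral_count_space_nat)
  also have "\<dots> = (\<Sum>\<^sub>\<infinity>n\<in>UNIV. f (from_nat_into A n))"
    by (intro sums_unique[symmetric] has_sum_imp_sums has_sum_infsum_ennreal)
  also have "\<dots> = (\<Sum>\<^sub>\<infinity>x\<in>A. f x)"
    by (rule infsum_reindex_bij_betw[OF bij])
  finally show ?thesis .
qed (simp add: nn_integral_count_space_finite)

lemma nn_integral_infsum:
  fixes f :: "'i \<Rightarrow> 'a \<Rightarrow> ennreal"
  assumes "countable A" "\<And>i. i \<in> A \<Longrightarrow> f i \<in> borel_measurable M"
  shows "(\<integral>\<^sup>+x. (\<Sum>\<^sub>\<infinity>i\<in>A. f i x) \<partial>M) = (\<Sum>\<^sub>\<infinity>i\<in>A. \<integral>\<^sup>+x. f i x \<partial>M)"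
  using nn_integral_count_space_nn_integral[OF assms]
  by (simp add: nn_integral_count_space_infsum[OF assms(1)])

text \<open>The sum is the supremum of its finite partial sums, and a countable set has only
  countably many finite subsets.\<close>

lemma borel_measurable_infsum_ennreal:
  fixes f :: "'i \<Rightarrow> 'a \<Rightarrow> ennreal"
  assumes A: "countable A" and f: "\<And>i. i \<in> A \<Longrightarrow> f i \<in> borel_measurable M"
  shows "(\<lambda>x. \<Sum>\<^sub>\<infinity>i\<in>A. f i x) \<in> borel_measurable M"
proof -
  have "countable {F. finite F \<and> F \<subseteq> A}"
    using countable_Collect_finite_subset[OF A] by (simp add: conj_commute)
  then show ?thesis
    using f by (subst nonneg_infsum_complete)
      (auto intro!: borel_measurable_SUP borel_measurable_sum)
qed

section \<open>Hilbert-Schmidt operators\<close>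

text \<open>The intended instance is v \<mapsto> \<langle>T v, w\<rangle>. An operator T is linear
  only up to null sets, but the inner product absorbs these, so the functional is linear exactly and
  acts on functions rather than classes.\<close>

definition bounded_functional :: "'a measure \<Rightarrow> (('a \<Rightarrow> complex) \<Rightarrow> complex) \<Rightarrow> bool" where
  "bounded_functional M \<phi> \<longleftrightarrow>
     (\<forall>f\<in>L2 M. \<forall>g\<in>L2 M. \<forall>a b. \<phi> (\<lambda>x. a * f x + b * g x) = a * \<phi> f + b * \<phi> g) \<and>
     (\<exists>C. \<forall>f\<in>L2 M. cmod (\<phi> f) \<le> C * l2_norm M f)"

lemma bounded_functional_linear:
  "bounded_functional M \<phi> \<Longrightarrow> f \<in> L2 M \<Longrightarrow> g \<in> L2 M \<Longrightarrow>
    \<phi> (\<lambda>x. a * f x + b * g x) = a * \<phi> f + b * \<phi> g"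
  by (simp add: bounded_functional_def)

lemma bounded_functional_sum:
  assumes \<phi>: "bounded_functional M \<phi>" and "finite F" "\<And>i. i \<in> F \<Longrightarrow> u i \<in> L2 M"
  shows "\<phi> (\<lambda>x. \<Sum>i\<in>F. c i * u i x) = (\<Sum>i\<in>F. c i * \<phi> (u i))"
  using assms(2,3)
proof (induction F)
  case empty
  from bounded_functional_linear[OF \<phi> L2_zero L2_zero, of 0 0] show ?case by simp
next
  case (insert a F)
  have "\<phi> (\<lambda>x. c a * u a x + 1 * (\<Sum>i\<in>F. c i * u i x))
      = c a * \<phi> (u a) + 1 * \<phi> (\<lambda>x. \<Sum>i\<in>F. c i * u i x)"
  proof -
    have "(\<lambda>x. \<Sum>i\<in>F. c i * u i x) \<in> L2 M"
      using insert.prems by (intro L2_sum L2_cmult) auto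
    with insert.prems[of a] show ?thesis
      using bounded_functional_linear[OF \<phi>, of "u a" _ "c a" 1] by auto
  qed
  then show ?case
    using insert by simp
qed

lemma bounded_functional_expansion:
  assumes \<phi>: "bounded_functional M \<phi>" and onb: "orthonormal_basis M I u" and f: "f \<in> L2 M"
  shows "((\<lambda>i. l2_inner M f (u i) * \<phi> (u i)) has_sum \<phi> f) I"
proof -
  from \<phi> obtain C where C: "\<And>f. f \<in> L2 M \<Longrightarrow> cmod (\<phi> f) \<le> C * l2_norm M f"
    unfolding bounded_functional_def by blast
  let ?p = "\<lambda>F x. \<Sum>i\<in>F. l2_inner M f (u i) * u i x"
  have "((\<lambda>F. C * l2_norm M (\<lambda>x. f x - ?p F x)) \<longlongrightarrow> C * 0) (finite_subsets_at_top I)"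
    by (intro tendsto_intros onb_expansion[OF onb f])
  then have "((\<lambda>F. C * l2_norm M (\<lambda>x. f x - ?p F x)) \<longlongrightarrow> 0) (finite_subsets_at_top I)"
    by simp
  then have "((\<lambda>F. \<phi> f - (\<Sum>i\<in>F. l2_inner M f (u i) * \<phi> (u i))) \<longlongrightarrow> 0) (finite_subsets_at_top I)"
  proof (rule Lim_null_comparison[rotated])
    show "\<forall>\<^sub>F F in finite_subsets_at_top I.
        cmod (\<phi> f - (\<Sum>i\<in>F. l2_inner M f (u i) * \<phi> (u i))) \<le> C * l2_norm M (\<lambda>x. f x - ?p F x)"
    proof (rule eventually_finite_subsets_at_top_weakI)
      fix F assume F: "finite F" "F \<subseteq> I"
      have u: "u i \<in> L2 M" if "i \<in> F" for i
        using onb_L2[OF onb] that F(2) by auto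
      have p: "?p F \<in> L2 M"
        using u by (intro L2_sum L2_cmult) auto
      have "\<phi> (\<lambda>x. 1 * f x + (-1) * ?p F x) = 1 * \<phi> f + (-1) * \<phi> (?p F)"
        using bounded_functional_linear[OF \<phi> f p] .
      moreover have "\<phi> (?p F) = (\<Sum>i\<in>F. l2_inner M f (u i) * \<phi> (u i))"
        by (rule bounded_functional_sum[OF \<phi> F(1)]) (use u in auto)
      ultimately show "cmod (\<phi> f - (\<Sum>i\<in>F. l2_inner M f (u i) * \<phi> (u i)))
          \<le> C * l2_norm M (\<lambda>x. f x - ?p F x)"
        using C[OF L2_diff[OF f p]] by simp
    qed
  qed
  from tendsto_diff[OF tendsto_const[of "\<phi> f"] this] show ?thesis
    by (simp add: has_sum_def)
qed

text \<open>Cauchy-Schwarz applied to the expansion of \<phi> f in the basis, followed by Bessel's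
  inequality. The right-hand side may be infinite.\<close>

lemma bounded_functional_le:
  assumes \<phi>: "bounded_functional M \<phi>" and onb: "orthonormal_basis M I u" and f: "f \<in> L2 M"
  shows "ennreal ((cmod (\<phi> f))\<^sup>2)
    \<le> ennreal ((l2_norm M f)\<^sup>2) * (\<Sum>\<^sub>\<infinity>i\<in>I. ennreal ((cmod (\<phi> (u i)))\<^sup>2))"
proof (rule tendsto_upperbound)
  show "((\<lambda>F. ennreal ((cmod (\<Sum>i\<in>F. l2_inner M f (u i) * \<phi> (u i)))\<^sup>2))
      \<longlongrightarrow> ennreal ((cmod (\<phi> f))\<^sup>2)) (finite_subsets_at_top I)"
    using bounded_functional_expansion[OF assms] unfolding has_sum_def
    by (intro tendsto_ennrealI tendsto_intros)
  show "\<forall>\<^sub>F F in finite_subsets_at_top I.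
      ennreal ((cmod (\<Sum>i\<in>F. l2_inner M f (u i) * \<phi> (u i)))\<^sup>2)
      \<le> ennreal ((l2_norm M f)\<^sup>2) * (\<Sum>\<^sub>\<infinity>i\<in>I. ennreal ((cmod (\<phi> (u i)))\<^sup>2))"
  proof (rule eventually_finite_subsets_at_top_weakI)
    fix F assume F: "finite F" "F \<subseteq> I"
    have "(cmod (\<Sum>i\<in>F. l2_inner M f (u i) * \<phi> (u i)))\<^sup>2
        \<le> (\<Sum>i\<in>F. cmod (l2_inner M f (u i)) * cmod (\<phi> (u i)))\<^sup>2"
      by (intro power_mono order_trans[OF norm_sum]) (auto simp: norm_mult)
    also have "\<dots> \<le> (\<Sum>i\<in>F. (cmod (l2_inner M f (u i)))\<^sup>2) * (\<Sum>i\<in>F. (cmod (\<phi> (u i)))\<^sup>2)"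
      by (rule Cauchy_Schwarz_ineq_sum)
    also have "(\<Sum>i\<in>F. (cmod (l2_inner M f (u i)))\<^sup>2) \<le> (l2_norm M f)\<^sup>2"
      using onb_projection[OF onb f F]
        zero_le_power2[of "l2_norm M (\<lambda>x. f x - (\<Sum>i\<in>F. l2_inner M f (u i) * u i x))"]
      by linarith
    finally have "(cmod (\<Sum>i\<in>F. l2_inner M f (u i) * \<phi> (u i)))\<^sup>2
        \<le> (l2_norm M f)\<^sup>2 * (\<Sum>i\<in>F. (cmod (\<phi> (u i)))\<^sup>2)"
      by (simp add: mult_right_mono sum_nonneg)
    then have "ennreal ((cmod (\<Sum>i\<in>F. l2_inner M f (u i) * \<phi> (u i)))\<^sup>2)
        \<le> ennreal ((l2_norm M f)\<^sup>2 * (\<Sum>i\<in>F. (cmod (\<phi> (u i)))\<^sup>2))"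
      by (rule ennreal_leI)
    also have "\<dots> = ennreal ((l2_norm M f)\<^sup>2) * (\<Sum>i\<in>F. ennreal ((cmod (\<phi> (u i)))\<^sup>2))"
      by (subst ennreal_mult) (auto simp: sum_nonneg sum_ennreal)
    also have "\<dots> \<le> ennreal ((l2_norm M f)\<^sup>2) * (\<Sum>\<^sub>\<infinity>i\<in>I. ennreal ((cmod (\<phi> (u i)))\<^sup>2))"
      by (intro mult_left_mono infsum_ennreal_ge_sum F) auto
    finally show "ennreal ((cmod (\<Sum>i\<in>F. l2_inner M f (u i) * \<phi> (u i)))\<^sup>2)
        \<le> ennreal ((l2_norm M f)\<^sup>2) * (\<Sum>\<^sub>\<infinity>i\<in>I. ennreal ((cmod (\<phi> (u i)))\<^sup>2))" .
  qed
qed (simp add: finite_subsets_at_top_neq_bot)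

text \<open>Both sums equal the squared norm of the Riesz representative of \<phi>. Its finite
  truncations in the basis v are enough for the comparison, so the representative itself is never
  constructed.\<close>

lemma bounded_functional_basis_le:
  assumes \<phi>: "bounded_functional M \<phi>"
    and u: "orthonormal_basis M I u" and v: "orthonormal_basis M J v"
  shows "(\<Sum>\<^sub>\<infinity>j\<in>J. ennreal ((cmod (\<phi> (v j)))\<^sup>2)) \<le> (\<Sum>\<^sub>\<infinity>i\<in>I. ennreal ((cmod (\<phi> (u i)))\<^sup>2))"
proof (rule infsum_ennreal_le)
  fix F assume F: "finite F" "F \<subseteq> J"
  define s where "s = (\<Sum>j\<in>F. (cmod (\<phi> (v j)))\<^sup>2)"
  \<comment> \<open>Chosen so that \<phi> w and the squared norm of w are both s; the bound for
    \<phi> w then reads s * s \<le> s * R, and s can be cancelled unless it is 0.\<close>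
  define w where "w = (\<lambda>x. \<Sum>j\<in>F. cnj (\<phi> (v j)) * v j x)"
  let ?R = "\<Sum>\<^sub>\<infinity>i\<in>I. ennreal ((cmod (\<phi> (u i)))\<^sup>2)"
  have s: "0 \<le> s"
    by (simp add: s_def sum_nonneg)
  have vF: "v j \<in> L2 M" if "j \<in> F" for j
    using onb_L2[OF v] that F(2) by auto
  have w: "w \<in> L2 M" "(l2_norm M w)\<^sup>2 = s"
    using vF onb_combination_norm[OF v F] by (auto simp: w_def s_def intro!: L2_sum)
  have "\<phi> w = (\<Sum>j\<in>F. cnj (\<phi> (v j)) * \<phi> (v j))"
    unfolding w_def by (rule bounded_functional_sum[OF \<phi> F(1)]) (use vF in auto)
  also have "\<dots> = of_real s"
    unfolding s_def of_real_sum complex_norm_square by (simp add: mult.commute)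
  finally have "ennreal (s * s) \<le> ennreal s * ?R"
    using bounded_functional_le[OF \<phi> u w(1)] s unfolding w(2) by (simp add: power2_eq_square)
  then have *: "ennreal s * ennreal s \<le> ennreal s * ?R"
    using s by (simp add: ennreal_mult)
  have "ennreal s \<le> ?R"
  proof (cases "s = 0")
    case False
    then show ?thesis
      using * s by (simp add: ennreal_mult_le_mult_iff)
  qed simp
  then show "(\<Sum>j\<in>F. ennreal ((cmod (\<phi> (v j)))\<^sup>2)) \<le> ?R"
    by (simp add: s_def sum_ennreal)
qed

lemma bounded_functional_basis:
  assumes "bounded_functional M \<phi>" "orthonormal_basis M I u" "orthonormal_basis M J v"
  shows "(\<Sum>\<^sub>\<infinity>j\<in>J. ennreal ((cmod (\<phi> (v j)))\<^sup>2)) = (\<Sum>\<^sub>\<infinity>i\<in>I. ennreal ((cmod (\<phi> (u i)))\<^sup>2))"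
  using assms by (intro antisym bounded_functional_basis_le)

section \<open>Hilbert-Schmidt norms through matrix entries\<close>

lemma bounded_operator_L2: "bounded_operator T \<Longrightarrow> f \<in> L2 lborel \<Longrightarrow> T f \<in> L2 lborel"
  by (simp add: bounded_operator_def)

lemma bounded_functional_operator:
  assumes T: "bounded_operator T" and w: "w \<in> L2 lborel"
  shows "bounded_functional lborel (\<lambda>v. l2_inner lborel (T v) w)"
  unfolding bounded_functional_def
proof (intro conjI ballI allI)
  fix f g :: "real^'a \<Rightarrow> complex" and a b
  assume fg: "f \<in> L2 lborel" "g \<in> L2 lborel"
  note Tfg = fg[THEN bounded_operator_L2[OF T]]
  have "AE t in lborel. T (\<lambda>t. a * f t + b * g t) t = a * T f t + b * T g t"
    using T fg unfolding bounded_operator_def by blast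
  then have "l2_inner lborel (T (\<lambda>x. a * f x + b * g x)) w
      = l2_inner lborel (\<lambda>t. a * T f t + b * T g t) w"
    by (intro l2_inner_cong_AE L2_measurable w bounded_operator_L2[OF T] L2_add L2_cmult fg Tfg) auto
  then show "l2_inner lborel (T (\<lambda>x. a * f x + b * g x)) w
      = a * l2_inner lborel (T f) w + b * l2_inner lborel (T g) w"
    by (simp add: l2_inner_add_left L2_cmult Tfg w l2_inner_cmult_left)
next
  obtain C where C: "\<And>f. f \<in> L2 lborel \<Longrightarrow> l2_norm lborel (T f) \<le> C * l2_norm lborel f"
    using T unfolding bounded_operator_def by blast
  show "\<exists>C. \<forall>f\<in>L2 lborel. cmod (l2_inner lborel (T f) w) \<le> C * l2_norm lborel f"
  proof (intro exI[of _ "C * l2_norm lborel w"] ballI)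
    fix f :: "real^'a \<Rightarrow> complex" assume f: "f \<in> L2 lborel"
    have "cmod (l2_inner lborel (T f) w) \<le> l2_norm lborel (T f) * l2_norm lborel w"
      by (intro l2_Cauchy_Schwarz bounded_operator_L2[OF T] f w)
    also have "\<dots> \<le> C * l2_norm lborel f * l2_norm lborel w"
      by (intro mult_right_mono C f) simp
    finally show "cmod (l2_inner lborel (T f) w) \<le> C * l2_norm lborel w * l2_norm lborel f"
      by (simp add: mult_ac)
  qed
qed

context
  fixes I :: "'i set" and e :: "'i \<Rightarrow> real^'d::finite \<Rightarrow> complex"
  assumes e: "orthonormal_basis lborel I e"
begin

lemma onb_Parseval_ennreal:
  assumes "f \<in> L2 lborel"
  shows "ennreal ((l2_norm lborel f)\<^sup>2) = (\<Sum>\<^sub>\<infinity>i\<in>I. ennreal ((cmod (l2_inner lborel f (e i)))\<^sup>2))"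
  using infsum_ennreal_has_sum[OF onb_Parseval[OF e assms]] by simp

text \<open>The supremum is over a constant. Expanding T (v u) in e and swapping the sums leaves,
  for each l, a sum over the basis v of the functional \<langle>T -, e l\<rangle>, where v may be
  replaced by e. This takes the place of the usual passage through the adjoint.\<close>

lemma hs_norm_sq_onb:
  assumes T: "bounded_operator T"
  shows "hs_norm_sq T = (\<Sum>\<^sub>\<infinity>k\<in>I. ennreal ((l2_norm lborel (T (e k)))\<^sup>2))"
proof -
  have *: "(\<Sum>\<^sub>\<infinity>u\<in>U. ennreal ((l2_norm lborel (T (v u)))\<^sup>2))
      = (\<Sum>\<^sub>\<infinity>k\<in>I. ennreal ((l2_norm lborel (T (e k)))\<^sup>2))"
    if v: "orthonormal_basis lborel U v" for U :: "'c set" and v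
  proof -
    have "(\<Sum>\<^sub>\<infinity>u\<in>U. ennreal ((l2_norm lborel (T (v u)))\<^sup>2))
        = (\<Sum>\<^sub>\<infinity>u\<in>U. \<Sum>\<^sub>\<infinity>l\<in>I. ennreal ((cmod (l2_inner lborel (T (v u)) (e l)))\<^sup>2))"
      by (intro infsum_cong onb_Parseval_ennreal bounded_operator_L2[OF T] onb_L2[OF v])
    also have "\<dots> = (\<Sum>\<^sub>\<infinity>l\<in>I. \<Sum>\<^sub>\<infinity>u\<in>U. ennreal ((cmod (l2_inner lborel (T (v u)) (e l)))\<^sup>2))"
      by (rule infsum_ennreal_swap)
    also have "\<dots> = (\<Sum>\<^sub>\<infinity>l\<in>I. \<Sum>\<^sub>\<infinity>k\<in>I. ennreal ((cmod (l2_inner lborel (T (e k)) (e l)))\<^sup>2))"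
      by (intro infsum_cong bounded_functional_basis[OF bounded_functional_operator[OF T]]
          onb_L2[OF e] e v)
    also have "\<dots> = (\<Sum>\<^sub>\<infinity>k\<in>I. \<Sum>\<^sub>\<infinity>l\<in>I. ennreal ((cmod (l2_inner lborel (T (e k)) (e l)))\<^sup>2))"
      by (rule infsum_ennreal_swap)
    also have "\<dots> = (\<Sum>\<^sub>\<infinity>k\<in>I. ennreal ((l2_norm lborel (T (e k)))\<^sup>2))"
      by (intro infsum_cong onb_Parseval_ennreal[symmetric] bounded_operator_L2[OF T] onb_L2[OF e])
    finally show ?thesis .
  qed
  have "{U. orthonormal_basis lborel U (\<lambda>u::real^'d \<Rightarrow> complex. u)} \<noteq> {}"
    using onb_image[OF e] by blast
  then show ?thesis
    unfolding hs_norm_sq_def using * by (subst SUP_cong[OF refl *]) auto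
qed

lemma hs_norm_sq_matrix:
  assumes T: "bounded_operator T"
  shows "hs_norm_sq T
    = (\<Sum>\<^sub>\<infinity>k\<in>I. \<Sum>\<^sub>\<infinity>l\<in>I. ennreal ((cmod (l2_inner lborel (T (e k)) (e l)))\<^sup>2))"
  unfolding hs_norm_sq_onb[OF T]
  by (intro infsum_cong onb_Parseval_ennreal bounded_operator_L2[OF T] onb_L2[OF e])

lemma onb_coefficients_eq_0:
  assumes f: "f \<in> L2 lborel" and 0: "\<And>l. l \<in> I \<Longrightarrow> l2_inner lborel f (e l) = 0"
  shows "AE t in lborel. f t = 0"
proof -
  have "ennreal ((l2_norm lborel f)\<^sup>2) = (\<Sum>\<^sub>\<infinity>i\<in>I. 0)"
    unfolding onb_Parseval_ennreal[OF f] by (intro infsum_cong) (simp add: 0)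
  then show ?thesis
    using l2_norm_eq_0_iff[OF f] by simp
qed

text \<open>If only column k is nonzero, expanding v in the basis leaves the single term \<langle>v,
  e k\<rangle> T (e k). This is the direction of \<open>H_space_iff\<close> that has to produce an
  operator from coefficients.\<close>

lemma op_eq_rank_one:
  assumes T: "bounded_operator T" and k: "k \<in> I"
    and 0: "\<And>k' l. k' \<in> I \<Longrightarrow> l \<in> I \<Longrightarrow> k' \<noteq> k \<Longrightarrow> l2_inner lborel (T (e k')) (e l) = 0"
  shows "op_eq T (rank_one (T (e k)) (e k))"
  unfolding op_eq_def
proof
  fix v :: "real^'d \<Rightarrow> complex" assume v: "v \<in> L2 lborel"
  note Te = bounded_operator_L2[OF T onb_L2[OF e]]
  let ?c = "l2_inner lborel v (e k)"
  have "AE t in lborel. T v t - ?c * T (e k) t = 0"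
  proof (rule onb_coefficients_eq_0)
    fix l assume l: "l \<in> I"
    have "((\<lambda>i. l2_inner lborel v (e i) * l2_inner lborel (T (e i)) (e l))
        has_sum l2_inner lborel (T v) (e l)) I"
      by (rule bounded_functional_expansion[OF bounded_functional_operator[OF T] e v])
         (rule onb_L2[OF e l])
    moreover have "((\<lambda>i. l2_inner lborel v (e i) * l2_inner lborel (T (e i)) (e l))
        has_sum ?c * l2_inner lborel (T (e k)) (e l)) I"
      using k 0 l by (subst has_sum_cong_neutral[where T="{k}"]) (auto intro!: has_sum_finiteI)
    ultimately have "l2_inner lborel (T v) (e l) = ?c * l2_inner lborel (T (e k)) (e l)"
      by (rule has_sum_unique)
    then show "l2_inner lborel (\<lambda>t. T v t - ?c * T (e k) t) (e l) = 0"
      by (subst l2_inner_diff_left)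
         (auto simp: l2_inner_cmult_left intro: Te k bounded_operator_L2[OF T v] onb_L2[OF e l])
  qed (intro L2_diff L2_cmult Te k bounded_operator_L2[OF T v])
  then show "AE t in lborel. T v t = rank_one (T (e k)) (e k) v t"
    by (simp add: rank_one_def)
qed

lemma op_eq_zero:
  assumes T: "bounded_operator T"
    and 0: "\<And>k l. k \<in> I \<Longrightarrow> l \<in> I \<Longrightarrow> l2_inner lborel (T (e k)) (e l) = 0"
  shows "op_eq T (\<lambda>_ _. 0)"
  unfolding op_eq_def
proof
  fix v :: "real^'d \<Rightarrow> complex" assume v: "v \<in> L2 lborel"
  show "AE t in lborel. T v t = 0"
  proof (rule onb_coefficients_eq_0)
    fix l assume l: "l \<in> I"
    have "((\<lambda>i. l2_inner lborel v (e i) * l2_inner lborel (T (e i)) (e l))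
        has_sum l2_inner lborel (T v) (e l)) I"
      by (rule bounded_functional_expansion[OF bounded_functional_operator[OF T] e v])
         (rule onb_L2[OF e l])
    moreover have "((\<lambda>i. l2_inner lborel v (e i) * l2_inner lborel (T (e i)) (e l)) has_sum 0) I"
      using 0 l by (intro has_sum_0) auto
    ultimately show "l2_inner lborel (T v) (e l) = 0"
      by (rule has_sum_unique)
  qed (rule bounded_operator_L2[OF T v])
qed

end

lemma bounded_operator_zero: "bounded_operator (\<lambda>_ _. 0)"
  by (auto simp: bounded_operator_def intro!: exI[of _ 0])

lemma bounded_operator_rank_one:
  assumes "\<phi> \<in> L2 lborel" "u \<in> L2 lborel"
  shows "bounded_operator (rank_one \<phi> u)"
  unfolding bounded_operator_def
proof (intro conjI ballI allI)
  fix f g :: "real^'a \<Rightarrow> complex" and a b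
  assume fg: "f \<in> L2 lborel" "g \<in> L2 lborel"
  show "rank_one \<phi> u f \<in> L2 lborel"
    unfolding rank_one_def using assms by auto
  have "l2_inner lborel (\<lambda>t. a * f t + b * g t) u = a * l2_inner lborel f u + b * l2_inner lborel g u"
    using fg assms by (simp add: l2_inner_add_left L2_cmult l2_inner_cmult_left)
  then show "AE t in lborel. rank_one \<phi> u (\<lambda>t. a * f t + b * g t) t
      = a * rank_one \<phi> u f t + b * rank_one \<phi> u g t"
    by (simp add: rank_one_def algebra_simps)
next
  show "\<exists>C. \<forall>f\<in>L2 lborel. l2_norm lborel (rank_one \<phi> u f) \<le> C * l2_norm lborel f"
  proof (intro exI[of _ "l2_norm lborel u * l2_norm lborel \<phi>"] ballI)
    fix f :: "real^'a \<Rightarrow> complex" assume f: "f \<in> L2 lborel"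
    have "l2_norm lborel (rank_one \<phi> u f) = cmod (l2_inner lborel f u) * l2_norm lborel \<phi>"
      by (simp add: rank_one_def l2_norm_cmult)
    also have "\<dots> \<le> (l2_norm lborel f * l2_norm lborel u) * l2_norm lborel \<phi>"
      by (intro mult_right_mono l2_Cauchy_Schwarz f assms) simp
    finally show "l2_norm lborel (rank_one \<phi> u f)
        \<le> l2_norm lborel u * l2_norm lborel \<phi> * l2_norm lborel f"
      by (simp add: mult_ac)
  qed
qed

section \<open>Coordinates and dilations of the group\<close>

text \<open>The automorphism A in coordinates, with a free factor: c = \<open>2 powi j\<close> gives
  \<open>A_power G j\<close>, negative j included.\<close>

definition axis_dilation ::
    "real \<Rightarrow> (real^'z) \<times> (real^'d) \<times> (real^'d) \<Rightarrow> (real^'z) \<times> (real^'d) \<times> (real^'d)" where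
  "axis_dilation c = (\<lambda>(z, y, x). (c *\<^sub>R z, c *\<^sub>R y, x))"

lemma axis_dilation_axis_dilation [simp]:
  "axis_dilation b (axis_dilation c p) = axis_dilation (b * c) p"
  by (simp add: axis_dilation_def case_prod_beta)

lemma axis_dilation_1 [simp]: "axis_dilation 1 p = p"
  by (simp add: axis_dilation_def)

lemma axis_dilation_measurable [measurable]:
  "(axis_dilation c :: (real^'z::finite) \<times> (real^'d::finite) \<times> (real^'d) \<Rightarrow> _) \<in> borel_measurable borel"
  unfolding axis_dilation_def case_prod_beta
  by (intro borel_measurable_continuous_onI continuous_intros)

lemma sum_UNIV_sum:
  "(\<Sum>p\<in>UNIV. f p) = (\<Sum>i\<in>UNIV. f (Inl i)) + (\<Sum>j\<in>UNIV. f (Inr j))"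
  for f :: "'a::finite + 'b::finite \<Rightarrow> 'c::comm_monoid_add"
  using sum.Plus[of "UNIV :: 'a set" "UNIV :: 'b set" f] by (simp add: o_def)

lemma prod_Basis_prod:
  "(\<Prod>b\<in>Basis. f b) = (\<Prod>u\<in>Basis. f (u, 0)) * (\<Prod>v\<in>Basis. f (0, v))"
  for f :: "'a::euclidean_space \<times> 'b::euclidean_space \<Rightarrow> 'c::comm_monoid_mult"
proof -
  have "(\<lambda>u::'a. (u, 0::'b)) ` Basis \<inter> Pair 0 ` Basis = {}"
    using nonzero_Basis by auto
  then show ?thesis
    unfolding Basis_prod_def by (simp add: prod.union_disjoint prod.reindex inj_on_def)
qed

text \<open>The Jacobian is one factor c for each z and each y coordinate, and 1 for each x
  coordinate.\<close>

lemma distr_axis_dilation: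
  fixes c :: real
  assumes c: "c > 0"
  shows "(lborel :: ((real^'z::finite) \<times> (real^'d::finite) \<times> (real^'d)) measure)
    = density (distr lborel borel (axis_dilation c)) (\<lambda>_. ennreal (c ^ (CARD('z) + CARD('d))))"
proof -
  let ?B = "Basis :: ((real^'z) \<times> (real^'d) \<times> (real^'d)) set"
  \<comment> \<open>The stretch factor in direction b. A basis vector of the product is nonzero in
    exactly one component, so a vanishing last component singles out the z and y directions.\<close>
  define co where "co b = (if snd (snd b) = 0 then c else 1)"
    for b :: "(real^'z) \<times> (real^'d) \<times> (real^'d)"
  have T: "0 + (\<Sum>j\<in>?B. (co j * (p \<bullet> j)) *\<^sub>R j) = axis_dilation c p" for p
  proof (rule euclidean_eqI)
    fix b assume b: "b \<in> ?B"
    have "(\<Sum>j\<in>?B. (co j * (p \<bullet> j)) *\<^sub>R j) \<bullet> b = co b * (p \<bullet> b)"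
      using b by (rule inner_sum_left_Basis)
    also have "\<dots> = axis_dilation c p \<bullet> b"
      using b nonzero_Basis
      by (cases p) (auto simp: Basis_prod_def co_def axis_dilation_def)
    finally show "(0 + (\<Sum>j\<in>?B. (co j * (p \<bullet> j)) *\<^sub>R j)) \<bullet> b = axis_dilation c p \<bullet> b"
      by simp
  qed
  have co: "\<bar>co b\<bar> = co b" for b
    using c by (simp add: co_def)
  have 1: "(\<Prod>u\<in>(Basis :: (real^'d) set). co (0, 0, u)) = 1"
    using nonzero_Basis by (intro prod.neutral) (auto simp: co_def)
  have "(\<Prod>j\<in>?B. \<bar>co j\<bar>) = (\<Prod>u\<in>(Basis :: (real^'z) set). co (u, 0))
      * ((\<Prod>u\<in>(Basis :: (real^'d) set). co (0, u, 0)) * (\<Prod>u\<in>(Basis :: (real^'d) set). co (0, 0, u)))"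
    unfolding co by (subst prod_Basis_prod, subst prod_Basis_prod) (rule refl)
  also have "\<dots> = c ^ (CARD('z) + CARD('d))"
    unfolding 1 by (simp add: co_def power_add)
  finally have P: "(\<Prod>j\<in>?B. \<bar>co j\<bar>) = c ^ (CARD('z) + CARD('d))" .
  show ?thesis
    using lborel_affine_euclidean[of co 0] c unfolding T P by (auto simp: co_def)
qed

text \<open>Non-measurable F are covered: the dilation is invertible, so both integrands are then
  non-measurable and both integrals take the default value 0. This allows the integrand of the
  Fourier transform to be rescaled without proving the matrix coefficients of the representation
  measurable.\<close>

lemma
  fixes F :: "(real^'z::finite) \<times> (real^'d::finite) \<times> (real^'d) \<Rightarrow> 'b::{banach, second_countable_topology}"
  assumes c: "c > 0"
  shows integral_axis_dilation:
      "(LINT p|lborel. F p) = c ^ (CARD('z) + CARD('d)) *\<^sub>R (LINT p|lborel. F (axis_dilation c p))"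
    and integrable_axis_dilation_iff:
      "integrable lborel F \<longleftrightarrow> integrable lborel (\<lambda>p. F (axis_dilation c p))"
proof -
  let ?k = "c ^ (CARD('z) + CARD('d))"
  have inv: "(\<lambda>p. F (axis_dilation c (axis_dilation (1/c) p))) = F"
    using c by simp
  have meas: "F \<in> borel_measurable borel \<longleftrightarrow> (\<lambda>p. F (axis_dilation c p)) \<in> borel_measurable borel"
  proof
    assume "(\<lambda>p. F (axis_dilation c p)) \<in> borel_measurable borel"
    from measurable_compose[OF axis_dilation_measurable[of "1/c"] this]
    show "F \<in> borel_measurable borel"
      unfolding inv .
  next
    assume "F \<in> borel_measurable borel"
    from measurable_compose[OF axis_dilation_measurable this]
    show "(\<lambda>p. F (axis_dilation c p)) \<in> borel_measurable borel" .
  qed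
  have not_integrable: "\<not> integrable lborel H"
    if "H \<notin> borel_measurable borel" for H :: "(real^'z) \<times> (real^'d) \<times> (real^'d) \<Rightarrow> 'b"
    using that borel_measurable_integrable[of lborel H] by auto
  let ?D = "density (distr lborel borel (axis_dilation c)) (\<lambda>_. ennreal ?k)"
  show "(LINT p|lborel. F p) = ?k *\<^sub>R (LINT p|lborel. F (axis_dilation c p))"
  proof (cases "F \<in> borel_measurable borel")
    case True
    have "(LINT p|lborel. F p) = (LINT p|?D. F p)"
      using distr_axis_dilation[OF c] by (rule arg_cong)
    also have "\<dots> = ?k *\<^sub>R (LINT p|distr lborel borel (axis_dilation c). F p)"
      using True c by (subst integral_density) auto
    also have "(LINT p|distr lborel borel (axis_dilation c). F p) = (LINT p|lborel. F (axis_dilation c p))"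
      using True by (intro integral_distr) auto
    finally show ?thesis .
  next
    case False
    then have "\<not> integrable lborel F" "\<not> integrable lborel (\<lambda>p. F (axis_dilation c p))"
      using not_integrable meas by auto
    then show ?thesis
      by (simp add: not_integrable_integral_eq)
  qed
  show "integrable lborel F \<longleftrightarrow> integrable lborel (\<lambda>p. F (axis_dilation c p))"
  proof (cases "F \<in> borel_measurable borel")
    case True
    have "integrable lborel F \<longleftrightarrow> integrable ?D F"
      using distr_axis_dilation[OF c] by (rule arg_cong)
    also have "\<dots> \<longleftrightarrow> integrable (distr lborel borel (axis_dilation c)) (\<lambda>p. ?k *\<^sub>R F p)"
      using True c by (intro integrable_density) auto
    also have "\<dots> \<longleftrightarrow> integrable (distr lborel borel (axis_dilation c)) F"
    proof
      assume "integrable (distr lborel borel (axis_dilation c)) (\<lambda>p. ?k *\<^sub>R F p)"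
      then have "integrable (distr lborel borel (axis_dilation c)) (\<lambda>p. (1 / ?k) *\<^sub>R (?k *\<^sub>R F p))"
        by (rule integrable_scaleR_right)
      moreover have "(\<lambda>p. (1 / ?k) *\<^sub>R (?k *\<^sub>R F p)) = F"
        using c by (intro ext) (subst scaleR_scaleR, simp)
      ultimately show "integrable (distr lborel borel (axis_dilation c)) F"
        by (simp only:)
    qed (intro integrable_scaleR_right)
    also have "\<dots> \<longleftrightarrow> integrable lborel (\<lambda>p. F (axis_dilation c p))"
      using True by (intro integrable_distr_eq) auto
    finally show ?thesis .
  next
    case False
    then show ?thesis
      using not_integrable meas by auto
  qed
qed

section \<open>The chart as global coordinates on the group\<close>

locale nilpotent_group_setting =
  fixes G :: "('g, 'n::real_vector, 'z::{finite,linorder}, 'd::{finite,linorder}) nilpotent_group"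
  assumes setting: "nilpotent_setting G"
begin

definition Zvec :: "(real, 'z) vec \<Rightarrow> 'n" where "Zvec z = (\<Sum>i\<in>UNIV. z $ i *\<^sub>R Zb G i)"
definition Yvec :: "(real, 'd) vec \<Rightarrow> 'n" where "Yvec y = (\<Sum>i\<in>UNIV. y $ i *\<^sub>R Yb G i)"
definition Xvec :: "(real, 'd) vec \<Rightarrow> 'n" where "Xvec x = (\<Sum>i\<in>UNIV. x $ i *\<^sub>R Xb G i)"

lemma jh_sum:
  "(\<Sum>p\<in>UNIV. w p *\<^sub>R jh_basis G p)
    = Zvec (\<chi> i. w (Inl i)) + Yvec (\<chi> i. w (Inr (Inl i))) + Xvec (\<chi> i. w (Inr (Inr i)))"
  by (simp add: sum_UNIV_sum Zvec_def Yvec_def Xvec_def jh_basis_def add.assoc)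

lemma jh_inj: "inj (jh_basis G)"
  and jh_independent: "independent (range (jh_basis G))"
  and jh_span: "span (range (jh_basis G)) = UNIV"
  and center: "lie_center (bracket G) = span (range (Zb G))"
  and bilinear_bracket: "bilinear (bracket G)"
  and lie_exp_bij: "bij_betw (lie_exp G) UNIV (carrier G)"
  and lie_exp_mult: "lie_exp G v \<otimes>\<^bsub>G\<^esub> lie_exp G w = lie_exp G (v + w + (1/2) *\<^sub>R bracket G v w)"
  using setting unfolding nilpotent_setting_def lie_algebra_def by simp_all

lemma bracket_YX:
  "v \<in> span (range (Yb G)) \<Longrightarrow> w \<in> span (range (Xb G)) \<Longrightarrow>
    bracket G v w \<in> lie_center (bracket G)"
proof -
  have "\<forall>v\<in>span (range (Yb G)). \<forall>w\<in>span (range (Xb G)). bracket G v w \<in> lie_center (bracket G)"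
    using setting unfolding nilpotent_setting_def by (elim conjE)
  then show "v \<in> span (range (Yb G)) \<Longrightarrow> w \<in> span (range (Xb G)) \<Longrightarrow>
      bracket G v w \<in> lie_center (bracket G)"
    by simp
qed

lemma jh_sum_eq_0:
  assumes "(\<Sum>p\<in>UNIV. w p *\<^sub>R jh_basis G p) = 0"
  shows "w p = 0"
proof (rule ccontr)
  assume "w p \<noteq> 0"
  moreover define u where "u v = w (inv_into UNIV (jh_basis G) v)" for v
  ultimately have "u (jh_basis G p) \<noteq> 0" "(\<Sum>v\<in>range (jh_basis G). u v *\<^sub>R v) = 0"
    using assms by (simp_all add: jh_inj sum.reindex)
  then have "dependent (range (jh_basis G))"
    unfolding dependent_finite[OF finite_imageI[OF finite]] by blast
  with jh_independent show False by simp
qed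

lemma ZYX_unique:
  assumes "Zvec z + Yvec y + Xvec x = Zvec z' + Yvec y' + Xvec x'"
  shows "z = z' \<and> y = y' \<and> x = x'"
proof -
  define w where "w = case_sum (\<lambda>i. z $ i - z' $ i) (case_sum (\<lambda>i. y $ i - y' $ i) (\<lambda>i. x $ i - x' $ i))"
  have "(\<Sum>p\<in>UNIV. w p *\<^sub>R jh_basis G p)
      = (Zvec z + Yvec y + Xvec x) - (Zvec z' + Yvec y' + Xvec x')"
    unfolding jh_sum
    by (simp add: w_def Zvec_def Yvec_def Xvec_def scaleR_left_diff_distrib sum_subtractf algebra_simps)
  then have w: "w p = 0" for p
    using assms by (intro jh_sum_eq_0) simp
  have "z $ i = z' $ i" "y $ j = y' $ j" "x $ j = x' $ j" for i j
    using w[of "Inl i"] w[of "Inr (Inl j)"] w[of "Inr (Inr j)"] by (simp_all add: w_def)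
  then show ?thesis
    by (simp add: vec_eq_iff)
qed

lemma ZYX_surj: "\<exists>z y x. v = Zvec z + Yvec y + Xvec x"
proof -
  have "v \<in> span (range (jh_basis G))"
    by (simp add: jh_span)
  then obtain u where "v = (\<Sum>b\<in>range (jh_basis G). u b *\<^sub>R b)"
    by (auto simp: span_finite)
  then have "v = (\<Sum>p\<in>UNIV. u (jh_basis G p) *\<^sub>R jh_basis G p)"
    by (simp add: sum.reindex[OF jh_inj])
  then show ?thesis
    unfolding jh_sum by blast
qed

lemma Zb_inj: "inj (Zb G)"
  using jh_inj by (auto simp: inj_def jh_basis_def split: sum.splits)

lemma span_Zb: "v \<in> span (range (Zb G)) \<Longrightarrow> \<exists>z. v = Zvec z"
proof -
  assume "v \<in> span (range (Zb G))"
  then obtain u where "v = (\<Sum>b\<in>range (Zb G). u b *\<^sub>R b)"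
    by (auto simp: span_finite)
  then have "v = Zvec (\<chi> i. u (Zb G i))"
    by (simp add: sum.reindex[OF Zb_inj] Zvec_def)
  then show ?thesis ..
qed

text \<open>By the truncated Baker-Campbell-Hausdorff formula the product of exponentials differs
  from the exponential of the sum by half the bracket of the y and x parts. That bracket is central,
  so it only shifts z by an amount q depending on y and x. The chart is therefore
  \<open>lie_exp\<close> after an invertible shear, which yields injectivity and surjectivity at
  once.\<close>

lemma chart_lie_exp:
  "\<exists>q. \<forall>z y x. chart G (z, y, x) = lie_exp G (Zvec (z + q y x) + Yvec y + Xvec x)"
proof -
  have "\<exists>q. (1/2) *\<^sub>R bracket G (Yvec y) (Xvec x) = Zvec q" for y x
  proof (rule span_Zb)
    have "bracket G (Yvec y) (Xvec x) \<in> span (range (Zb G))"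
      unfolding center[symmetric]
      unfolding Yvec_def Xvec_def
      by (rule bracket_YX; rule span_sum, rule span_scale, rule span_base, simp)
    then show "(1/2) *\<^sub>R bracket G (Yvec y) (Xvec x) \<in> span (range (Zb G))"
      by (rule span_scale)
  qed
  then obtain q where q: "\<And>y x. (1/2) *\<^sub>R bracket G (Yvec y) (Xvec x) = Zvec (q y x)"
    by metis
  have "chart G (z, y, x) = lie_exp G (Zvec (z + q y x) + Yvec y + Xvec x)" for z y x
  proof -
    have "Zvec z \<in> lie_center (bracket G)"
      unfolding center Zvec_def by (rule span_sum, rule span_scale, rule span_base, simp)
    then have 0: "bracket G (Zvec z) v = 0" for v
      by (simp add: lie_center_def)
    have "chart G (z, y, x) = lie_exp G (Zvec z) \<otimes>\<^bsub>G\<^esub> lie_exp G (Yvec y) \<otimes>\<^bsub>G\<^esub> lie_exp G (Xvec x)"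
      by (simp add: chart_def exp_Z_def exp_Y_def exp_X_def Zvec_def Yvec_def Xvec_def)
    also have "\<dots> = lie_exp G (Zvec z + Yvec y + Xvec x + (1/2) *\<^sub>R bracket G (Zvec z + Yvec y) (Xvec x))"
      by (simp add: lie_exp_mult 0)
    also have "(1/2) *\<^sub>R bracket G (Zvec z + Yvec y) (Xvec x) = Zvec (q y x)"
      using bilinear_ladd[OF bilinear_bracket] by (simp add: 0 q)
    also have "Zvec z + Yvec y + Xvec x + Zvec (q y x) = Zvec (z + q y x) + Yvec y + Xvec x"
      by (simp add: Zvec_def scaleR_left_distrib sum.distrib algebra_simps)
    finally show ?thesis .
  qed
  then show ?thesis
    by blast
qed

lemma chart_inj: "inj (chart G)"
proof -
  obtain q where q: "\<And>z y x. chart G (z, y, x) = lie_exp G (Zvec (z + q y x) + Yvec y + Xvec x)"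
    using chart_lie_exp by blast
  have inj: "inj (lie_exp G)"
    using lie_exp_bij by (rule bij_betw_imp_inj_on)
  show ?thesis
  proof (rule injI, clarsimp)
    fix z y x z' y' x' assume "chart G (z, y, x) = chart G (z', y', x')"
    then have "Zvec (z + q y x) + Yvec y + Xvec x = Zvec (z' + q y' x') + Yvec y' + Xvec x'"
      unfolding q by (rule injD[OF inj])
    from ZYX_unique[OF this] show "z = z' \<and> y = y' \<and> x = x'"
      by auto
  qed
qed

lemma chart_range: "range (chart G) = carrier G"
proof -
  obtain q where q: "\<And>z y x. chart G (z, y, x) = lie_exp G (Zvec (z + q y x) + Yvec y + Xvec x)"
    using chart_lie_exp by blast
  have "lie_exp G v \<in> range (chart G)" for v
  proof -
    obtain z y x where "v = Zvec z + Yvec y + Xvec x"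
      using ZYX_surj by blast
    then have "lie_exp G v = chart G (z - q y x, y, x)"
      by (simp add: q)
    then show ?thesis by blast
  qed
  then have "range (chart G) = range (lie_exp G)"
    using q by fastforce
  then show ?thesis
    using lie_exp_bij by (simp add: bij_betw_def)
qed

lemma coords_chart [simp]: "coords G (chart G p) = p"
  by (simp add: coords_def chart_inj)

lemma A_aut_chart: "A_aut G (chart G p) = chart G (axis_dilation 2 p)"
  by (simp add: A_aut_def axis_dilation_def case_prod_beta)

lemma A_aut_inj_on: "inj_on (A_aut G) (carrier G)"
proof (rule inj_onI)
  fix m m' assume "m \<in> carrier G" "m' \<in> carrier G" and eq: "A_aut G m = A_aut G m'"
  then obtain p p' where m: "m = chart G p" "m' = chart G p'"
    unfolding chart_range[symmetric] by blast
  have "axis_dilation 2 p = axis_dilation 2 p'"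
    using eq unfolding m A_aut_chart by (rule injD[OF chart_inj])
  then have "axis_dilation (1/2) (axis_dilation 2 p) = axis_dilation (1/2) (axis_dilation 2 p')"
    by simp
  then show "m = m'"
    by (simp add: m)
qed

lemma A_aut_inv_chart: "inv_into (carrier G) (A_aut G) (chart G p) = chart G (axis_dilation (1/2) p)"
proof -
  have "chart G p = A_aut G (chart G (axis_dilation (1/2) p))"
    by (simp add: A_aut_chart)
  moreover have "chart G (axis_dilation (1/2) p) \<in> carrier G"
    using chart_range by blast
  ultimately show ?thesis
    using inv_into_f_f[OF A_aut_inj_on] by simp
qed

lemma A_power_chart: "A_power G j (chart G p) = chart G (axis_dilation (2 powi j) p)"
proof -
  have 1: "(A_aut G ^^ n) (chart G p) = chart G (axis_dilation (2 ^ n) p)" for n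
    by (induction n) (simp_all add: A_aut_chart)
  have 2: "(inv_into (carrier G) (A_aut G) ^^ n) (chart G p) = chart G (axis_dilation ((1/2) ^ n) p)" for n
    by (induction n) (simp_all add: A_aut_inv_chart)
  show ?thesis
    by (auto simp: A_power_def 1 2 power_int_def power_one_over inverse_eq_divide)
qed

subsection \<open>Haar measure\<close>

lemma haar_distr: "haar G = distr lborel (haar G) (chart G)"
  unfolding haar_def by (rule embed_measure_eq_distr[OF chart_inj])

lemma chart_measurable: "chart G \<in> measurable lborel (haar G)"
  unfolding haar_def by (rule measurable_embed_measure2[OF chart_inj])

lemma haar_measurable_iff: "f \<in> measurable (haar G) N \<longleftrightarrow> (\<lambda>p. f (chart G p)) \<in> measurable borel N"
proof
  assume "f \<in> measurable (haar G) N"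
  from measurable_compose[OF chart_measurable this]
  show "(\<lambda>p. f (chart G p)) \<in> measurable borel N"
    by simp
next
  assume "(\<lambda>p. f (chart G p)) \<in> measurable borel N"
  then show "f \<in> measurable (haar G) N"
    unfolding haar_def by (intro measurable_embed_measure1) simp
qed

text \<open>As for the dilation above, non-measurable f satisfy both claims by default values, since
  measurability can be tested in coordinates.\<close>

lemma
  fixes f :: "'g \<Rightarrow> 'b::{banach, second_countable_topology}"
  shows integrable_haar_iff: "integrable (haar G) f \<longleftrightarrow> integrable lborel (\<lambda>p. f (chart G p))"
    and integral_haar: "(LINT m|haar G. f m) = (LINT p|lborel. f (chart G p))"
proof -
  have 1: "integrable (haar G) f \<longleftrightarrow> integrable lborel (\<lambda>p. f (chart G p))"
    "(LINT m|haar G. f m) = (LINT p|lborel. f (chart G p))"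
    if "f \<in> borel_measurable (haar G)"
  proof -
    have "integrable (haar G) f \<longleftrightarrow> integrable (distr lborel (haar G) (chart G)) f"
      using haar_distr by (rule arg_cong)
    also have "\<dots> \<longleftrightarrow> integrable lborel (\<lambda>p. f (chart G p))"
      using chart_measurable that by (rule integrable_distr_eq)
    finally show "integrable (haar G) f \<longleftrightarrow> integrable lborel (\<lambda>p. f (chart G p))" .
    have "(LINT m|haar G. f m) = (LINT m|distr lborel (haar G) (chart G). f m)"
      using haar_distr by (rule arg_cong)
    also have "\<dots> = (LINT p|lborel. f (chart G p))"
      using chart_measurable that by (rule integral_distr)
    finally show "(LINT m|haar G. f m) = (LINT p|lborel. f (chart G p))" .
  qed
  have 2: "integrable (haar G) f \<longleftrightarrow> integrable lborel (\<lambda>p. f (chart G p))"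
    "(LINT m|haar G. f m) = (LINT p|lborel. f (chart G p))"
    if f: "f \<notin> borel_measurable (haar G)"
  proof -
    have "\<not> integrable (haar G) f"
      using f borel_measurable_integrable[of "haar G" f] by auto
    moreover have "\<not> integrable lborel (\<lambda>p. f (chart G p))"
      using f borel_measurable_integrable[of lborel "\<lambda>p. f (chart G p)"]
      by (auto simp: haar_measurable_iff)
    ultimately show "integrable (haar G) f \<longleftrightarrow> integrable lborel (\<lambda>p. f (chart G p))"
      and "(LINT m|haar G. f m) = (LINT p|lborel. f (chart G p))"
      by (simp_all add: not_integrable_integral_eq)
  qed
  from 1 2 show "integrable (haar G) f \<longleftrightarrow> integrable lborel (\<lambda>p. f (chart G p))"
    and "(LINT m|haar G. f m) = (LINT p|lborel. f (chart G p))"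
    by blast+
qed

lemma L2_haar_iff: "f \<in> L2 (haar G) \<longleftrightarrow> (\<lambda>p. f (chart G p)) \<in> L2 lborel"
  by (simp add: L2_def haar_measurable_iff integrable_haar_iff)

lemma l2_inner_haar: "l2_inner (haar G) f g = l2_inner lborel (\<lambda>p. f (chart G p)) (\<lambda>p. g (chart G p))"
  by (simp add: l2_inner_def integral_haar)

lemma l2_norm_haar: "l2_norm (haar G) f = l2_norm lborel (\<lambda>p. f (chart G p))"
  by (simp add: l2_norm_def integral_haar)

subsection \<open>Unitarity of the dilations\<close>

text \<open>The square root of the Jacobian of the j-th power of A. The normalising factor of
  \<open>dilation G j\<close> is its value at - j, while its value at j is the factor by which the
  coefficients get multiplied.\<close>

definition dilation_const :: "int \<Rightarrow> real" where
  "dilation_const j = 2 powr (of_int j * real (CARD('z) + CARD('d)) / 2)"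

lemma dilation_const_pos [simp]: "dilation_const j > 0"
  by (simp add: dilation_const_def)

lemma dilation_const_add: "dilation_const (i + j) = dilation_const i * dilation_const j"
  by (simp add: dilation_const_def powr_add[symmetric] distrib_right add_divide_distrib)

lemma dilation_const_0 [simp]: "dilation_const 0 = 1"
  by (simp add: dilation_const_def)

lemma dilation_const_square: "dilation_const j * dilation_const j = (2 powi j) ^ (CARD('z) + CARD('d))"
proof -
  have "dilation_const j * dilation_const j = 2 powr (of_int j * real (CARD('z) + CARD('d)))"
    by (simp add: dilation_const_def powr_add[symmetric])
  also have "\<dots> = (2 powr of_int j) powr real (CARD('z) + CARD('d))"
    by (simp add: powr_powr)
  also have "\<dots> = (2 powr of_int j) ^ (CARD('z) + CARD('d))"
    by (rule powr_realpow) simp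
  also have "2 powr of_int j = (2 powi j :: real)"
    by (simp add: powr_real_of_int')
  finally show ?thesis .
qed

lemma dilation_chart:
  "dilation G j f (chart G p)
    = of_real (dilation_const (- j)) * f (chart G (axis_dilation (2 powi (- j)) p))"
  by (simp add: dilation_def A_power_chart dilation_const_def)

text \<open>Stated at points of the chart because the type may have elements outside the carrier,
  where \<open>coords\<close> is arbitrary. Integrals over \<open>haar G\<close> do not see
  these.\<close>

lemma dilation_dilation_chart: "dilation G i (dilation G j f) (chart G p) = dilation G (i + j) f (chart G p)"
  using dilation_const_add[of "-i" "-j"] power_int_add[of "2::real" "-i" "-j"]
  by (simp add: dilation_chart mult_ac)

lemma dilation_0_chart: "dilation G 0 f (chart G p) = f (chart G p)"
  by (simp add: dilation_chart)

lemma L2_dilation: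
  assumes f: "f \<in> L2 (haar G)"
  shows "dilation G j f \<in> L2 (haar G)"
proof -
  have "(\<lambda>p. f (chart G p)) \<in> borel_measurable borel"
    using L2_measurable[OF f] by (simp add: haar_measurable_iff)
  moreover have "integrable lborel (\<lambda>p. (cmod (f (chart G p)))\<^sup>2)"
    using L2_integrable[OF f] by (simp add: integrable_haar_iff)
  then have "integrable lborel (\<lambda>p. (cmod (f (chart G (axis_dilation (2 powi (- j)) p))))\<^sup>2)"
    by (subst (asm) integrable_axis_dilation_iff[of "2 powi (- j)"]) auto
  ultimately show ?thesis
    unfolding L2_def haar_measurable_iff integrable_haar_iff dilation_chart
    by (simp add: haar_measurable_iff integrable_haar_iff dilation_chart norm_mult power_mult_distrib
        measurable_compose[OF axis_dilation_measurable])
qed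

lemma l2_inner_dilation: "l2_inner (haar G) (dilation G j f) (dilation G j g) = l2_inner (haar G) f g"
proof -
  let ?c = "2 powi (- j) :: real"
  let ?F = "\<lambda>p. f (chart G p) * cnj (g (chart G p))"
  have "l2_inner (haar G) (dilation G j f) (dilation G j g)
      = (LINT p|lborel. of_real (dilation_const (-j) * dilation_const (-j)) * ?F (axis_dilation ?c p))"
    unfolding l2_inner_haar unfolding dilation_chart l2_inner_def
    by (intro Bochner_Integration.integral_cong) (simp_all add: mult_ac)
  also have "\<dots> = (?c ^ (CARD('z) + CARD('d))) *\<^sub>R (LINT p|lborel. ?F (axis_dilation ?c p))"
    unfolding dilation_const_square by (simp add: scaleR_conv_of_real)
  also have "\<dots> = l2_inner (haar G) f g"
    unfolding l2_inner_haar unfolding l2_inner_def by (rule integral_axis_dilation[symmetric]) simp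
  finally show ?thesis .
qed

lemma l2_norm_dilation: "l2_norm (haar G) (dilation G j f) = l2_norm (haar G) f"
  using l2_inner_dilation[of j f f] unfolding l2_inner_self of_real_eq_iff by simp

lemma l2_inner_dilation_right:
  "l2_inner (haar G) f (dilation G j g) = l2_inner (haar G) (dilation G (- j) f) g"
proof -
  have "l2_inner (haar G) f (dilation G j g)
      = l2_inner (haar G) (dilation G j (dilation G (- j) f)) (dilation G j g)"
    unfolding l2_inner_haar dilation_dilation_chart by (simp add: dilation_0_chart)
  then show ?thesis
    by (simp add: l2_inner_dilation)
qed

end

section \<open>The Plancherel measure\<close>

context nilpotent_group_setting
begin

lemma B_matrix_scaleR: "B_matrix G (c *\<^sub>R l) = c *\<^sub>R B_matrix G l"
  by (simp add: B_matrix_def functional_def vec_eq_iff sum_distrib_left mult.assoc)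

lemma det_B_scaleR: "det (B_matrix G (c *\<^sub>R l)) = c ^ CARD('d) * det (B_matrix G l)"
  by (simp add: B_matrix_scaleR det_def prod.distrib sum_distrib_left mult_ac)

lemma continuous_det_B: "continuous_on UNIV (\<lambda>l. det (B_matrix G l))"
  unfolding det_def B_matrix_def functional_def by (simp, intro continuous_intros)

lemma Sigma_open: "open (Sigma_set G)"
  unfolding Sigma_set_def
  by (rule open_Collect_neq[OF continuous_det_B continuous_on_const])

lemma Sigma_sets [measurable]: "Sigma_set G \<in> sets borel"
  using Sigma_open by (rule borel_open)

lemma det_B_measurable [measurable]: "(\<lambda>l. det (B_matrix G l)) \<in> borel_measurable borel"
  by (rule borel_measurable_continuous_onI[OF continuous_det_B])

lemma Sigma_scaleR: "c \<noteq> 0 \<Longrightarrow> c *\<^sub>R l \<in> Sigma_set G \<longleftrightarrow> l \<in> Sigma_set G"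
  by (simp add: Sigma_set_def det_B_scaleR)

lemma space_plancherel [simp]: "space (plancherel_measure G) = Sigma_set G"
  by (simp add: plancherel_measure_def space_restrict_space)

lemma sets_plancherel: "sets (plancherel_measure G) = sets (restrict_space borel (Sigma_set G))"
  by (simp add: plancherel_measure_def sets_restrict_space)

lemma measurable_plancherel: "measurable (plancherel_measure G) N = measurable (restrict_space borel (Sigma_set G)) N"
  by (rule measurable_cong_sets[OF sets_plancherel refl])

text \<open>Moves the integral to all of Euclidean space, where the linear change of variables for
  Lebesgue measure is available.\<close>

lemma nn_integral_plancherel:
  assumes "F \<in> borel_measurable (plancherel_measure G)"
  shows "(\<integral>\<^sup>+l. F l \<partial>plancherel_measure G)
    = (\<integral>\<^sup>+l. ennreal \<bar>det (B_matrix G l)\<bar> * (F l * indicator (Sigma_set G) l) \<partial>lborel)"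
proof -
  have F: "F \<in> borel_measurable (restrict_space lborel (Sigma_set G))"
    using assms unfolding measurable_plancherel by (simp cong: measurable_cong_sets sets_restrict_space_cong)
  have "(\<integral>\<^sup>+l. F l \<partial>plancherel_measure G)
      = (\<integral>\<^sup>+l. ennreal \<bar>det (B_matrix G l)\<bar> * F l \<partial>restrict_space lborel (Sigma_set G))"
    unfolding plancherel_measure_def
    by (rule nn_integral_density[OF _ F]) (auto intro!: measurable_restrict_space1)
  also have "\<dots> = (\<integral>\<^sup>+l. ennreal \<bar>det (B_matrix G l)\<bar> * F l * indicator (Sigma_set G) l \<partial>lborel)"
    by (rule nn_integral_restrict_space) simp
  finally show ?thesis
    by (simp add: mult.assoc)
qed

lemma scaleR_measurable_plancherel:
  assumes "c \<noteq> 0"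
  shows "(\<lambda>l. c *\<^sub>R l) \<in> measurable (plancherel_measure G) (plancherel_measure G)"
proof -
  have "(\<lambda>l. c *\<^sub>R l) \<in> measurable (restrict_space borel (Sigma_set G)) (restrict_space borel (Sigma_set G))"
    using assms by (intro measurable_restrict_space3) (auto simp: Sigma_scaleR)
  then show ?thesis
    by (simp cong: measurable_cong_sets add: sets_plancherel measurable_plancherel)
qed

text \<open>Lebesgue measure contributes one factor c for each central coordinate, and the density,
  a determinant of size d with entries linear in l, contributes c to the power d.\<close>

lemma nn_integral_plancherel_scaleR:
  assumes c: "c > 0" and F: "F \<in> borel_measurable (plancherel_measure G)"
  shows "(\<integral>\<^sup>+l. F l \<partial>plancherel_measure G)
    = ennreal (c ^ (CARD('z) + CARD('d))) * (\<integral>\<^sup>+l. F (c *\<^sub>R l) \<partial>plancherel_measure G)"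
proof -
  define H where "H l = ennreal \<bar>det (B_matrix G l)\<bar> * (F l * indicator (Sigma_set G) l)" for l
  have [measurable]: "(\<lambda>l. F l * indicator (Sigma_set G) l) \<in> borel_measurable borel"
    using F unfolding measurable_plancherel
    by (subst (asm) borel_measurable_restrict_space_iff_ennreal) simp_all
  have H [measurable]: "H \<in> borel_measurable borel"
    unfolding H_def by measurable
  have Fc: "(\<lambda>l. F (c *\<^sub>R l)) \<in> borel_measurable (plancherel_measure G)"
    using measurable_compose[OF scaleR_measurable_plancherel F] c by simp
  let ?D = "density (distr lborel borel (\<lambda>l::(real, 'z) vec. 0 + c *\<^sub>R l)) (\<lambda>_. ennreal (\<bar>c\<bar> ^ DIM((real, 'z) vec)))"
  have "(\<integral>\<^sup>+l. F l \<partial>plancherel_measure G) = (\<integral>\<^sup>+l. H l \<partial>lborel)"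
    unfolding H_def by (rule nn_integral_plancherel[OF F])
  also have "\<dots> = (\<integral>\<^sup>+l. H l \<partial>?D)"
    using c by (intro arg_cong2[where f=nn_integral] lborel_affine refl) simp
  also have "\<dots> = (\<integral>\<^sup>+l. ennreal (c ^ CARD('z)) * H l \<partial>distr lborel borel (\<lambda>l. 0 + c *\<^sub>R l))"
    using c by (subst nn_integral_density) auto
  also have "\<dots> = (\<integral>\<^sup>+l. ennreal (c ^ CARD('z)) * H (c *\<^sub>R l) \<partial>lborel)"
    by (subst nn_integral_distr) auto
  also have "\<dots> = (\<integral>\<^sup>+l. ennreal (c ^ (CARD('z) + CARD('d))) *
      (ennreal \<bar>det (B_matrix G l)\<bar> * (F (c *\<^sub>R l) * indicator (Sigma_set G) l)) \<partial>lborel)"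
  proof (rule nn_integral_cong)
    fix l
    have 1: "ennreal (c ^ CARD('z)) * ennreal \<bar>det (B_matrix G (c *\<^sub>R l))\<bar>
        = ennreal (c ^ (CARD('z) + CARD('d))) * ennreal \<bar>det (B_matrix G l)\<bar>"
      using c by (simp add: det_B_scaleR abs_mult power_add flip: ennreal_mult)
    have 2: "indicator (Sigma_set G) (c *\<^sub>R l) = (indicator (Sigma_set G) l :: ennreal)"
      using c by (simp add: indicator_def Sigma_scaleR)
    show "ennreal (c ^ CARD('z)) * H (c *\<^sub>R l) = ennreal (c ^ (CARD('z) + CARD('d))) *
      (ennreal \<bar>det (B_matrix G l)\<bar> * (F (c *\<^sub>R l) * indicator (Sigma_set G) l))"
      by (simp only: H_def 2 mult.assoc[symmetric] 1)
  qed
  also have "\<dots> = ennreal (c ^ (CARD('z) + CARD('d))) * (\<integral>\<^sup>+l.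
      ennreal \<bar>det (B_matrix G l)\<bar> * (F (c *\<^sub>R l) * indicator (Sigma_set G) l) \<partial>lborel)"
  proof (rule nn_integral_cmult)
    have [measurable]: "(\<lambda>l. F (c *\<^sub>R l) * indicator (Sigma_set G) l) \<in> borel_measurable borel"
      using Fc unfolding measurable_plancherel
      by (subst (asm) borel_measurable_restrict_space_iff_ennreal) simp_all
    show "(\<lambda>l. ennreal \<bar>det (B_matrix G l)\<bar> * (F (c *\<^sub>R l) * indicator (Sigma_set G) l)) \<in> borel_measurable lborel"
      by measurable
  qed
  also have "(\<integral>\<^sup>+l. ennreal \<bar>det (B_matrix G l)\<bar> * (F (c *\<^sub>R l) * indicator (Sigma_set G) l) \<partial>lborel)
      = (\<integral>\<^sup>+l. F (c *\<^sub>R l) \<partial>plancherel_measure G)"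
    by (rule nn_integral_plancherel[OF Fc, symmetric])
  finally show ?thesis .
qed

text \<open>A preimage of a null set under scaling is null, by the scaling formula for its
  indicator. Needed because coefficients, known only almost everywhere, will be evaluated at scaled
  points.\<close>

lemma AE_plancherel_scaleR:
  assumes c: "c > 0" and Q: "AE l in plancherel_measure G. Q l"
  shows "AE l in plancherel_measure G. Q (c *\<^sub>R l)"
proof -
  let ?\<mu> = "plancherel_measure G"
  from Q obtain N where N: "{l \<in> space ?\<mu>. \<not> Q l} \<subseteq> N" "emeasure ?\<mu> N = 0" "N \<in> sets ?\<mu>"
    by (rule AE_E)
  have iN: "(indicator N :: _ \<Rightarrow> ennreal) \<in> borel_measurable ?\<mu>"
    using N(3) by simp
  have "0 = (\<integral>\<^sup>+l. indicator N l \<partial>?\<mu>)"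
    using N by simp
  also have "\<dots> = ennreal (c ^ (CARD('z) + CARD('d))) * (\<integral>\<^sup>+l. indicator N (c *\<^sub>R l) \<partial>?\<mu>)"
    by (rule nn_integral_plancherel_scaleR[OF c iN])
  finally have "(\<integral>\<^sup>+l. indicator N (c *\<^sub>R l) \<partial>?\<mu>) = 0"
    using c by simp
  moreover have "(\<lambda>l. indicator N (c *\<^sub>R l) :: ennreal) \<in> borel_measurable ?\<mu>"
    using measurable_compose[OF scaleR_measurable_plancherel iN] c by simp
  ultimately have "AE l in ?\<mu>. indicator N (c *\<^sub>R l) = (0::ennreal)"
    by (simp add: nn_integral_0_iff_AE)
  moreover have "AE l in ?\<mu>. l \<in> Sigma_set G"
    using AE_space[of ?\<mu>] by simp
  ultimately show ?thesis
  proof eventually_elim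
    case (elim l)
    then have "c *\<^sub>R l \<in> space ?\<mu>" "c *\<^sub>R l \<notin> N"
      using c by (auto simp: Sigma_scaleR indicator_eq_0_iff)
    then show ?case
      using N(1) by auto
  qed
qed

subsection \<open>The Fourier transform of a dilated function\<close>

text \<open>The parameter l enters through the pairing of l with z and through B(l) y, both linear
  in l, so a factor on z and y can be moved to l. The translation by x does not involve l, and x is
  not stretched.\<close>

lemma rep_axis_dilation: "rep G l (chart G (axis_dilation c p)) = rep G (c *\<^sub>R l) (chart G p)"
  by (cases p) (simp add: rep_def axis_dilation_def pi_Z_def pi_Y_def fun_eq_iff B_matrix_scaleR
      matrix_vector_mult_scaleR flip: scaleR_matrix_vector_assoc)

text \<open>Substitute in the weak integral. The function brings the factor
  \<open>dilation_const (- j)\<close> and the change of variables brings the Jacobian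
  \<open>dilation_const j\<close> squared; their product is \<open>dilation_const j\<close>.\<close>

lemma is_fourier_dilation:
  assumes T: "is_fourier G (dilation G j f) l T" and T': "is_fourier G f (2 powi j *\<^sub>R l) T'"
    and "\<phi> \<in> L2 lborel" "\<psi> \<in> L2 lborel"
  shows "l2_inner lborel (T \<phi>) \<psi> = of_real (dilation_const j) * l2_inner lborel (T' \<phi>) \<psi>"
proof -
  define W where "W l p = l2_inner lborel (rep G l (chart G p) \<phi>) \<psi>" for l p
  let ?b = "2 powi j :: real" and ?c = "2 powi (- j) :: real"
  let ?F = "\<lambda>p. f (chart G p) * W (?b *\<^sub>R l) p"
  have ab: "dilation_const j * dilation_const (-j) = 1"
    using dilation_const_add[of j "-j"] by simp
  \<comment> \<open>The dilation is imposed on the matrix coefficient too, at the price of scaling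
    l, so that the whole integrand becomes a dilated function.\<close>
  have W: "W l p = W (?b *\<^sub>R l) (axis_dilation ?c p)" for p
    using rep_axis_dilation[of l ?b "axis_dilation ?c p"] by (simp add: W_def power_int_minus)
  have "l2_inner lborel (T \<phi>) \<psi> = (LINT m|haar G. dilation G j f m * l2_inner lborel (rep G l m \<phi>) \<psi>)"
    using T assms(3,4) unfolding is_fourier_def by simp
  also have "\<dots> = (LINT p|lborel. of_real (dilation_const (-j)) * ?F (axis_dilation ?c p))"
    unfolding integral_haar dilation_chart W_def[symmetric] W by (simp add: mult.assoc)
  also have "\<dots> = of_real (dilation_const (-j)) * (LINT p|lborel. ?F (axis_dilation ?c p))"
    by simp
  also have "(LINT p|lborel. ?F (axis_dilation ?c p))
      = of_real (dilation_const j * dilation_const j) * (LINT p|lborel. ?F p)"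
  proof -
    have 1: "dilation_const j * dilation_const j * (dilation_const (-j) * dilation_const (-j)) = 1"
      using ab by algebra
    have "(LINT p|lborel. ?F p) = of_real (dilation_const (-j) * dilation_const (-j))
        * (LINT p|lborel. ?F (axis_dilation ?c p))"
      unfolding dilation_const_square[of "-j"] scaleR_conv_of_real[symmetric]
      by (rule integral_axis_dilation) simp
    then show ?thesis
      by (simp only: mult.assoc[symmetric] of_real_mult[symmetric] 1[simplified mult.assoc[symmetric]])
         simp
  qed
  also have "of_real (dilation_const (-j)) * (of_real (dilation_const j * dilation_const j) * (LINT p|lborel. ?F p))
      = of_real (dilation_const j) * (LINT p|lborel. ?F p)"
  proof -
    have "dilation_const (-j) * (dilation_const j * dilation_const j) = dilation_const j"
      using ab by algebra
    then show ?thesis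
      by (simp only: mult.assoc[symmetric] of_real_mult[symmetric])
  qed
  also have "(LINT p|lborel. ?F p) = (LINT m|haar G. f m * l2_inner lborel (rep G (?b *\<^sub>R l) m \<phi>) \<psi>)"
    unfolding integral_haar W_def ..
  also have "\<dots> = l2_inner lborel (T' \<phi>) \<psi>"
    using T' assms(3,4) unfolding is_fourier_def by simp
  finally show ?thesis .
qed

end

section \<open>Matrix coefficients of the Plancherel transform\<close>

locale plancherel_setting = nilpotent_group_setting G
  for G :: "('g, 'n::real_vector, 'z::{finite,linorder}, 'd::{finite,linorder}) nilpotent_group" +
  fixes P :: "('g \<Rightarrow> complex) \<Rightarrow> (real, 'z) vec \<Rightarrow> 'd oper"
    and I :: "'i set" and e :: "'i \<Rightarrow> (real, 'd) vec \<Rightarrow> complex"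
  assumes plancherel: "plancherel_transform G P"
    and countable_I: "countable I"
    and e: "orthonormal_basis lborel I e"
begin

abbreviation \<mu> :: "(real, 'z) vec measure" where "\<mu> \<equiv> plancherel_measure G"

text \<open>The index k is the column (input vector) and i the row. A rank-one operator \<phi>
  \<otimes> e k has its only possibly nonzero entries in column k, so columns label the spaces of
  the decomposition.\<close>

definition coef :: "('g \<Rightarrow> complex) \<Rightarrow> 'i \<Rightarrow> 'i \<Rightarrow> (real, 'z) vec \<Rightarrow> complex" where
  "coef f k i l = l2_inner lborel (P f l (e k)) (e i)"

lemma e_L2: "k \<in> I \<Longrightarrow> e k \<in> L2 lborel"
  by (rule onb_L2[OF e])

lemma P_direct: "f \<in> L2 (haar G) \<Longrightarrow> P f \<in> direct_integral G"
  using plancherel unfolding plancherel_transform_def by (elim conjE) (erule (1) bspec)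

lemma P_linear:
  assumes "f \<in> L2 (haar G)" "g \<in> L2 (haar G)"
  shows "field_eq G (P (\<lambda>m. a * f m + b * g m)) (\<lambda>l \<phi> t. a * P f l \<phi> t + b * P g l \<phi> t)"
  using plancherel assms unfolding plancherel_transform_def
  by (elim conjE) (drule (1) bspec[where P="\<lambda>f. \<forall>g\<in>_. _ f g"], blast)

lemma P_isometric:
  "f \<in> L2 (haar G) \<Longrightarrow> (\<integral>\<^sup>+ l. hs_norm_sq (P f l) \<partial>\<mu>) = ennreal ((l2_norm (haar G) f)\<^sup>2)"
  using plancherel unfolding plancherel_transform_def by (elim conjE) (erule (1) bspec)

lemma P_surj: "T \<in> direct_integral G \<Longrightarrow> \<exists>f\<in>L2 (haar G). field_eq G (P f) T"
  using plancherel unfolding plancherel_transform_def by (elim conjE) (erule (1) bspec)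

lemma P_fourier:
  "f \<in> L2 (haar G) \<Longrightarrow> integrable (haar G) f \<Longrightarrow> AE l in \<mu>. is_fourier G f l (P f l)"
  using plancherel unfolding plancherel_transform_def
  by (elim conjE) (drule (1) bspec, erule (1) mp)

lemma P_bounded: "f \<in> L2 (haar G) \<Longrightarrow> l \<in> Sigma_set G \<Longrightarrow> bounded_operator (P f l)"
  using P_direct[of f] by (simp add: direct_integral_def hilbert_schmidt_def)

lemma P_L2: "f \<in> L2 (haar G) \<Longrightarrow> l \<in> Sigma_set G \<Longrightarrow> k \<in> I \<Longrightarrow> P f l (e k) \<in> L2 lborel"
  by (rule bounded_operator_L2[OF P_bounded e_L2])

lemma AE_Sigma: "AE l in \<mu>. l \<in> Sigma_set G"
  using AE_space[of \<mu>] by simp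

lemma coef_measurable:
  "f \<in> L2 (haar G) \<Longrightarrow> k \<in> I \<Longrightarrow> i \<in> I \<Longrightarrow> coef f k i \<in> borel_measurable \<mu>"
  using P_direct[of f] e_L2[of k] e_L2[of i]
  by (simp add: direct_integral_def coef_def[abs_def])

text \<open>The quantifiers over k and i stand inside the AE: linearity of \<open>P\<close> holds as
  an equality of operators off one null set of l.\<close>

lemma coef_linear:
  assumes f: "f \<in> L2 (haar G)" and g: "g \<in> L2 (haar G)"
  shows "AE l in \<mu>. \<forall>k\<in>I. \<forall>i\<in>I.
    coef (\<lambda>m. a * f m + b * g m) k i l = a * coef f k i l + b * coef g k i l"
  using P_linear[OF f g, of a b, unfolded field_eq_def] AE_Sigma
proof eventually_elim
  case (elim l)
  have fg: "(\<lambda>m. a * f m + b * g m) \<in> L2 (haar G)"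
    using f g by auto
  note L2 = P_L2[OF _ elim(2)]
  show ?case
  proof (intro ballI)
    fix k i assume k: "k \<in> I" and i: "i \<in> I"
    have "coef (\<lambda>m. a * f m + b * g m) k i l
        = l2_inner lborel (\<lambda>t. a * P f l (e k) t + b * P g l (e k) t) (e i)"
      unfolding coef_def using elim(1) e_L2[OF k] e_L2[OF i]
      by (intro l2_inner_cong_AE L2_measurable L2 fg f g k L2_add L2_cmult) (auto simp: op_eq_def)
    also have "\<dots> = a * coef f k i l + b * coef g k i l"
      by (simp add: coef_def l2_inner_add_left L2_cmult L2 f g k i e_L2 l2_inner_cmult_left)
    finally show "coef (\<lambda>m. a * f m + b * g m) k i l = a * coef f k i l + b * coef g k i l" .
  qed
qed

section \<open>Norms, cut-offs and orthogonality in terms of coefficients\<close>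

lemma hs_norm_sq_coef:
  assumes "f \<in> L2 (haar G)" "l \<in> Sigma_set G"
  shows "hs_norm_sq (P f l) = (\<Sum>\<^sub>\<infinity>k\<in>I. \<Sum>\<^sub>\<infinity>i\<in>I. ennreal ((cmod (coef f k i l))\<^sup>2))"
  unfolding hs_norm_sq_matrix[OF e P_bounded[OF assms]] coef_def ..

text \<open>By Parseval this is the squared norm of \<open>P f l (e k)\<close> for l in \<Sigma>.
  The expanded form exposes measurability in l and changes under cut-offs entry by entry.\<close>

definition energy :: "('g \<Rightarrow> complex) \<Rightarrow> 'i \<Rightarrow> (real, 'z) vec \<Rightarrow> ennreal" where
  "energy f k l = (\<Sum>\<^sub>\<infinity>i\<in>I. ennreal ((cmod (coef f k i l))\<^sup>2))"

lemma energy_measurable: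
  assumes "f \<in> L2 (haar G)" "k \<in> I"
  shows "energy f k \<in> borel_measurable \<mu>"
  unfolding energy_def[abs_def]
proof (rule borel_measurable_infsum_ennreal[OF countable_I])
  fix i assume "i \<in> I"
  then have [measurable]: "coef f k i \<in> borel_measurable \<mu>"
    using assms by (intro coef_measurable)
  show "(\<lambda>l. ennreal ((cmod (coef f k i l))\<^sup>2)) \<in> borel_measurable \<mu>"
    by measurable
qed

lemma total_energy_measurable:
  "f \<in> L2 (haar G) \<Longrightarrow> (\<lambda>l. \<Sum>\<^sub>\<infinity>k\<in>I. energy f k l) \<in> borel_measurable \<mu>"
  by (rule borel_measurable_infsum_ennreal[OF countable_I energy_measurable])

lemma norm_energy:
  assumes "f \<in> L2 (haar G)"
  shows "ennreal ((l2_norm (haar G) f)\<^sup>2) = (\<integral>\<^sup>+l. (\<Sum>\<^sub>\<infinity>k\<in>I. energy f k l) \<partial>\<mu>)"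
  unfolding P_isometric[OF assms, symmetric] energy_def
  by (intro nn_integral_cong hs_norm_sq_coef assms) simp

text \<open>Each coefficient is a contraction into L2 of \<mu>: the continuity on which the density
  argument for dilations rests.\<close>

lemma coef_norm_le:
  assumes "f \<in> L2 (haar G)" "k \<in> I" "i \<in> I"
  shows "(\<integral>\<^sup>+l. ennreal ((cmod (coef f k i l))\<^sup>2) \<partial>\<mu>) \<le> ennreal ((l2_norm (haar G) f)\<^sup>2)"
  unfolding norm_energy[OF assms(1)]
proof (rule nn_integral_mono)
  fix l
  have "ennreal ((cmod (coef f k i l))\<^sup>2) \<le> energy f k l"
    unfolding energy_def
    using infsum_ennreal_ge_sum[of "{i}" I "\<lambda>i. ennreal ((cmod (coef f k i l))\<^sup>2)"] assms by simp
  also have "\<dots> \<le> (\<Sum>\<^sub>\<infinity>k\<in>I. energy f k l)"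
    using infsum_ennreal_ge_sum[of "{k}" I "\<lambda>k. energy f k l"] assms by simp
  finally show "ennreal ((cmod (coef f k i l))\<^sup>2) \<le> (\<Sum>\<^sub>\<infinity>k\<in>I. energy f k l)" .
qed

text \<open>The orthogonal projection of f onto column k over C. It is built on the side of the
  operator fields, where it is an explicit truncation, and pulled back through surjectivity of
  \<open>P\<close>.\<close>

lemma coef_cutoff:
  assumes f: "f \<in> L2 (haar G)" and k: "k \<in> I" and C: "C \<in> sets borel"
  obtains g where "g \<in> L2 (haar G)"
    "AE l in \<mu>. \<forall>k'\<in>I. \<forall>i\<in>I. coef g k' i l = (if k' = k \<and> l \<in> C then coef f k i l else 0)"
proof -
  define T where "T l = (if l \<in> C then rank_one (P f l (e k)) (e k) else (\<lambda>_ _. 0))" for l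
  have bdd: "bounded_operator (T l)" if "l \<in> Sigma_set G" for l
    using that unfolding T_def
    by (auto intro: bounded_operator_zero bounded_operator_rank_one P_L2 f k e_L2)
  have coefT: "l2_inner lborel (T l (e k')) (e i) = (if k' = k \<and> l \<in> C then coef f k i l else 0)"
    if "k' \<in> I" "i \<in> I" for l k' i
    using that k by (auto simp: T_def rank_one_def l2_inner_cmult_left onb_inner[OF e] coef_def)
  \<comment> \<open>Every entry of the truncated operator is an entry of \<open>P f l\<close> or 0,
    so square integrability of the field is inherited from f.\<close>
  have hs: "hs_norm_sq (T l) \<le> hs_norm_sq (P f l)" if "l \<in> Sigma_set G" for l
    unfolding hs_norm_sq_matrix[OF e bdd[OF that]] hs_norm_sq_matrix[OF e P_bounded[OF f that]]
  proof (rule has_sum_mono[OF has_sum_infsum_ennreal has_sum_infsum_ennreal],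
         rule has_sum_mono[OF has_sum_infsum_ennreal has_sum_infsum_ennreal])
    fix k' i assume "k' \<in> I" "i \<in> I"
    then show "ennreal ((cmod (l2_inner lborel (T l (e k')) (e i)))\<^sup>2)
        \<le> ennreal ((cmod (l2_inner lborel (P f l (e k')) (e i)))\<^sup>2)"
      by (auto simp: coefT coef_def)
  qed
  have "T \<in> direct_integral G"
    unfolding direct_integral_def
  proof (intro CollectI conjI ballI)
    fix l assume l: "l \<in> Sigma_set G"
    have "hs_norm_sq (P f l) < \<infinity>"
      using P_direct[OF f] l by (simp add: direct_integral_def hilbert_schmidt_def)
    with hs[OF l] bdd[OF l] show "hilbert_schmidt (T l)"
      unfolding hilbert_schmidt_def by (auto intro: le_less_trans)
  next
    fix \<phi> \<psi> :: "(real, 'd) vec \<Rightarrow> complex" assume "\<phi> \<in> L2 lborel" "\<psi> \<in> L2 lborel"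
    then have [measurable]: "(\<lambda>l. l2_inner lborel (P f l (e k)) \<psi>) \<in> borel_measurable \<mu>"
      using P_direct[OF f] e_L2[OF k] by (simp add: direct_integral_def)
    have "C \<inter> space \<mu> \<in> sets \<mu>"
      using C by (auto simp: sets_plancherel sets_restrict_space)
    then have [measurable]: "Measurable.pred \<mu> (\<lambda>l. l \<in> C)"
      by (simp add: pred_def Int_def conj_commute)
    have "(\<lambda>l. l2_inner lborel (T l \<phi>) \<psi>)
        = (\<lambda>l. if l \<in> C then l2_inner lborel \<phi> (e k) * l2_inner lborel (P f l (e k)) \<psi> else 0)"
      by (auto simp: T_def rank_one_def l2_inner_cmult_left)
    also have "\<dots> \<in> borel_measurable \<mu>"
      by measurable
    finally show "(\<lambda>l. l2_inner lborel (T l \<phi>) \<psi>) \<in> borel_measurable \<mu>" .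
  next
    have "(\<integral>\<^sup>+ l. hs_norm_sq (T l) \<partial>\<mu>) \<le> (\<integral>\<^sup>+ l. hs_norm_sq (P f l) \<partial>\<mu>)"
      by (intro nn_integral_mono hs) simp
    then show "(\<integral>\<^sup>+ l. hs_norm_sq (T l) \<partial>\<mu>) < \<infinity>"
      unfolding P_isometric[OF f] by (rule le_less_trans) simp
  qed
  then obtain g where g: "g \<in> L2 (haar G)" "field_eq G (P g) T"
    using P_surj by blast
  from g(2)[unfolded field_eq_def] AE_Sigma
  have "AE l in \<mu>. \<forall>k'\<in>I. \<forall>i\<in>I. coef g k' i l = (if k' = k \<and> l \<in> C then coef f k i l else 0)"
  proof eventually_elim
    case (elim l)
    have "coef g k' i l = l2_inner lborel (T l (e k')) (e i)" if "k' \<in> I" "i \<in> I" for k' i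
      unfolding coef_def using that elim e_L2
      by (intro l2_inner_cong_AE L2_measurable P_L2 g(1) bounded_operator_L2[OF bdd]) (auto simp: op_eq_def)
    then show ?case
      by (simp add: coefT)
  qed
  with g(1) show ?thesis
    by (rule that)
qed

text \<open>The equivalence holds at every l in \<Sigma>, so no null set has to be chosen.
  Orthonormality of e makes \<phi> \<otimes> e k vanish on all other e k'; conversely the vector
  \<phi> can be recovered as the image of e k.\<close>

lemma H_space_iff:
  assumes k: "k \<in> I"
  shows "f \<in> H_space G P j (e k) \<longleftrightarrow> f \<in> L2 (haar G) \<and>
    (AE l in \<mu>. \<forall>k'\<in>I. \<forall>i\<in>I. k' \<noteq> k \<or> l \<notin> E_scaled G j \<longrightarrow> coef f k' i l = 0)"
proof (cases "f \<in> L2 (haar G)")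
  case f: True
  have "(l \<in> E_scaled G j \<longrightarrow> (\<exists>\<phi>\<in>L2 lborel. op_eq (P f l) (rank_one \<phi> (e k)))) \<and>
        (l \<notin> E_scaled G j \<longrightarrow> op_eq (P f l) (\<lambda>_ _. 0)) \<longleftrightarrow>
      (\<forall>k'\<in>I. \<forall>i\<in>I. k' \<noteq> k \<or> l \<notin> E_scaled G j \<longrightarrow> coef f k' i l = 0)" (is "?L \<longleftrightarrow> ?R")
    if l: "l \<in> Sigma_set G" for l
  proof
    assume L: ?L
    show ?R
    proof (intro ballI impI)
      fix k' i assume k': "k' \<in> I" and i: "i \<in> I" and or: "k' \<noteq> k \<or> l \<notin> E_scaled G j"
      have "AE t in lborel. P f l (e k') t = 0"
      proof (cases "l \<in> E_scaled G j")
        case True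
        with L obtain \<phi> where "op_eq (P f l) (rank_one \<phi> (e k))"
          by blast
        then show ?thesis
          using True or k k' e_L2[OF k'] by (auto simp: op_eq_def rank_one_def onb_inner[OF e])
      next
        case False
        with L show ?thesis
          using e_L2[OF k'] by (simp add: op_eq_def)
      qed
      then have "l2_inner lborel (P f l (e k')) (e i) = l2_inner lborel (\<lambda>_. 0) (e i)"
        by (intro l2_inner_cong_AE L2_measurable P_L2 f l k' e_L2 i L2_zero) auto
      then show "coef f k' i l = 0"
        by (simp add: coef_def)
    qed
  next
    assume R: ?R
    note bdd = P_bounded[OF f l]
    show ?L
    proof (intro conjI impI)
      assume "l \<in> E_scaled G j"
      have "op_eq (P f l) (rank_one (P f l (e k)) (e k))"
        using R by (intro op_eq_rank_one[OF e bdd k]) (auto simp: coef_def)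
      then show "\<exists>\<phi>\<in>L2 lborel. op_eq (P f l) (rank_one \<phi> (e k))"
        using P_L2[OF f l k] by blast
    next
      assume "l \<notin> E_scaled G j"
      then show "op_eq (P f l) (\<lambda>_ _. 0)"
        using R by (intro op_eq_zero[OF e bdd]) (auto simp: coef_def)
    qed
  qed
  then have "(AE l in \<mu>. (l \<in> E_scaled G j \<longrightarrow> (\<exists>\<phi>\<in>L2 lborel. op_eq (P f l) (rank_one \<phi> (e k)))) \<and>
        (l \<notin> E_scaled G j \<longrightarrow> op_eq (P f l) (\<lambda>_ _. 0))) \<longleftrightarrow>
      (AE l in \<mu>. \<forall>k'\<in>I. \<forall>i\<in>I. k' \<noteq> k \<or> l \<notin> E_scaled G j \<longrightarrow> coef f k' i l = 0)"
    by (intro AE_cong) simp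
  then show ?thesis
    using P_direct[OF f] f by (simp add: H_space_def direct_integral_over_def)
qed (simp add: H_space_def)

text \<open>Polarization. At almost every l no entry is nonzero for both functions, so adding a
  multiple of g to f adds the energies, and the norm identity forces Re (c * \<langle>f, g\<rangle>)
  = 0 for every scalar c. The values 1 and \<i> give the real and the imaginary part.\<close>

lemma coef_orthogonal:
  assumes f: "f \<in> L2 (haar G)" and g: "g \<in> L2 (haar G)"
    and disj: "AE l in \<mu>. \<forall>k\<in>I. \<forall>i\<in>I. coef f k i l = 0 \<or> coef g k i l = 0"
  shows "l2_inner (haar G) f g = 0"
proof -
  have Re0: "Re (c * l2_inner (haar G) f g) = 0" for c
  proof -
    define h where "h = (\<lambda>m. cnj c * g m)"
    have h: "h \<in> L2 (haar G)"
      using g by (auto simp: h_def)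
    define s where "s = (\<lambda>m. 1 * f m + cnj c * g m)"
    have s: "s \<in> L2 (haar G)"
      using f g unfolding s_def by (intro L2_add L2_cmult)
    have lin: "AE l in \<mu>. \<forall>k\<in>I. \<forall>i\<in>I. coef h k i l = 0 * coef f k i l + cnj c * coef g k i l"
      using coef_linear[OF f g, of 0 "cnj c"] by (simp add: h_def)
    have "AE l in \<mu>. (\<Sum>\<^sub>\<infinity>k\<in>I. energy s k l) = (\<Sum>\<^sub>\<infinity>k\<in>I. energy f k l) + (\<Sum>\<^sub>\<infinity>k\<in>I. energy h k l)"
      using disj lin coef_linear[OF f g, of 1 "cnj c", folded s_def]
    proof eventually_elim
      case (elim l)
      have "ennreal ((cmod (coef s k i l))\<^sup>2)
          = ennreal ((cmod (coef f k i l))\<^sup>2) + ennreal ((cmod (coef h k i l))\<^sup>2)"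
        if k: "k \<in> I" and i: "i \<in> I" for k i
      proof -
        have "coef s k i l = 1 * coef f k i l + cnj c * coef g k i l"
          "coef h k i l = 0 * coef f k i l + cnj c * coef g k i l"
          using elim(2,3) k i by blast+
        moreover have "coef f k i l = 0 \<or> coef g k i l = 0"
          using elim(1) k i by blast
        ultimately show ?thesis
          by (elim disjE) simp_all
      qed
      then have "energy s k l = energy f k l + energy h k l" if "k \<in> I" for k
        unfolding energy_def infsum_ennreal_add[symmetric] using that by (intro infsum_cong)
      then show ?case
        unfolding infsum_ennreal_add[symmetric] by (intro infsum_cong)
    qed
    then have "ennreal ((l2_norm (haar G) s)\<^sup>2)
        = (\<integral>\<^sup>+l. (\<Sum>\<^sub>\<infinity>k\<in>I. energy f k l) + (\<Sum>\<^sub>\<infinity>k\<in>I. energy h k l) \<partial>\<mu>)"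
      unfolding norm_energy[OF s] by (rule nn_integral_cong_AE)
    also have "\<dots> = ennreal ((l2_norm (haar G) f)\<^sup>2) + ennreal ((l2_norm (haar G) h)\<^sup>2)"
      unfolding norm_energy[OF f] norm_energy[OF h]
      by (intro nn_integral_add total_energy_measurable f h)
    also have "\<dots> = ennreal ((l2_norm (haar G) f)\<^sup>2 + (l2_norm (haar G) h)\<^sup>2)"
      by (rule ennreal_plus[symmetric]) simp_all
    finally have "(l2_norm (haar G) s)\<^sup>2 = (l2_norm (haar G) f)\<^sup>2 + (l2_norm (haar G) h)\<^sup>2"
      by (subst (asm) ennreal_inj) simp_all
    moreover have "(l2_norm (haar G) s)\<^sup>2 = (l2_norm (haar G) f)\<^sup>2 + (l2_norm (haar G) h)\<^sup>2
        + 2 * Re (l2_inner (haar G) f h)"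
      using l2_norm_add_square[OF f h] by (simp add: s_def h_def)
    ultimately show ?thesis
      by (simp add: h_def l2_inner_cmult_right)
  qed
  show ?thesis
    using Re0[of 1] Re0[of \<i>] by (simp add: complex_eq_iff)
qed

end

section \<open>The dyadic tiling of the dual\<close>

context nilpotent_group_setting
begin

text \<open>The determinant is homogeneous of degree d, and d is positive since index types are
  nonempty. The origin is the one point that no dyadic shell can reach.\<close>

lemma zero_notin_Sigma: "0 \<notin> Sigma_set G"
  using det_B_scaleR[of 0 0] by (simp add: Sigma_set_def power_0_left)

lemma E_scaled_iff: "l \<in> E_scaled G j \<longleftrightarrow> 2 powi j *\<^sub>R l \<in> E_set G"
proof
  assume "l \<in> E_scaled G j"
  then obtain l' where "l' \<in> E_set G" "l = 2 powi (- j) *\<^sub>R l'"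
    by (auto simp: E_scaled_def)
  then show "2 powi j *\<^sub>R l \<in> E_set G"
    by (simp add: power_int_minus)
next
  assume "2 powi j *\<^sub>R l \<in> E_set G"
  moreover have "l = 2 powi (- j) *\<^sub>R (2 powi j *\<^sub>R l)"
    by (simp add: power_int_minus)
  ultimately show "l \<in> E_scaled G j"
    unfolding E_scaled_def by blast
qed

lemma E_scaled_scaleR: "2 powi i *\<^sub>R l \<in> E_scaled G j \<longleftrightarrow> l \<in> E_scaled G (j + i)"
  by (simp add: E_scaled_iff power_int_add)

lemma E_scaled_sets: "E_scaled G j \<in> sets borel"
proof -
  have "E_set G \<in> sets borel"
    unfolding E_set_def by (intro sets.Int sets.Diff Sigma_sets) (auto intro: borel_closed)
  moreover have "(\<lambda>l. 2 powi j *\<^sub>R l :: (real, 'z) vec) \<in> borel_measurable borel"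
    by measurable
  ultimately have "(\<lambda>l. 2 powi j *\<^sub>R l) -` E_set G \<inter> space borel \<in> sets borel"
    by (rule measurable_sets[rotated])
  moreover have "E_scaled G j = (\<lambda>l. 2 powi j *\<^sub>R l) -` E_set G \<inter> space borel"
    by (auto simp: E_scaled_iff)
  ultimately show ?thesis
    by (simp only:)
qed

text \<open>E is the part of \<Sigma> where the maximum norm lies in (1/4, 1/2]. As the removed
  inner cube is closed, neighbouring shells do not share boundary points, and the tiling is exact
  rather than up to null sets.\<close>

lemma E_scaled_unique:
  assumes l: "l \<in> Sigma_set G"
  shows "\<exists>j. \<forall>i. l \<in> E_scaled G i \<longleftrightarrow> i = j"
proof -
  define m where "m = Max (range (\<lambda>i. \<bar>l $ i\<bar>))"
  have le_m: "m \<le> a \<longleftrightarrow> (\<forall>i. \<bar>l $ i\<bar> \<le> a)" for a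
    unfolding m_def by (subst Max_le_iff) auto
  have "l \<noteq> 0"
    using l zero_notin_Sigma by auto
  then obtain i where "l $ i \<noteq> 0"
    by (auto simp: vec_eq_iff)
  moreover have "\<bar>l $ i\<bar> \<le> m"
    using le_m[of m] by blast
  ultimately have m: "m > 0"
    by linarith
  have box: "2 powi j *\<^sub>R l \<in> cbox (\<chi> i. - a) (\<chi> i. a) \<longleftrightarrow> 2 powi j * m \<le> a" for j a
  proof -
    have "2 powi j *\<^sub>R l \<in> cbox (\<chi> i. - a) (\<chi> i. a) \<longleftrightarrow> (\<forall>i. \<bar>2 powi j * l $ i\<bar> \<le> a)"
      by (auto simp: mem_box_cart abs_le_iff minus_le_iff)
    also have "\<dots> \<longleftrightarrow> (\<forall>i. \<bar>l $ i\<bar> \<le> a / 2 powi j)"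
      by (simp add: abs_mult le_divide_eq mult.commute)
    also have "\<dots> \<longleftrightarrow> 2 powi j * m \<le> a"
      unfolding le_m[symmetric] by (simp add: le_divide_eq mult.commute)
    finally show ?thesis .
  qed
  \<comment> \<open>For the maximum norm m of l, 1/4 < 2^j * m \<le> 1/2 is the same as 2^j \<le>
    1/(2m) < 2^(j+1), which determines j as the floor of a logarithm.\<close>
  have "l \<in> E_scaled G j \<longleftrightarrow> j = \<lfloor>log 2 (1 / (2 * m))\<rfloor>" for j
  proof -
    have pw: "2 powi j = 2 powr real_of_int j" "2 powr real_of_int j * 2 = 2 powr (real_of_int j + 1)"
      by (simp_all add: powr_real_of_int' powr_add)
    have "l \<in> E_scaled G j \<longleftrightarrow> 2 powi j * m \<le> 1/2 \<and> \<not> 2 powi j * m \<le> 1/4"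
      using box[of j "1/2"] box[of j "1/4"] l by (simp add: E_scaled_iff E_set_def Sigma_scaleR)
    also have "\<dots> \<longleftrightarrow> 2 powr real_of_int j \<le> 1 / (2 * m) \<and> 1 / (2 * m) < 2 powr (real_of_int j + 1)"
      using m unfolding pw(1) pw(2)[symmetric] by (auto simp: field_simps)
    also have "\<dots> \<longleftrightarrow> real_of_int j \<le> log 2 (1 / (2 * m)) \<and> log 2 (1 / (2 * m)) < real_of_int j + 1"
      using m by (simp add: le_log_iff log_less_iff)
    also have "\<dots> \<longleftrightarrow> j = \<lfloor>log 2 (1 / (2 * m))\<rfloor>"
      by (metis floor_eq_iff)
    finally show ?thesis .
  qed
  then show ?thesis
    by blast
qed

section \<open>Integrable functions inside L2 of the group\<close>

lemma integrable_dilation: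
  assumes "integrable (haar G) f"
  shows "integrable (haar G) (dilation G j f)"
  using assms integrable_axis_dilation_iff[of "2 powi (- j)" "\<lambda>p. f (chart G p)"]
  by (simp add: integrable_haar_iff dilation_chart)

text \<open>The approximants are f cut off to growing balls in coordinates; they converge by
  domination with |f|^2.\<close>

lemma L1_dense:
  assumes f: "f \<in> L2 (haar G)"
  obtains h where "\<And>n. h n \<in> L2 (haar G)" "\<And>n. integrable (haar G) (h n)"
    "(\<lambda>n. l2_norm (haar G) (\<lambda>m. f m - h n m)) \<longlonglongrightarrow> 0"
proof -
  define F where "F p = f (chart G p)" for p
  have F: "F \<in> L2 lborel"
    using f unfolding F_def L2_haar_iff .
  have [measurable]: "F \<in> borel_measurable borel"
    using L2_measurable[OF F] by simp
  define B :: "nat \<Rightarrow> ((real, 'z) vec \<times> (real, 'd) vec \<times> (real, 'd) vec) set"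
    where "B n = cball 0 (real n)" for n
  have [measurable]: "B n \<in> sets borel" for n
    by (simp add: B_def)
  define h where "h n m = indicator (B n) (coords G m) * f m" for n m
  have hc: "h n (chart G p) = indicator (B n) p * F p" for n p
    by (simp add: h_def F_def)
  have "h n \<in> L2 (haar G)" for n
  proof -
    have "integrable lborel (\<lambda>p. (cmod (indicator (B n) p * F p))\<^sup>2)"
    proof (rule Bochner_Integration.integrable_bound[OF L2_integrable[OF F]])
      show "AE p in lborel. norm ((cmod (indicator (B n) p * F p))\<^sup>2) \<le> norm ((cmod (F p))\<^sup>2)"
        by (intro AE_I2) (auto simp: indicator_def)
    qed measurable
    then show ?thesis
      unfolding L2_haar_iff hc by (simp add: L2_def)
  qed
  moreover have "integrable (haar G) (h n)" for n
    unfolding integrable_haar_iff hc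
  proof (rule Bochner_Integration.integrable_bound)
    have "emeasure lborel (B n) < \<infinity>"
      unfolding B_def by (intro emeasure_bounded_finite) simp
    then show "integrable lborel (\<lambda>p. indicator (B n) p + (cmod (F p))\<^sup>2 :: real)"
      using L2_integrable[OF F] by (intro Bochner_Integration.integrable_add integrable_real_indicator) auto
    \<comment> \<open>On the ball this dominates the cut-off function by 1 + |F|^2, which is
      integrable there because the ball has finite measure.\<close>
    have "cmod z \<le> 1 + (cmod z)\<^sup>2" for z
      using sum_squares_bound[of "cmod z" 1] norm_ge_zero[of z] by (simp; linarith)
    then show "AE p in lborel. norm (indicator (B n) p * F p) \<le> norm (indicator (B n) p + (cmod (F p))\<^sup>2)"
      by (intro AE_I2) (auto simp: indicator_def)
  qed measurable
  moreover have "(\<lambda>n. l2_norm (haar G) (\<lambda>m. f m - h n m)) \<longlonglongrightarrow> 0"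
  proof -
    have "(\<lambda>n. LINT p|lborel. (cmod (F p - indicator (B n) p * F p))\<^sup>2) \<longlonglongrightarrow> (LINT p|(lborel :: ((real, 'z) vec \<times> (real, 'd) vec \<times> (real, 'd) vec) measure). 0)"
    proof (rule integral_dominated_convergence[OF _ _ L2_integrable[OF F]])
      show "AE p in lborel. (\<lambda>n. (cmod (F p - indicator (B n) p * F p))\<^sup>2) \<longlonglongrightarrow> 0"
      proof (rule AE_I2)
        fix p :: "(real, 'z) vec \<times> (real, 'd) vec \<times> (real, 'd) vec"
        obtain N :: nat where N: "norm p \<le> real N"
          using real_arch_simple by blast
        have "\<forall>\<^sub>F n in sequentially. (cmod (F p - indicator (B n) p * F p))\<^sup>2 = 0"
          using eventually_ge_at_top[of N]
        proof eventually_elim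
          case (elim n)
          then have "norm p \<le> real n"
            using N by simp
          then show ?case
            by (simp add: B_def)
        qed
        then show "(\<lambda>n. (cmod (F p - indicator (B n) p * F p))\<^sup>2) \<longlonglongrightarrow> 0"
          by (rule tendsto_eventually)
      qed
      show "AE p in lborel. norm ((cmod (F p - indicator (B n) p * F p))\<^sup>2) \<le> (cmod (F p))\<^sup>2" for n
        by (intro AE_I2) (auto simp: indicator_def)
    qed measurable
    then have "(\<lambda>n. sqrt (LINT p|lborel. (cmod (F p - indicator (B n) p * F p))\<^sup>2)) \<longlonglongrightarrow> sqrt 0"
      by (intro tendsto_real_sqrt) simp
    then show ?thesis
      unfolding l2_norm_haar hc F_def[symmetric] by (simp add: l2_norm_def)
  qed
  ultimately show ?thesis
    by (rule that)
qed

end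

section \<open>Dilations in terms of matrix coefficients\<close>

context plancherel_setting
begin

text \<open>Both sides are continuous in \<open>f\<close>, so it suffices to treat integrable \<open>f\<close>, where the weak
  integral defining the Fourier transform can be used.\<close>

lemma coef_dilation:
  assumes f: "f \<in> L2 (haar G)" and k: "k \<in> I" and i: "i \<in> I"
  shows "AE l in \<mu>. coef (dilation G j f) k i l = of_real (dilation_const j) * coef f k i (2 powi j *\<^sub>R l)"
proof -
  let ?b = "2 powi j :: real" and ?\<delta> = "complex_of_real (dilation_const j)"
  have b: "?b > 0"
    by simp
  \<comment> \<open>The defect of the claimed identity. It is additive in its argument, vanishes for
    integrable arguments and is bounded in terms of the norm, so it vanishes for f.\<close>
  define D where "D g l = coef (dilation G j g) k i l - ?\<delta> * coef g k i (?b *\<^sub>R l)" for g l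
  have m1: "coef (dilation G j g) k i \<in> borel_measurable \<mu>" if "g \<in> L2 (haar G)" for g
    using that k i by (intro coef_measurable L2_dilation)
  have m2: "(\<lambda>l. coef g k i (?b *\<^sub>R l)) \<in> borel_measurable \<mu>" if "g \<in> L2 (haar G)" for g
    using that k i by (intro measurable_compose[OF scaleR_measurable_plancherel coef_measurable]) simp
  have D_lin: "AE l in \<mu>. D (\<lambda>m. f m - h m) l = D f l - D h l" if h: "h \<in> L2 (haar G)" for h
  proof -
    have "dilation G j (\<lambda>m. f m - h m) = (\<lambda>m. 1 * dilation G j f m + (-1) * dilation G j h m)"
      by (simp add: dilation_def algebra_simps)
    then have "AE l in \<mu>. \<forall>k\<in>I. \<forall>i\<in>I. coef (dilation G j (\<lambda>m. f m - h m)) k i l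
        = 1 * coef (dilation G j f) k i l + (-1) * coef (dilation G j h) k i l"
      using coef_linear[OF L2_dilation[OF f, of j] L2_dilation[OF h, of j], of 1 "-1"] by simp
    moreover have "AE l in \<mu>. \<forall>k\<in>I. \<forall>i\<in>I. coef (\<lambda>m. 1 * f m + (-1) * h m) k i (?b *\<^sub>R l)
        = 1 * coef f k i (?b *\<^sub>R l) + (-1) * coef h k i (?b *\<^sub>R l)"
      by (rule AE_plancherel_scaleR[OF b coef_linear[OF f h]])
    ultimately show ?thesis
    proof eventually_elim
      case (elim l)
      then have 1: "coef (dilation G j (\<lambda>m. f m - h m)) k i l
          = coef (dilation G j f) k i l - coef (dilation G j h) k i l"
        and 2: "coef (\<lambda>m. f m - h m) k i (?b *\<^sub>R l) = coef f k i (?b *\<^sub>R l) - coef h k i (?b *\<^sub>R l)"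
        using k i by simp_all
      then show ?case
        unfolding D_def 1 2 by (simp add: algebra_simps)
    qed
  qed
  have D_0: "AE l in \<mu>. D h l = 0" if h: "h \<in> L2 (haar G)" "integrable (haar G) h" for h
    using P_fourier[OF L2_dilation[OF h(1)] integrable_dilation[OF h(2)], of j]
      AE_plancherel_scaleR[OF b P_fourier[OF h]]
  proof eventually_elim
    case (elim l)
    then show ?case
      using is_fourier_dilation[OF elim e_L2[OF k] e_L2[OF i]] by (simp add: D_def coef_def)
  qed
  \<comment> \<open>The constant 4 comes from (x + y)^2 \<le> 2 x^2 + 2 y^2, where each of the two
    squares integrates to at most the squared norm of g. For the second one the squared
    \<open>dilation_const j\<close> is exactly the scaling factor of \<mu>.\<close>
  have D_le: "(\<integral>\<^sup>+l. ennreal ((cmod (D g l))\<^sup>2) \<partial>\<mu>) \<le> ennreal (4 * (l2_norm (haar G) g)\<^sup>2)"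
    if g: "g \<in> L2 (haar G)" for g
  proof -
    note [measurable] = m1[OF g] m2[OF g] coef_measurable[OF g k i]
    have "(cmod (D g l))\<^sup>2 \<le> 2 * (cmod (coef (dilation G j g) k i l))\<^sup>2
        + 2 * (dilation_const j)\<^sup>2 * (cmod (coef g k i (?b *\<^sub>R l)))\<^sup>2" for l
    proof -
      let ?x = "cmod (coef (dilation G j g) k i l)" and ?y = "cmod (?\<delta> * coef g k i (?b *\<^sub>R l))"
      have "(cmod (D g l))\<^sup>2 \<le> (?x + ?y)\<^sup>2"
        unfolding D_def by (intro power_mono norm_triangle_ineq4) simp
      also have "\<dots> \<le> 2 * ?x\<^sup>2 + 2 * ?y\<^sup>2"
        using sum_squares_bound[of ?x ?y] by (simp add: power2_sum)
      finally show ?thesis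
        by (simp add: norm_mult power_mult_distrib)
    qed
    from ennreal_leI[OF this] have "ennreal ((cmod (D g l))\<^sup>2) \<le> 2 * ennreal ((cmod (coef (dilation G j g) k i l))\<^sup>2)
        + 2 * (ennreal ((dilation_const j)\<^sup>2) * ennreal ((cmod (coef g k i (?b *\<^sub>R l)))\<^sup>2))" for l
      by (simp add: ennreal_mult mult.assoc)
    then have "(\<integral>\<^sup>+l. ennreal ((cmod (D g l))\<^sup>2) \<partial>\<mu>)
        \<le> (\<integral>\<^sup>+l. 2 * ennreal ((cmod (coef (dilation G j g) k i l))\<^sup>2)
          + 2 * (ennreal ((dilation_const j)\<^sup>2) * ennreal ((cmod (coef g k i (?b *\<^sub>R l)))\<^sup>2)) \<partial>\<mu>)"
      by (rule nn_integral_mono)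
    also have "\<dots> = 2 * (\<integral>\<^sup>+l. ennreal ((cmod (coef (dilation G j g) k i l))\<^sup>2) \<partial>\<mu>)
        + 2 * (ennreal ((dilation_const j)\<^sup>2) * (\<integral>\<^sup>+l. ennreal ((cmod (coef g k i (?b *\<^sub>R l)))\<^sup>2) \<partial>\<mu>))"
      by (simp add: nn_integral_add nn_integral_cmult)
    also have "ennreal ((dilation_const j)\<^sup>2) * (\<integral>\<^sup>+l. ennreal ((cmod (coef g k i (?b *\<^sub>R l)))\<^sup>2) \<partial>\<mu>)
        = (\<integral>\<^sup>+l. ennreal ((cmod (coef g k i l))\<^sup>2) \<partial>\<mu>)"
      unfolding power2_eq_square[of "dilation_const j"] dilation_const_square
      by (rule nn_integral_plancherel_scaleR[OF b, symmetric]) measurable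
    also have "2 * (\<integral>\<^sup>+l. ennreal ((cmod (coef (dilation G j g) k i l))\<^sup>2) \<partial>\<mu>)
        + 2 * (\<integral>\<^sup>+l. ennreal ((cmod (coef g k i l))\<^sup>2) \<partial>\<mu>)
        \<le> 2 * ennreal ((l2_norm (haar G) (dilation G j g))\<^sup>2) + 2 * ennreal ((l2_norm (haar G) g)\<^sup>2)"
      by (intro add_mono mult_left_mono coef_norm_le L2_dilation g k i) auto
    also have "\<dots> = ennreal (4 * (l2_norm (haar G) g)\<^sup>2)"
      by (simp add: l2_norm_dilation ennreal_mult mult_2[symmetric] mult.assoc[symmetric])
    finally show ?thesis .
  qed
  obtain h where h: "\<And>n. h n \<in> L2 (haar G)" "\<And>n. integrable (haar G) (h n)"
    "(\<lambda>n. l2_norm (haar G) (\<lambda>m. f m - h n m)) \<longlonglongrightarrow> 0"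
    using L1_dense[OF f] by blast
  have "(\<integral>\<^sup>+l. ennreal ((cmod (D f l))\<^sup>2) \<partial>\<mu>) \<le> ennreal (4 * (l2_norm (haar G) (\<lambda>m. f m - h n m))\<^sup>2)" for n
  proof -
    have "(\<integral>\<^sup>+l. ennreal ((cmod (D f l))\<^sup>2) \<partial>\<mu>) = (\<integral>\<^sup>+l. ennreal ((cmod (D (\<lambda>m. f m - h n m) l))\<^sup>2) \<partial>\<mu>)"
      using D_lin[OF h(1)[of n]] D_0[OF h(1,2)[of n]]
      by (intro nn_integral_cong_AE, eventually_elim) simp
    also have "\<dots> \<le> ennreal (4 * (l2_norm (haar G) (\<lambda>m. f m - h n m))\<^sup>2)"
      by (intro D_le L2_diff f h)
    finally show ?thesis .
  qed
  moreover have "(\<lambda>n. ennreal (4 * (l2_norm (haar G) (\<lambda>m. f m - h n m))\<^sup>2)) \<longlonglongrightarrow> ennreal (4 * 0\<^sup>2)"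
    by (intro tendsto_ennrealI tendsto_intros h)
  ultimately have "(\<integral>\<^sup>+l. ennreal ((cmod (D f l))\<^sup>2) \<partial>\<mu>) \<le> ennreal (4 * 0\<^sup>2)"
    by (intro LIMSEQ_le_const) auto
  then have 0: "(\<integral>\<^sup>+l. ennreal ((cmod (D f l))\<^sup>2) \<partial>\<mu>) = 0"
    by simp
  note [measurable] = m1[OF f] m2[OF f]
  have "(\<lambda>l. ennreal ((cmod (D f l))\<^sup>2)) \<in> borel_measurable \<mu>"
    unfolding D_def by measurable
  from nn_integral_0_iff_AE[OF this] 0 have "AE l in \<mu>. D f l = 0"
    by simp
  then show ?thesis
    by (simp add: D_def)
qed

text \<open>Rescaling l leaves the column alone and shifts the tile: \<open>2 powi n\<close> times l
  lies in tile j iff l lies in tile j + n.\<close>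

lemma dilation_H_space:
  assumes k: "k \<in> I" and f: "f \<in> H_space G P j (e k)"
  shows "dilation G n f \<in> H_space G P (j + n) (e k)"
proof -
  have fL2: "f \<in> L2 (haar G)"
    and 0: "AE l in \<mu>. \<forall>k'\<in>I. \<forall>i\<in>I. k' \<noteq> k \<or> l \<notin> E_scaled G j \<longrightarrow> coef f k' i l = 0"
    using f unfolding H_space_iff[OF k] by auto
  have "AE l in \<mu>. \<forall>k'\<in>I. \<forall>i\<in>I. coef (dilation G n f) k' i l
      = of_real (dilation_const n) * coef f k' i (2 powi n *\<^sub>R l)"
    \<comment> \<open>\<open>coef_dilation\<close> has a null set for each pair of indices;
      countability of \<open>I\<close> merges them.\<close>
    by (intro AE_ball_countable' countable_I coef_dilation fL2)
  moreover have "AE l in \<mu>. \<forall>k'\<in>I. \<forall>i\<in>I. k' \<noteq> k \<or> 2 powi n *\<^sub>R l \<notin> E_scaled G j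
      \<longrightarrow> coef f k' i (2 powi n *\<^sub>R l) = 0"
    by (rule AE_plancherel_scaleR[OF _ 0]) simp
  ultimately have "AE l in \<mu>. \<forall>k'\<in>I. \<forall>i\<in>I. k' \<noteq> k \<or> l \<notin> E_scaled G (j + n)
      \<longrightarrow> coef (dilation G n f) k' i l = 0"
    by eventually_elim (simp add: E_scaled_scaleR)
  then show ?thesis
    using L2_dilation[OF fL2] unfolding H_space_iff[OF k] by blast
qed

text \<open>An inclusion of spaces suffices, because it holds for - j as well: the inverse dilation
  returns f to level 0, where the given frame applies, and unitarity moves it across the inner
  product.\<close>

lemma parseval_frame_dilation:
  assumes k: "k \<in> I" and frame: "parseval_frame (haar G) (H_space G P 0 (e k)) \<Gamma> F"
  shows "parseval_frame (haar G) (H_space G P j (e k)) \<Gamma> (\<lambda>\<gamma>. dilation G j (F \<gamma>))"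
  unfolding parseval_frame_def
proof (intro conjI ballI)
  show "countable \<Gamma>"
    using frame by (simp add: parseval_frame_def)
  show "dilation G j (F \<gamma>) \<in> H_space G P j (e k)" if "\<gamma> \<in> \<Gamma>" for \<gamma>
    using frame that dilation_H_space[OF k, of "F \<gamma>" 0 j] by (simp add: parseval_frame_def)
  fix f assume "f \<in> H_space G P j (e k)"
  then have "dilation G (- j) f \<in> H_space G P 0 (e k)"
    using dilation_H_space[OF k, of f j "- j"] by simp
  then have "((\<lambda>\<gamma>. (cmod (l2_inner (haar G) (dilation G (- j) f) (F \<gamma>)))\<^sup>2)
      has_sum (l2_norm (haar G) (dilation G (- j) f))\<^sup>2) \<Gamma>"
    using frame unfolding parseval_frame_def by simp
  then show "((\<lambda>\<gamma>. (cmod (l2_inner (haar G) f (dilation G j (F \<gamma>))))\<^sup>2)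
      has_sum (l2_norm (haar G) f)\<^sup>2) \<Gamma>"
    by (simp add: l2_norm_dilation l2_inner_dilation_right)
qed

lemma H_space_orthogonal:
  assumes "S \<subseteq> I"
  shows "orthogonal_family (haar G) (S \<times> UNIV) (\<lambda>(k, j). H_space G P j (e k))"
  unfolding orthogonal_family_def
proof (clarify, goal_cases)
  case (1 k j k' j' f g)
  have k: "k \<in> I" "k' \<in> I"
    using 1 assms by auto
  have f: "f \<in> L2 (haar G)"
    "AE l in \<mu>. \<forall>k1\<in>I. \<forall>i\<in>I. k1 \<noteq> k \<or> l \<notin> E_scaled G j \<longrightarrow> coef f k1 i l = 0"
    using 1 unfolding H_space_iff[OF k(1)] by auto
  have g: "g \<in> L2 (haar G)"
    "AE l in \<mu>. \<forall>k1\<in>I. \<forall>i\<in>I. k1 \<noteq> k' \<or> l \<notin> E_scaled G j' \<longrightarrow> coef g k1 i l = 0"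
    using 1 unfolding H_space_iff[OF k(2)] by auto
  show ?case
  proof (rule coef_orthogonal[OF f(1) g(1)])
    show "AE l in \<mu>. \<forall>k\<in>I. \<forall>i\<in>I. coef f k i l = 0 \<or> coef g k i l = 0"
      using f(2) g(2) AE_Sigma
    proof eventually_elim
      case (elim l)
      obtain j0 where "\<And>i. l \<in> E_scaled G i \<longleftrightarrow> i = j0"
        using E_scaled_unique[OF elim(3)] by blast
      \<comment> \<open>Otherwise k and k' would both be k1 and j and j' would both be j0, although
        the pairs (k, j) and (k', j') differ.\<close>
      then have "k1 \<noteq> k \<or> l \<notin> E_scaled G j \<or> k1 \<noteq> k' \<or> l \<notin> E_scaled G j'" for k1
        using 1 by auto
      then show ?case
        using elim(1,2) by blast
    qed
  qed
qed

text \<open>The components g (k, j) are the cut-offs of f to column k over tile j. Convergence of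
  their sum to f follows from numbers alone: the squared remainder after finitely many components is
  the norm square of f minus theirs, and all of theirs add up to that of f.\<close>

lemma L2_orthogonal_components:
  assumes f: "f \<in> L2 (haar G)"
  shows "f \<in> hilbert_sum (haar G) (I \<times> UNIV) (\<lambda>(k, j). H_space G P j (e k))"
proof -
  let ?H = "\<lambda>(k, j). H_space G P j (e k)"
  have "\<forall>p\<in>I \<times> (UNIV :: int set). \<exists>g. g \<in> L2 (haar G) \<and> (AE l in \<mu>. \<forall>k'\<in>I. \<forall>i\<in>I.
      coef g k' i l = (if k' = fst p \<and> l \<in> E_scaled G (snd p) then coef f (fst p) i l else 0))"
  proof
    fix p :: "'i \<times> int" assume "p \<in> I \<times> UNIV"
    then have "fst p \<in> I"
      by auto
    show "\<exists>g. g \<in> L2 (haar G) \<and> (AE l in \<mu>. \<forall>k'\<in>I. \<forall>i\<in>I.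
      coef g k' i l = (if k' = fst p \<and> l \<in> E_scaled G (snd p) then coef f (fst p) i l else 0))"
      by (rule coef_cutoff[OF f \<open>fst p \<in> I\<close> E_scaled_sets[of "snd p"]]) (intro exI conjI)
  qed
  from bchoice[OF this] obtain g where *: "\<forall>p\<in>I \<times> UNIV. g p \<in> L2 (haar G) \<and> (AE l in \<mu>. \<forall>k'\<in>I. \<forall>i\<in>I.
      coef (g p) k' i l = (if k' = fst p \<and> l \<in> E_scaled G (snd p) then coef f (fst p) i l else 0))"
    by (elim exE)
  have g: "g p \<in> L2 (haar G)" if "p \<in> I \<times> UNIV" for p
    using bspec[OF * that] by (rule conjunct1)
  have gc: "AE l in \<mu>. \<forall>k'\<in>I. \<forall>i\<in>I.
      coef (g p) k' i l = (if k' = fst p \<and> l \<in> E_scaled G (snd p) then coef f (fst p) i l else 0)"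
    if "p \<in> I \<times> UNIV" for p
    using bspec[OF * that] by (rule conjunct2)
  have gH: "g p \<in> ?H p" if p: "p \<in> I \<times> UNIV" for p
  proof -
    obtain k j where kj: "p = (k, j)" "k \<in> I"
      using p by auto
    from gc[OF p] have "AE l in \<mu>. \<forall>k'\<in>I. \<forall>i\<in>I. k' \<noteq> k \<or> l \<notin> E_scaled G j \<longrightarrow> coef (g p) k' i l = 0"
      by eventually_elim (auto simp: kj)
    then show ?thesis
      using g[OF p] H_space_iff[OF kj(2)] by (simp add: kj)
  qed
  have orth: "l2_inner (haar G) (g p) (g q) = 0" if "p \<in> I \<times> UNIV" "q \<in> I \<times> UNIV" "p \<noteq> q" for p q
    using H_space_orthogonal[OF order_refl, unfolded orthogonal_family_def, rule_format,
        OF that gH[OF that(1)] gH[OF that(2)]] .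
  \<comment> \<open>Wherever an entry of g p is nonzero it agrees with that of f, so f - g p has
    disjoint coefficients and is orthogonal to g p.\<close>
  have fg: "l2_inner (haar G) f (g p) = of_real ((l2_norm (haar G) (g p))\<^sup>2)" if p: "p \<in> I \<times> UNIV" for p
  proof -
    have "l2_inner (haar G) (\<lambda>m. 1 * f m + (-1) * g p m) (g p) = 0"
    proof (rule coef_orthogonal)
      show "AE l in \<mu>. \<forall>k\<in>I. \<forall>i\<in>I. coef (\<lambda>m. 1 * f m + (-1) * g p m) k i l = 0 \<or> coef (g p) k i l = 0"
        using coef_linear[OF f g[OF p], of 1 "-1"] gc[OF p]
        by eventually_elim simp
    qed (intro L2_add L2_cmult f g p)+
    then show ?thesis
      using l2_inner_diff_left[OF f g[OF p] g[OF p]] by (simp add: l2_inner_self)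
  qed
  have norm_g: "ennreal ((l2_norm (haar G) (g (k, j)))\<^sup>2)
      = (\<integral>\<^sup>+l. (if l \<in> E_scaled G j then energy f k l else 0) \<partial>\<mu>)" if k: "k \<in> I" for k j
  proof -
    have p: "(k, j) \<in> I \<times> UNIV"
      using k by simp
    have "AE l in \<mu>. (\<Sum>\<^sub>\<infinity>k'\<in>I. energy (g (k, j)) k' l) = (if l \<in> E_scaled G j then energy f k l else 0)"
      using gc[OF p]
    proof eventually_elim
      case (elim l)
      have *: "energy (g (k, j)) k' l = (if k' = k \<and> l \<in> E_scaled G j then energy f k l else 0)"
        if "k' \<in> I" for k'
      proof -
        have "energy (g (k, j)) k' l = (\<Sum>\<^sub>\<infinity>i\<in>I. ennreal ((cmod
            (if k' = k \<and> l \<in> E_scaled G j then coef f k i l else 0))\<^sup>2))"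
          unfolding energy_def using elim that by (intro infsum_cong) simp
        then show ?thesis
          by (auto simp: energy_def)
      qed
      have "(\<Sum>\<^sub>\<infinity>k'\<in>I. energy (g (k, j)) k' l) = energy (g (k, j)) k l"
        using * by (intro infsum_ennreal_single k) simp
      then show ?case
        using * k by simp
    qed
    then show ?thesis
      unfolding norm_energy[OF g[OF p]] by (rule nn_integral_cong_AE)
  qed
  have "(\<Sum>\<^sub>\<infinity>p\<in>I \<times> UNIV. ennreal ((l2_norm (haar G) (g p))\<^sup>2))
      = (\<Sum>\<^sub>\<infinity>p\<in>I \<times> UNIV. \<integral>\<^sup>+l. (if l \<in> E_scaled G (snd p) then energy f (fst p) l else 0) \<partial>\<mu>)"
    using norm_g by (intro infsum_cong) (auto cong: if_cong)
  also have "\<dots> = (\<integral>\<^sup>+l. (\<Sum>\<^sub>\<infinity>p\<in>I \<times> UNIV. if l \<in> E_scaled G (snd p) then energy f (fst p) l else 0) \<partial>\<mu>)"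
  proof (rule nn_integral_infsum[symmetric])
    show "countable (I \<times> (UNIV :: int set))"
      using countable_I by simp
    fix p :: "'i \<times> int" assume "p \<in> I \<times> UNIV"
    then have [measurable]: "energy f (fst p) \<in> borel_measurable \<mu>"
      using f by (intro energy_measurable) auto
    have "E_scaled G (snd p) \<inter> space \<mu> \<in> sets \<mu>"
      using E_scaled_sets by (auto simp: sets_plancherel sets_restrict_space)
    then have [measurable]: "Measurable.pred \<mu> (\<lambda>l. l \<in> E_scaled G (snd p))"
      by (simp add: pred_def Int_def conj_commute)
    show "(\<lambda>l. if l \<in> E_scaled G (snd p) then energy f (fst p) l else 0) \<in> borel_measurable \<mu>"
      by measurable
  qed
  also have "\<dots> = (\<integral>\<^sup>+l. (\<Sum>\<^sub>\<infinity>k\<in>I. energy f k l) \<partial>\<mu>)"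
  proof (rule nn_integral_cong)
    fix l assume "l \<in> space \<mu>"
    then obtain j where j: "\<And>i. l \<in> E_scaled G i \<longleftrightarrow> i = j"
      using E_scaled_unique by auto
    \<comment> \<open>Only one tile contains l, so the double sum keeps a single level j and becomes
      the total energy at l.\<close>
    have "(\<Sum>\<^sub>\<infinity>p\<in>I \<times> UNIV. if l \<in> E_scaled G (snd p) then energy f (fst p) l else 0)
        = (\<Sum>\<^sub>\<infinity>p\<in>(\<lambda>k. (k, j)) ` I. energy f (fst p) l)"
      by (rule infsum_cong_neutral) (auto simp: j)
    also have "\<dots> = (\<Sum>\<^sub>\<infinity>k\<in>I. energy f k l)"
      by (subst infsum_reindex) (auto simp: inj_on_def o_def)
    finally show "(\<Sum>\<^sub>\<infinity>p\<in>I \<times> UNIV. if l \<in> E_scaled G (snd p) then energy f (fst p) l else 0)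
        = (\<Sum>\<^sub>\<infinity>k\<in>I. energy f k l)" .
  qed
  also have "\<dots> = ennreal ((l2_norm (haar G) f)\<^sup>2)"
    by (rule norm_energy[OF f, symmetric])
  finally have "((\<lambda>p. (l2_norm (haar G) (g p))\<^sup>2) has_sum (l2_norm (haar G) f)\<^sup>2) (I \<times> UNIV)"
    by (intro has_sum_of_infsum_ennreal) simp_all
  then have "((\<lambda>F. sqrt ((l2_norm (haar G) f)\<^sup>2 - (\<Sum>p\<in>F. (l2_norm (haar G) (g p))\<^sup>2)))
      \<longlongrightarrow> sqrt ((l2_norm (haar G) f)\<^sup>2 - (l2_norm (haar G) f)\<^sup>2)) (finite_subsets_at_top (I \<times> UNIV))"
    unfolding has_sum_def by (intro tendsto_intros)
  moreover have "\<forall>\<^sub>F F in finite_subsets_at_top (I \<times> UNIV).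
      sqrt ((l2_norm (haar G) f)\<^sup>2 - (\<Sum>p\<in>F. (l2_norm (haar G) (g p))\<^sup>2))
      = l2_norm (haar G) (\<lambda>x. f x - (\<Sum>p\<in>F. g p x))"
  proof (rule eventually_finite_subsets_at_top_weakI)
    fix F assume F: "finite F" "F \<subseteq> I \<times> (UNIV :: int set)"
    have "(l2_norm (haar G) (\<lambda>x. f x - (\<Sum>p\<in>F. g p x)))\<^sup>2
        = (l2_norm (haar G) f)\<^sup>2 - (\<Sum>p\<in>F. (l2_norm (haar G) (g p))\<^sup>2)"
      using F(2) by (intro l2_norm_diff_sum_square F(1) f) (blast intro: g orth fg)+
    then show "sqrt ((l2_norm (haar G) f)\<^sup>2 - (\<Sum>p\<in>F. (l2_norm (haar G) (g p))\<^sup>2))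
      = l2_norm (haar G) (\<lambda>x. f x - (\<Sum>p\<in>F. g p x))"
      by (intro real_sqrt_unique) simp_all
  qed
  ultimately have "((\<lambda>F. l2_norm (haar G) (\<lambda>x. f x - (\<Sum>p\<in>F. g p x)))
      \<longlongrightarrow> sqrt ((l2_norm (haar G) f)\<^sup>2 - (l2_norm (haar G) f)\<^sup>2)) (finite_subsets_at_top (I \<times> UNIV))"
    by (rule Lim_transform_eventually)
  then have "((\<lambda>F. l2_norm (haar G) (\<lambda>x. f x - (\<Sum>p\<in>F. g p x))) \<longlongrightarrow> 0)
      (finite_subsets_at_top (I \<times> UNIV))"
    by simp
  then show ?thesis
    unfolding hilbert_sum_def using f gH by (intro CollectI conjI exI[of _ g]) simp_all
qed

end

section \<open>Parseval frames of Hilbert sums\<close>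

lemma parseval_frame_reindex:
  assumes "parseval_frame M H J F" "bij_betw b J' J"
  shows "parseval_frame M H J' (\<lambda>i. F (b i))"
proof -
  have "countable J'"
    using assms unfolding parseval_frame_def
    by (metis bij_betw_def countable_image_inj_on)
  moreover have "F (b i) \<in> H" if "i \<in> J'" for i
    using assms that unfolding parseval_frame_def by (simp add: bij_betwE)
  moreover have "((\<lambda>i. (cmod (l2_inner M f (F (b i))))\<^sup>2) has_sum (l2_norm M f)\<^sup>2) J'" if "f \<in> H" for f
    using assms that unfolding parseval_frame_def
    by (subst has_sum_reindex_bij_betw[OF assms(2)]) simp
  ultimately show ?thesis
    by (simp add: parseval_frame_def)
qed

text \<open>Inner products with an element of H i see only the i-th term of every large partial sum,
  so h i is the projection of f. In particular \<langle>f, h i\<rangle> is the squared norm of h i,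
  and Pythagoras gives the norm of f.\<close>

lemma
  assumes orth: "orthogonal_family M J H" and L2: "\<And>i. i \<in> J \<Longrightarrow> H i \<subseteq> L2 M"
    and f: "f \<in> L2 M" and h: "\<And>i. i \<in> J \<Longrightarrow> h i \<in> H i"
    and lim: "((\<lambda>F. l2_norm M (\<lambda>x. f x - (\<Sum>i\<in>F. h i x))) \<longlongrightarrow> 0) (finite_subsets_at_top J)"
  shows hilbert_sum_inner: "i \<in> J \<Longrightarrow> g \<in> H i \<Longrightarrow> l2_inner M f g = l2_inner M (h i) g"
    and hilbert_sum_norm: "((\<lambda>i. (l2_norm M (h i))\<^sup>2) has_sum (l2_norm M f)\<^sup>2) J"
proof -
  \<comment> \<open>Intersecting with J makes the partial sum square integrable for every F, as the
    continuity of the inner product requires; along the filter F lies in J anyway.\<close>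
  define u where "u F x = (\<Sum>i\<in>F \<inter> J. h i x)" for F x
  have hL2: "h i \<in> L2 M" if "i \<in> J" for i
    using L2 h that by blast
  have u: "u F \<in> L2 M" for F
    unfolding u_def by (intro L2_sum hL2) auto
  have u_eq: "(\<Sum>i\<in>F. h i x) = u F x" if "F \<subseteq> J" for F x
    using that by (simp add: u_def Int_absorb2)
  have "((\<lambda>F. l2_norm M (\<lambda>x. f x - u F x)) \<longlongrightarrow> 0) (finite_subsets_at_top J)"
    by (rule Lim_transform_eventually[OF lim])
       (intro eventually_finite_subsets_at_top_weakI, simp add: u_eq)
  note inner_lim = tendsto_l2_inner_left[OF u f _ this]
  show inner: "l2_inner M f g = l2_inner M (h i) g" if i: "i \<in> J" and g: "g \<in> H i" for i g
  proof (rule tendsto_unique)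
    have gL2: "g \<in> L2 M"
      using L2 i g by blast
    show "((\<lambda>F. l2_inner M (u F) g) \<longlongrightarrow> l2_inner M f g) (finite_subsets_at_top J)"
      by (rule inner_lim[OF gL2])
    have "l2_inner M (u F) g = l2_inner M (h i) g" if F: "finite F" "{i} \<subseteq> F" "F \<subseteq> J" for F
    proof -
      have "l2_inner M (u F) g = (\<Sum>i'\<in>F. l2_inner M (h i') g)"
        unfolding u_def using F(3) by (subst l2_inner_sum_left) (auto simp: hL2 gL2 Int_absorb2)
      also have "\<dots> = (\<Sum>i'\<in>{i}. l2_inner M (h i') g)"
      proof (rule sum.mono_neutral_right[OF F(1,2)], rule ballI)
        fix i' assume i': "i' \<in> F - {i}"
        then have "i' \<in> J" "i' \<noteq> i"
          using F(3) by auto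
        then show "l2_inner M (h i') g = 0"
          using orth h i g unfolding orthogonal_family_def by simp
      qed
      finally show ?thesis
        by simp
    qed
    then have "\<forall>\<^sub>F F in finite_subsets_at_top J. l2_inner M (h i) g = l2_inner M (u F) g"
      unfolding eventually_finite_subsets_at_top using i by (intro exI[of _ "{i}"]) simp
    then show "((\<lambda>F. l2_inner M (u F) g) \<longlongrightarrow> l2_inner M (h i) g) (finite_subsets_at_top J)"
      by (rule Lim_transform_eventually[OF tendsto_const])
  qed (simp add: finite_subsets_at_top_neq_bot)
  have "((\<lambda>F. (l2_norm M f)\<^sup>2 - (l2_norm M (\<lambda>x. f x - (\<Sum>i\<in>F. h i x)))\<^sup>2)
      \<longlongrightarrow> (l2_norm M f)\<^sup>2 - 0\<^sup>2) (finite_subsets_at_top J)"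
    by (intro tendsto_intros lim)
  moreover have "\<forall>\<^sub>F F in finite_subsets_at_top J.
      (l2_norm M f)\<^sup>2 - (l2_norm M (\<lambda>x. f x - (\<Sum>i\<in>F. h i x)))\<^sup>2 = (\<Sum>i\<in>F. (l2_norm M (h i))\<^sup>2)"
  proof (rule eventually_finite_subsets_at_top_weakI)
    fix F assume F: "finite F" "F \<subseteq> J"
    have "(l2_norm M (\<lambda>x. f x - (\<Sum>i\<in>F. h i x)))\<^sup>2 = (l2_norm M f)\<^sup>2 - (\<Sum>i\<in>F. (l2_norm M (h i))\<^sup>2)"
    proof (rule l2_norm_diff_sum_square[OF F(1) f])
      fix i assume "i \<in> F"
      then have i: "i \<in> J"
        using F(2) by auto
      show "h i \<in> L2 M"
        by (rule hL2[OF i])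
      show "l2_inner M f (h i) = of_real ((l2_norm M (h i))\<^sup>2)"
        unfolding inner[OF i h[OF i]] by (rule l2_inner_self)
      fix j assume "j \<in> F" "i \<noteq> j"
      moreover from this have "j \<in> J"
        using F(2) by auto
      ultimately show "l2_inner M (h i) (h j) = 0"
        using orth h i unfolding orthogonal_family_def by simp
    qed
    then show "(l2_norm M f)\<^sup>2 - (l2_norm M (\<lambda>x. f x - (\<Sum>i\<in>F. h i x)))\<^sup>2
        = (\<Sum>i\<in>F. (l2_norm M (h i))\<^sup>2)"
      by simp
  qed
  ultimately have "((\<lambda>F. \<Sum>i\<in>F. (l2_norm M (h i))\<^sup>2) \<longlongrightarrow> (l2_norm M f)\<^sup>2 - 0\<^sup>2) (finite_subsets_at_top J)"
    by (rule Lim_transform_eventually)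
  then show "((\<lambda>i. (l2_norm M (h i))\<^sup>2) has_sum (l2_norm M f)\<^sup>2) J"
    by (simp add: has_sum_def)
qed

lemma hilbert_sum_component:
  assumes "i \<in> J" "g \<in> H i" "g \<in> L2 M" "\<And>j. j \<in> J \<Longrightarrow> (\<lambda>x. 0) \<in> H j"
  shows "g \<in> hilbert_sum M J H"
proof -
  define h where "h j = (if j = i then g else (\<lambda>x. 0))" for j
  have "\<forall>\<^sub>F F in finite_subsets_at_top J. 0 = l2_norm M (\<lambda>x. g x - (\<Sum>j\<in>F. h j x))"
    unfolding eventually_finite_subsets_at_top
  proof (intro exI[of _ "{i}"] conjI allI impI)
    fix F assume F: "finite F \<and> {i} \<subseteq> F \<and> F \<subseteq> J"
    have "(\<Sum>j\<in>F. h j x) = (\<Sum>j\<in>F. if j = i then g x else 0)" for x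
      by (intro sum.cong) (auto simp: h_def)
    then have "(\<Sum>j\<in>F. h j x) = g x" for x
      using F by simp
    then show "0 = l2_norm M (\<lambda>x. g x - (\<Sum>j\<in>F. h j x))"
      by simp
  qed (use assms in auto)
  then have "((\<lambda>F. l2_norm M (\<lambda>x. g x - (\<Sum>j\<in>F. h j x))) \<longlongrightarrow> 0) (finite_subsets_at_top J)"
    by (rule Lim_transform_eventually[OF tendsto_const])
  moreover have "\<forall>j\<in>J. h j \<in> H j"
    using assms by (simp add: h_def)
  ultimately show ?thesis
    unfolding hilbert_sum_def using assms(3) by (intro CollectI conjI exI[of _ h]) simp_all
qed

text \<open>The coefficient of f against a vector of the i-th frame is that of its component h i.
  Summing over \<Gamma> gives the squared norm of h i, and summing over J that of f; nonnegativity
  turns the iterated sum into a sum over the product.\<close>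

lemma parseval_frame_hilbert_sum:
  assumes orth: "orthogonal_family M J H" and J: "countable J"
    and L2: "\<And>i. i \<in> J \<Longrightarrow> H i \<subseteq> L2 M" and zero: "\<And>i. i \<in> J \<Longrightarrow> (\<lambda>x. 0) \<in> H i"
    and frame: "\<And>i. i \<in> J \<Longrightarrow> parseval_frame M (H i) \<Gamma> (F i)"
  shows "parseval_frame M (hilbert_sum M J H) (J \<times> \<Gamma>) (\<lambda>(i, \<gamma>). F i \<gamma>)"
  unfolding parseval_frame_def
proof (intro conjI ballI)
  show "countable (J \<times> \<Gamma>)"
  \<comment> \<open>Countability of \<Gamma> is known only through one of the frames, and there is
    none if J is empty.\<close>
  proof (cases "J = {}")
    case False
    then obtain i where "i \<in> J"
      by blast
    then show ?thesis
      using J frame[of i] by (simp add: parseval_frame_def)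
  qed simp
next
  fix p assume "p \<in> J \<times> \<Gamma>"
  then obtain i \<gamma> where p: "p = (i, \<gamma>)" "i \<in> J" "\<gamma> \<in> \<Gamma>"
    by blast
  then have "F i \<gamma> \<in> H i"
    using frame[of i] by (simp add: parseval_frame_def)
  then show "(case p of (i, \<gamma>) \<Rightarrow> F i \<gamma>) \<in> hilbert_sum M J H"
    using L2[OF p(2)] zero p by (auto intro!: hilbert_sum_component)
next
  fix f assume "f \<in> hilbert_sum M J H"
  then obtain h where f: "f \<in> L2 M" and h: "\<And>i. i \<in> J \<Longrightarrow> h i \<in> H i"
    and lim: "((\<lambda>F. l2_norm M (\<lambda>x. f x - (\<Sum>i\<in>F. h i x))) \<longlongrightarrow> 0) (finite_subsets_at_top J)"
    unfolding hilbert_sum_def by blast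
  note sums = hilbert_sum_norm[OF orth L2 f h lim]
  let ?c = "\<lambda>p. (cmod (l2_inner M f (case p of (i, \<gamma>) \<Rightarrow> F i \<gamma>)))\<^sup>2"
  have inner: "((\<lambda>\<gamma>. ?c (i, \<gamma>)) has_sum (l2_norm M (h i))\<^sup>2) \<Gamma>" if i: "i \<in> J" for i
  proof -
    have "((\<lambda>\<gamma>. (cmod (l2_inner M (h i) (F i \<gamma>)))\<^sup>2) has_sum (l2_norm M (h i))\<^sup>2) \<Gamma>"
      using frame[OF i] h[OF i] by (simp add: parseval_frame_def)
    moreover have "l2_inner M f (F i \<gamma>) = l2_inner M (h i) (F i \<gamma>)" if "\<gamma> \<in> \<Gamma>" for \<gamma>
      using frame[OF i] that
      by (intro hilbert_sum_inner[OF orth L2 f h lim i]) (simp_all add: parseval_frame_def)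
    ultimately show ?thesis
      by (simp cong: has_sum_cong)
  qed
  show "(?c has_sum (l2_norm M f)\<^sup>2) (J \<times> \<Gamma>)"
  proof (rule has_sum_SigmaI[OF inner sums])
    show "?c summable_on J \<times> \<Gamma>"
      using sums by (intro summable_on_SigmaI[OF inner]) (auto simp: summable_on_def)
  qed
qed

section \<open>Parseval frames from dilated translates\<close>

context plancherel_setting
begin

lemma H_space_L2: "H_space G P j u \<subseteq> L2 (haar G)"
  by (auto simp: H_space_def)

text \<open>\<open>P\<close> need not send the zero function to the zero field literally; its
  linearity with both scalars 0 gives vanishing coefficients almost everywhere.\<close>

lemma zero_H_space:
  assumes "k \<in> I"
  shows "(\<lambda>m. 0) \<in> H_space G P j (e k)"
proof -
  have "AE l in \<mu>. \<forall>k\<in>I. \<forall>i\<in>I. coef (\<lambda>m. 0) k i l = 0"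
    using coef_linear[OF L2_zero L2_zero, of 0 0] by simp
  then have "AE l in \<mu>. \<forall>k'\<in>I. \<forall>i\<in>I. k' \<noteq> k \<or> l \<notin> E_scaled G j \<longrightarrow> coef (\<lambda>m. 0) k' i l = 0"
    by eventually_elim blast
  then show ?thesis
    unfolding H_space_iff[OF assms] by simp
qed

text \<open>Stated for any subset S of \<open>I\<close>, so that both claims of the theorem are
  instances, the second with S = \<open>I\<close>. The final reindexing only reorders the
  triples.\<close>

lemma parseval_frame_dilates:
  assumes S: "S \<subseteq> I"
    and frame: "\<And>k. k \<in> S \<Longrightarrow> parseval_frame (haar G) (H_space G P 0 (e k)) \<Gamma> (F k)"
  shows "parseval_frame (haar G)
    (hilbert_sum (haar G) (S \<times> (UNIV :: int set)) (\<lambda>(k, j). H_space G P j (e k)))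
    (\<Gamma> \<times> (UNIV :: int set) \<times> S) (\<lambda>(\<gamma>, j, k). dilation G j (F k \<gamma>))"
proof -
  let ?H = "\<lambda>(k, j). H_space G P j (e k)"
  have "parseval_frame (haar G) (hilbert_sum (haar G) (S \<times> (UNIV :: int set)) ?H)
      ((S \<times> UNIV) \<times> \<Gamma>) (\<lambda>(p, \<gamma>). (\<lambda>(k, j) \<gamma>. dilation G j (F k \<gamma>)) p \<gamma>)"
  proof (rule parseval_frame_hilbert_sum[OF H_space_orthogonal[OF S]])
    show "countable (S \<times> (UNIV :: int set))"
      using countable_subset[OF S countable_I] by simp
    fix p assume "p \<in> S \<times> (UNIV :: int set)"
    then obtain k j where p: "p = (k, j)" and k: "k \<in> S" "k \<in> I"
      using S by blast
    show "?H p \<subseteq> L2 (haar G)" "(\<lambda>x. 0) \<in> ?H p"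
      unfolding p using H_space_L2 zero_H_space[OF k(2)] by simp_all
    show "parseval_frame (haar G) (?H p) \<Gamma> ((\<lambda>(k, j) \<gamma>. dilation G j (F k \<gamma>)) p)"
      unfolding p using parseval_frame_dilation[OF k(2) frame[OF k(1)]] by simp
  qed
  moreover have "bij_betw (\<lambda>(\<gamma>, j, k). ((k, j), \<gamma>)) (\<Gamma> \<times> (UNIV :: int set) \<times> S) ((S \<times> UNIV) \<times> \<Gamma>)"
    by (rule bij_betw_byWitness[where f' = "\<lambda>((k, j), \<gamma>). (\<gamma>, j, k)"]) auto
  ultimately have "parseval_frame (haar G) (hilbert_sum (haar G) (S \<times> (UNIV :: int set)) ?H)
      (\<Gamma> \<times> (UNIV :: int set) \<times> S)
      (\<lambda>q. (\<lambda>(p, \<gamma>). (\<lambda>(k, j) \<gamma>. dilation G j (F k \<gamma>)) p \<gamma>) ((\<lambda>(\<gamma>, j, k). ((k, j), \<gamma>)) q))"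
    by (rule parseval_frame_reindex)
  then show ?thesis
    by (simp add: case_prod_unfold)
qed

lemma hilbert_sum_H_space:
  "hilbert_sum (haar G) (I \<times> (UNIV :: int set)) (\<lambda>(k, j). H_space G P j (e k)) = L2 (haar G)"
  using L2_orthogonal_components by (auto simp: hilbert_sum_def)

end

theorem theorem24:
  fixes G :: "('g, 'n::real_vector, 'z::{finite,linorder}, 'd::{finite,linorder}) nilpotent_group"
    and P :: "('g \<Rightarrow> complex) \<Rightarrow> real^'z::{finite,linorder} \<Rightarrow> 'd::{finite,linorder} oper"
    and I :: "'i set"
    and e :: "'i \<Rightarrow> real^'d::{finite,linorder} \<Rightarrow> complex"
  assumes "nilpotent_setting G"
    and "plancherel_transform G P"
    and "infinite I" and "countable I"
    and "orthonormal_basis lborel I e"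
  shows "(\<forall>(S :: 'i set) (f :: 'i \<Rightarrow> 'g \<Rightarrow> complex).
            finite S \<longrightarrow> S \<subseteq> I \<longrightarrow>
            (\<forall>k\<in>S. parseval_frame (haar G) (H_space G P 0 (e k))
                      (Gamma_set G) (\<lambda>\<gamma>. left_translation G \<gamma> (f k))) \<longrightarrow>
            orthogonal_family (haar G) (S \<times> (UNIV :: int set)) (\<lambda>(k, j). H_space G P j (e k)) \<and>
            parseval_frame (haar G)
              (hilbert_sum (haar G) (S \<times> (UNIV :: int set)) (\<lambda>(k, j). H_space G P j (e k)))
              (Gamma_set G \<times> (UNIV :: int set) \<times> S)
              (\<lambda>(\<gamma>, j, k). dilation G j (left_translation G \<gamma> (f k))))
       \<and> (\<forall>f :: 'i \<Rightarrow> 'g \<Rightarrow> complex.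
            (\<forall>k\<in>I. parseval_frame (haar G) (H_space G P 0 (e k))
                      (Gamma_set G) (\<lambda>\<gamma>. left_translation G \<gamma> (f k))) \<longrightarrow>
            parseval_frame (haar G) (L2 (haar G))
              (Gamma_set G \<times> (UNIV :: int set) \<times> I)
              (\<lambda>(\<gamma>, j, k). dilation G j (left_translation G \<gamma> (f k))))"
proof -
  interpret plancherel_setting G P I e
    by unfold_locales (fact assms)+
  show ?thesis
  proof (intro conjI allI impI)
    fix S and f :: "'i \<Rightarrow> 'g \<Rightarrow> complex"
    assume S: "S \<subseteq> I" and frame: "\<forall>k\<in>S. parseval_frame (haar G) (H_space G P 0 (e k))
      (Gamma_set G) (\<lambda>\<gamma>. left_translation G \<gamma> (f k))"
    show "orthogonal_family (haar G) (S \<times> (UNIV :: int set)) (\<lambda>(k, j). H_space G P j (e k))"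
      by (rule H_space_orthogonal[OF S])
    show "parseval_frame (haar G)
        (hilbert_sum (haar G) (S \<times> (UNIV :: int set)) (\<lambda>(k, j). H_space G P j (e k)))
        (Gamma_set G \<times> (UNIV :: int set) \<times> S)
        (\<lambda>(\<gamma>, j, k). dilation G j (left_translation G \<gamma> (f k)))"
      by (rule parseval_frame_dilates[OF S]) (use frame in blast)
  next
    fix f :: "'i \<Rightarrow> 'g \<Rightarrow> complex"
    assume frame: "\<forall>k\<in>I. parseval_frame (haar G) (H_space G P 0 (e k))
      (Gamma_set G) (\<lambda>\<gamma>. left_translation G \<gamma> (f k))"
    have "parseval_frame (haar G)
        (hilbert_sum (haar G) (I \<times> (UNIV :: int set)) (\<lambda>(k, j). H_space G P j (e k)))
        (Gamma_set G \<times> (UNIV :: int set) \<times> I)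
        (\<lambda>(\<gamma>, j, k). dilation G j (left_translation G \<gamma> (f k)))"
      by (rule parseval_frame_dilates[OF order_refl]) (use frame in blast)
    then show "parseval_frame (haar G) (L2 (haar G))
        (Gamma_set G \<times> (UNIV :: int set) \<times> I)
        (\<lambda>(\<gamma>, j, k). dilation G j (left_translation G \<gamma> (f k)))"
      unfolding hilbert_sum_H_space .
  qed
qed

end
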